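(* Let $P\in\mathbb{C}[\xi_1,\ldots,\xi_d]$ and let $X\subseteq\mathbb{R}^d$ be open and convex. Then $\mathscr{E}_P(X)=\{f\in\mathscr{E}(X) : P(D)f=0\}$ satisfies $(\Omega)$.
   Context: $\mathscr{E}(X)$ is the Fréchet space of smooth complex-valued functions on the open set $X$. $P(D)=P(-i\frac{\partial}{\partial x_1},\ldots,-i\frac{\partial}{\partial x_d})$. $\mathscr{E}_P(X)$ carries the relative topology of $\mathscr{E}(X)$ and is a Fréchet space. A Fréchet space $E$ satisfies $(\Omega)$ if, with $\mathscr{U}_0(E)$ denoting the absolutely convex neighborhoods of $0$ in $E$, $$\forall U\in\mathscr{U}_0(E)\ \exists V\in\mathscr{U}_0(E)\ \forall W\in\mathscr{U}_0(E)\ \exists C,s>0\ \forall\varepsilon\in(0,1):\quad V\subseteq\varepsilon U+\frac{C}{\varepsilon^s}W.$$ *)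

theory Defs
  imports "HOL-Analysis.Analysis" "HOL-Library.Poly_Mapping" "HOL-Library.Function_Algebras"
begin

section \<open>Absolutely convex neighbourhoods and the condition \<open>(\<Omega>)\<close>\<close>

text \<open>
  A complex topological vector space is given by a topology \<open>T\<close> whose \<open>topspace\<close> is a linear
  subspace of an ambient vector space with scalar multiplication \<open>smul\<close>.
  The conditions below are used only for such spaces; that they are Frechet is not built in.
\<close>

definition absolutely_convex :: "(complex \<Rightarrow> 'v \<Rightarrow> 'v) \<Rightarrow> 'v::ab_group_add set \<Rightarrow> bool" where
  "absolutely_convex smul A \<longleftrightarrow>
     (\<forall>x\<in>A. \<forall>y\<in>A. \<forall>a b. norm a + norm b \<le> 1 \<longrightarrow> smul a x + smul b y \<in> A)"

definition abs_convex_nhds0 ::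
    "(complex \<Rightarrow> 'v \<Rightarrow> 'v) \<Rightarrow> 'v::ab_group_add topology \<Rightarrow> 'v set set" where
  "abs_convex_nhds0 smul T =
     {U. U \<subseteq> topspace T \<and> absolutely_convex smul U \<and> (\<exists>G. openin T G \<and> 0 \<in> G \<and> G \<subseteq> U)}"

definition satisfies_Omega ::
    "(complex \<Rightarrow> 'v \<Rightarrow> 'v) \<Rightarrow> 'v::ab_group_add topology \<Rightarrow> bool" where
  "satisfies_Omega smul T \<longleftrightarrow>
     (\<forall>U\<in>abs_convex_nhds0 smul T. \<exists>V\<in>abs_convex_nhds0 smul T. \<forall>W\<in>abs_convex_nhds0 smul T.
        \<exists>C s :: real. C > 0 \<and> s > 0 \<and>
          (\<forall>\<epsilon>\<in>{0<..<1}.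
             V \<subseteq> {smul (of_real \<epsilon>) u + smul (of_real (C / \<epsilon> powr s)) w | u w. u \<in> U \<and> w \<in> W}))"

section \<open>Smooth functions\<close>

definition partial_derivative :: "'n \<Rightarrow> (real^'n::finite \<Rightarrow> complex) \<Rightarrow> real^'n \<Rightarrow> complex" where
  "partial_derivative i f x = vector_derivative (\<lambda>t. f (x + t *\<^sub>R axis i 1)) (at 0)"

fun iter_partial :: "'n list \<Rightarrow> (real^'n::finite \<Rightarrow> complex) \<Rightarrow> real^'n \<Rightarrow> complex" where
  "iter_partial [] f = f"
| "iter_partial (i # js) f = partial_derivative i (iter_partial js f)"

text \<open>All iterated partial derivatives, in any order, exist and are continuous (for open \<open>X\<close>).\<close>

definition smooth_on :: "(real^'n::finite) set \<Rightarrow> (real^'n \<Rightarrow> complex) \<Rightarrow> bool" where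
  "smooth_on X f \<longleftrightarrow>
     (\<forall>js. continuous_on X (iter_partial js f) \<and>
        (\<forall>i. \<forall>x\<in>X. (\<lambda>t::real. iter_partial js f (x + t *\<^sub>R axis i 1)) differentiable (at 0)))"

text \<open>
  A function on \<open>X\<close> is represented by its extension by zero to the whole space, so that
  equality in the function type is equality on \<open>X\<close>. As \<open>X\<close> is open, derivatives at points of
  \<open>X\<close> are unaffected.
\<close>

definition smooth_functions :: "(real^'n::finite) set \<Rightarrow> (real^'n \<Rightarrow> complex) set" where
  "smooth_functions X = {f. smooth_on X f \<and> (\<forall>x. x \<notin> X \<longrightarrow> f x = 0)}"

text \<open>Uniform convergence of all derivatives on compact subsets of \<open>X\<close>.\<close>

definition smooth_topology :: "(real^'n::finite) set \<Rightarrow> (real^'n \<Rightarrow> complex) topology" where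
  "smooth_topology X = topology_generated_by
     {{g \<in> smooth_functions X.
         \<forall>js. length js \<le> m \<longrightarrow> (\<forall>x\<in>K. norm (iter_partial js g x - iter_partial js f x) < e)}
      | f K m e. f \<in> smooth_functions X \<and> compact K \<and> K \<subseteq> X \<and> e > (0::real)}"

section \<open>Constant coefficient differential operators\<close>

text \<open>
  Polynomials in the variables \<open>\<xi>\<^sub>i\<close>, \<open>i :: 'n\<close>, are finitely supported maps from
  multi-indices (exponent vectors) to coefficients.
\<close>

type_synonym 'n cpoly = "('n \<Rightarrow>\<^sub>0 nat) \<Rightarrow>\<^sub>0 complex"

text \<open>
  The derivatives along \<open>\<alpha>\<close> are taken in some fixed order, since the type \<open>'n\<close> carries no
  ordering; by Schwarz's theorem the order is immaterial for smooth functions.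
\<close>

definition multi_index_list :: "('n::finite \<Rightarrow>\<^sub>0 nat) \<Rightarrow> 'n list" where
  "multi_index_list \<alpha> = (SOME js. \<forall>i. count_list js i = Poly_Mapping.lookup \<alpha> i)"

definition D_op :: "'n \<Rightarrow> (real^'n::finite \<Rightarrow> complex) \<Rightarrow> real^'n \<Rightarrow> complex" where
  "D_op i f = (\<lambda>x. - \<i> * partial_derivative i f x)"

definition D_power :: "('n \<Rightarrow>\<^sub>0 nat) \<Rightarrow> (real^'n::finite \<Rightarrow> complex) \<Rightarrow> real^'n \<Rightarrow> complex" where
  "D_power \<alpha> f = foldr D_op (multi_index_list \<alpha>) f"

definition diff_op :: "'n cpoly \<Rightarrow> (real^'n::finite \<Rightarrow> complex) \<Rightarrow> real^'n \<Rightarrow> complex" where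
  "diff_op P f x = (\<Sum>\<alpha>\<in>Poly_Mapping.keys P. Poly_Mapping.lookup P \<alpha> * D_power \<alpha> f x)"

definition kernel_space ::
    "'n cpoly \<Rightarrow> (real^'n::finite) set \<Rightarrow> (real^'n \<Rightarrow> complex) set" where
  "kernel_space P X = {f \<in> smooth_functions X. \<forall>x\<in>X. diff_op P f x = 0}"

definition kernel_topology ::
    "'n cpoly \<Rightarrow> (real^'n::finite) set \<Rightarrow> (real^'n \<Rightarrow> complex) topology" where
  "kernel_topology P X = subtopology (smooth_topology X) (kernel_space P X)"

definition fun_scale :: "complex \<Rightarrow> ('a \<Rightarrow> complex) \<Rightarrow> 'a \<Rightarrow> complex" where
  "fun_scale c f = (\<lambda>x. c * f x)"

lemma multi_index_list_count: "count_list (multi_index_list \<alpha>) i = Poly_Mapping.lookup \<alpha> i"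
proof -
  obtain xs where xs: "set xs = (UNIV :: 'a set)" "distinct xs"
    using finite_distinct_list[OF finite[of "UNIV :: 'a set"]] by blast
  have rep: "count_list (replicate n j) k = (if j = k then n else 0)" for n and j k :: 'a
    by (induction n) auto
  have "distinct ys \<Longrightarrow>
      count_list (concat (map (\<lambda>j. replicate (Poly_Mapping.lookup \<alpha> j) j) ys)) k =
        (if k \<in> set ys then Poly_Mapping.lookup \<alpha> k else 0)" for ys k
    by (induction ys) (auto simp: rep)
  with xs have "\<forall>k. count_list (concat (map (\<lambda>j. replicate (Poly_Mapping.lookup \<alpha> j) j) xs)) k = Poly_Mapping.lookup \<alpha> k"
    by auto
  then have "\<forall>i. count_list (multi_index_list \<alpha>) i = Poly_Mapping.lookup \<alpha> i"
    unfolding multi_index_list_def by (rule someI)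
  then show ?thesis by blast
qed

lemma topspace_smooth_topology: "topspace (smooth_topology X) = smooth_functions X"
proof -
  have "smooth_functions X \<subseteq> topspace (smooth_topology X)"
  proof
    fix f assume "f \<in> smooth_functions X"
    then show "f \<in> topspace (smooth_topology X)"
      unfolding smooth_topology_def topology_generated_by_topspace
      by (intro UnionI[of "{g \<in> smooth_functions X. \<forall>js. length js \<le> 0 \<longrightarrow>
            (\<forall>x\<in>{}. norm (iter_partial js g x - iter_partial js f x) < 1)}"])
        (auto intro!: exI[of _ f] exI[of _ "{}"] exI[of _ "0::nat"] exI[of _ "1::real"])
  qed
  moreover have "topspace (smooth_topology X) \<subseteq> smooth_functions X"
    unfolding smooth_topology_def topology_generated_by_topspace by auto
  ultimately show ?thesis by blast
qed

end

theory Submission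
  imports Defs "HOL-Probability.Sinc_Integral" "HOL-Probability.Characteristic_Functions"
begin

text \<open>
  The proof splits a solution by a cut-off and repairs the cut-off with solutions that carry an
  exponential weight.

  Let \<open>K0 \<subseteq> X\<close> be the compact set on which smallness is required. Convexity gives finitely many
  affine functions \<open>a k\<close> with \<open>a k \<le> 0\<close> on \<open>K0\<close> whose polytope \<open>L = {a k \<le> 1 for all k}\<close> is a
  compact subset of \<open>X\<close> (\<open>polytope_neighbourhood\<close>). Let \<open>\<theta>\<close> be a cut-off with support in \<open>L\<close> that
  is 1 where all \<open>a k < 2/3\<close>. If \<open>P(D) f = 0\<close> then \<open>P(D) (\<theta> f)\<close> vanishes where all \<open>a k < 2/3\<close>, so a
  partition of unity writes it as a sum of \<open>g k\<close> supported in \<open>{a k \<ge> 1/3} \<inter> L\<close>. The equation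
  \<open>P(D) h = g k\<close> has, for every \<open>t \<ge> 0\<close>, a solution \<open>h k\<close> on the whole space of size at most a
  constant times \<open>exp (t (a k - 1/3))\<close>, with the constant independent of \<open>t\<close>
  (\<open>exponentially_weighted_solution\<close>). Then \<open>w = \<theta> f - \<Sum>k. h k\<close> solves \<open>P(D) w = 0\<close> on the whole
  space, differs from \<open>f\<close> on \<open>K0\<close> by at most \<open>const * exp (- t/3)\<close>, and grows at most like
  \<open>exp (c t)\<close> on any other compact set. Choosing \<open>t\<close> proportional to \<open>ln (1/\<epsilon>)\<close> gives exactly the
  trade-off between \<open>\<epsilon>\<close> and \<open>\<epsilon> powr - s\<close> that \<open>(\<Omega>)\<close> asks for.

  The weighted solutions come from an explicit formula of Koenig and Wagner. For a real vector \<open>\<eta>\<close> the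
  superposition of the exponentials \<open>exp ((\<eta> + \<i> \<xi>) \<bullet> x)\<close> with amplitude \<open>cnj p / p * g^\<close>, where \<open>p\<close> is the
  symbol and \<open>g^\<close> the Fourier--Laplace transform of \<open>g\<close>, both at \<open>\<eta> + \<i> \<xi>\<close>, is mapped by \<open>P(D)\<close> to the
  superposition with amplitude \<open>cnj p * g^\<close>. The quotient \<open>cnj p / p\<close> is bounded by 1 whatever the zeros
  of \<open>p\<close>, so the formula obeys bounds uniform in \<open>\<eta>\<close>. As \<open>cnj (\<eta> + \<i> \<xi>) = 2 \<eta> - (\<eta> + \<i> \<xi>)\<close>, the result is a differential operator applied to
  \<open>g\<close> whose coefficients are polynomials in \<open>\<eta>\<close>; a finite difference in \<open>\<eta>\<close> of the right order
  removes everything except a non-zero multiple of \<open>g\<close> (\<open>koenig_identity\<close>). Moving the difference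
  grid to \<open>t \<eta>\<close> produces the weight.

  There is one loss: the bound on \<open>m\<close> derivatives of \<open>w\<close> uses more than \<open>m\<close> derivatives of \<open>f\<close>,
  whereas in \<open>(\<Omega>)\<close> the neighbourhood \<open>V\<close> is fixed before \<open>W\<close>. Hence \<open>f\<close> is first
  mollified on the scale \<open>\<delta>\<close> proportional to \<open>\<epsilon>\<close>: this costs an error of order \<open>\<delta>\<close> on \<open>K0\<close> and turns
  higher derivatives into powers of \<open>1/\<delta>\<close>, which the weight absorbs (\<open>mollification\<close>,
  \<open>solution_decomposition\<close>).
\<close>

section \<open>Partial derivatives and smooth functions\<close>

text \<open>
  Unlike \<open>partial_derivative\<close>, which is total and arbitrary where the limit fails to exist, this
  predicate asserts differentiability and can be composed by derivative rules.
\<close>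

definition has_partial :: "'n \<Rightarrow> (real^'n::finite \<Rightarrow> complex) \<Rightarrow> complex \<Rightarrow> real^'n \<Rightarrow> bool" where
  "has_partial i f d x \<longleftrightarrow> ((\<lambda>t. f (x + t *\<^sub>R axis i 1)) has_vector_derivative d) (at 0)"

lemma has_partial_unique: "has_partial i f d x \<Longrightarrow> partial_derivative i f x = d"
  unfolding has_partial_def partial_derivative_def by (rule vector_derivative_at)

lemma has_partial_at:
  assumes "has_partial i f d (x + s *\<^sub>R axis i 1)"
  shows "((\<lambda>t. f (x + t *\<^sub>R axis i 1)) has_vector_derivative d) (at s)"
proof -
  have "((\<lambda>t. f (x + s *\<^sub>R axis i 1 + t *\<^sub>R axis i 1)) has_vector_derivative d) (at (s - s))"
    using assms by (simp add: has_partial_def)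
  moreover have "((\<lambda>t. t - s) has_vector_derivative 1) (at s)"
    by (auto intro!: derivative_eq_intros)
  ultimately have "((\<lambda>t. f (x + s *\<^sub>R axis i 1 + (t - s) *\<^sub>R axis i 1)) has_vector_derivative d) (at s)"
    using vector_diff_chain_at[where f="\<lambda>t. t - s" and f'=1] by (force simp: o_def)
  then show ?thesis by (simp add: algebra_simps scaleR_left_diff_distrib)
qed

lemma has_partial_cong_open:
  assumes "open X" "x \<in> X" "\<And>y. y \<in> X \<Longrightarrow> f y = g y"
  shows "has_partial i f d x \<longleftrightarrow> has_partial i g d x"
proof -
  have "((\<lambda>t. x + t *\<^sub>R axis i 1) \<longlongrightarrow> x + 0 *\<^sub>R axis i 1) (at (0::real))"
    by (intro tendsto_intros)
  then have "eventually (\<lambda>t. x + t *\<^sub>R axis i 1 \<in> X) (at (0::real))"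
    using topological_tendstoD[OF _ assms(1)] assms(2) by fastforce
  then have "eventually (\<lambda>t. f (x + t *\<^sub>R axis i 1) = g (x + t *\<^sub>R axis i 1)) (at (0::real))"
    by eventually_elim (use assms in auto)
  then have ev: "eventually (\<lambda>t. f (x + t *\<^sub>R axis i 1) = g (x + t *\<^sub>R axis i 1)) (nhds (0::real))"
    using assms by (auto simp: eventually_nhds_conv_at)
  show ?thesis unfolding has_partial_def by (rule has_vector_derivative_cong_ev) (use ev assms in auto)
qed

lemma partial_derivative_cong_open:
  assumes "open X" "x \<in> X" "\<And>y. y \<in> X \<Longrightarrow> f y = g y"
  shows "partial_derivative i f x = partial_derivative i g x"
proof -
  have "has_partial i f d x = has_partial i g d x" for d
    by (rule has_partial_cong_open[OF assms])
  then show ?thesis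
    unfolding partial_derivative_def vector_derivative_def has_partial_def by simp
qed

lemma iter_partial_cong_open:
  assumes "open X" "x \<in> X" "\<And>y. y \<in> X \<Longrightarrow> f y = g y"
  shows "iter_partial js f x = iter_partial js g x"
  using assms(2)
proof (induction js arbitrary: x)
  case (Cons i js)
  show ?case unfolding iter_partial.simps
    by (rule partial_derivative_cong_open[OF assms(1) Cons.prems Cons.IH])
qed (use assms in auto)

lemma iter_partial_append: "iter_partial (js @ ks) f = iter_partial js (iter_partial ks f)"
  by (induction js) auto

lemma smooth_on_has_partial:
  assumes "smooth_on X f" "x \<in> X"
  shows "has_partial i (iter_partial js f) (iter_partial (i # js) f x) x"
  using assms unfolding smooth_on_def has_partial_def iter_partial.simps partial_derivative_def
  using vector_derivative_works by blast

lemma smooth_on_has_partial0: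
  assumes "smooth_on X f" "x \<in> X"
  shows "has_partial i f (partial_derivative i f x) x"
  using smooth_on_has_partial[OF assms, of i "[]"] by simp

lemma smooth_on_continuous: "smooth_on X f \<Longrightarrow> continuous_on X (iter_partial js f)"
  unfolding smooth_on_def by blast

lemma smooth_on_continuous0: "smooth_on X f \<Longrightarrow> continuous_on X f"
  using smooth_on_continuous[of X f "[]"] by simp

lemma smooth_on_iter: "smooth_on X f \<Longrightarrow> smooth_on X (iter_partial js f)"
  unfolding smooth_on_def iter_partial_append[symmetric] by blast

lemma smooth_on_partial: "smooth_on X f \<Longrightarrow> smooth_on X (partial_derivative i f)"
  using smooth_on_iter[of X f "[i]"] by simp

lemma smooth_on_subset: "smooth_on X f \<Longrightarrow> Y \<subseteq> X \<Longrightarrow> smooth_on Y f"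
  unfolding smooth_on_def by (meson continuous_on_subset subsetD)

text \<open>
  All iterated derivatives are controlled by finding a class of continuous functions that is stable
  under each partial derivative. Agreement on \<open>X\<close> suffices because \<open>X\<close> is open.
\<close>

lemma smooth_on_coinduct:
  assumes X: "open X" and f: "f \<in> S"
    and cont: "\<And>f. f \<in> S \<Longrightarrow> continuous_on X f"
    and part: "\<And>f i. f \<in> S \<Longrightarrow> \<exists>f'\<in>S. \<forall>x\<in>X. has_partial i f (f' x) x"
  shows "smooth_on X f"
proof -
  have *: "\<exists>g\<in>S. \<forall>x\<in>X. iter_partial js f x = g x" for js
  proof (induction js)
    case (Cons i js)
    then obtain g where g: "g \<in> S" "\<forall>x\<in>X. iter_partial js f x = g x" by blast
    obtain g' where g': "g' \<in> S" "\<forall>x\<in>X. has_partial i g (g' x) x" using part[OF g(1)] by blast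
    have "has_partial i (iter_partial js f) (g' x) x" if "x \<in> X" for x
      using has_partial_cong_open[OF X that, of "iter_partial js f" g] g g' that by blast
    then have "\<forall>x\<in>X. iter_partial (i # js) f x = g' x" by (simp add: has_partial_unique)
    then show ?case using g'(1) by blast
  qed (use f in auto)
  show ?thesis unfolding smooth_on_def
  proof (intro allI conjI ballI)
    fix js
    obtain g where g: "g \<in> S" "\<forall>x\<in>X. iter_partial js f x = g x" using * by blast
    show "continuous_on X (iter_partial js f)"
      using continuous_on_cong[of X X g "iter_partial js f"] g cont by auto
    fix i x assume x: "x \<in> X"
    obtain g' where g': "g' \<in> S" "\<forall>x\<in>X. has_partial i g (g' x) x" using part[OF g(1)] by blast
    have "has_partial i (iter_partial js f) (g' x) x"
      using has_partial_cong_open[OF X x, of "iter_partial js f" g] g g' x by blast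
    then show "(\<lambda>t. iter_partial js f (x + t *\<^sub>R axis i 1)) differentiable at 0"
      unfolding has_partial_def using differentiableI_vector by blast
  qed
qed

lemma smooth_on_cong:
  assumes X: "open X" and f: "smooth_on X f" and eq: "\<And>x. x \<in> X \<Longrightarrow> f x = g x"
  shows "smooth_on X g"
proof (rule smooth_on_coinduct[OF X, of _ "{h. \<exists>js. \<forall>x\<in>X. h x = iter_partial js f x}"])
  show "g \<in> {h. \<exists>js. \<forall>x\<in>X. h x = iter_partial js f x}" using eq by (auto intro!: exI[of _ "[]"])
next
  fix h assume "h \<in> {h. \<exists>js. \<forall>x\<in>X. h x = iter_partial js f x}"
  then obtain js where js: "\<forall>x\<in>X. h x = iter_partial js f x" by blast
  show "continuous_on X h"
    using continuous_on_cong[of X X h "iter_partial js f"] js smooth_on_continuous[OF f] by auto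
  fix i
  show "\<exists>f'\<in>{h. \<exists>js. \<forall>x\<in>X. h x = iter_partial js f x}. \<forall>x\<in>X. has_partial i h (f' x) x"
  proof (intro bexI ballI)
    fix x assume "x \<in> X"
    then show "has_partial i h (iter_partial (i # js) f x) x"
      using has_partial_cong_open[OF X, of x h "iter_partial js f"] js smooth_on_has_partial[OF f] by blast
  qed blast
qed

lemma smooth_on_open_Union:
  assumes "\<And>x. x \<in> X \<Longrightarrow> \<exists>Y. open Y \<and> x \<in> Y \<and> smooth_on Y f"
  shows "smooth_on X f"
  unfolding smooth_on_def
proof (intro allI conjI ballI)
  fix js
  show "continuous_on X (iter_partial js f)"
  proof (rule continuous_at_imp_continuous_on, rule ballI)
    fix x assume "x \<in> X"
    then obtain Y where "open Y" "x \<in> Y" "smooth_on Y f" using assms by blast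
    then show "isCont (iter_partial js f) x"
      using smooth_on_continuous continuous_on_eq_continuous_at by blast
  qed
  fix i x assume "x \<in> X"
  then obtain Y where "open Y" "x \<in> Y" "smooth_on Y f" using assms by blast
  then show "(\<lambda>t. iter_partial js f (x + t *\<^sub>R axis i 1)) differentiable at 0"
    unfolding smooth_on_def by blast
qed

lemma has_partial_const: "has_partial i (\<lambda>x. c) 0 x"
  unfolding has_partial_def by (auto intro!: derivative_eq_intros)

lemma has_partial_add:
  "has_partial i f a x \<Longrightarrow> has_partial i g b x \<Longrightarrow> has_partial i (\<lambda>x. f x + g x) (a + b) x"
  unfolding has_partial_def by (auto intro!: derivative_eq_intros)

lemma has_partial_mult:
  "has_partial i f a x \<Longrightarrow> has_partial i g b x \<Longrightarrow>
     has_partial i (\<lambda>x. f x * g x) (a * g x + f x * b) x"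
  unfolding has_partial_def
  using has_vector_derivative_mult[of "\<lambda>t. f (x + t *\<^sub>R axis i 1)" a 0 UNIV "\<lambda>t. g (x + t *\<^sub>R axis i 1)" b]
  by (simp add: add.commute)

lemma has_partial_inverse:
  assumes "has_partial i f a x" "f x \<noteq> 0"
  shows "has_partial i (\<lambda>x. inverse (f x)) (- a * (inverse (f x) * inverse (f x))) x"
proof -
  have "((\<lambda>z. inverse z) has_field_derivative (- (inverse (f x) ^ 2))) (at (f (x + 0 *\<^sub>R axis i 1)))"
    using assms by (auto intro!: derivative_eq_intros simp: power2_eq_square)
  from field_vector_diff_chain_at[of "\<lambda>t. f (x + t *\<^sub>R axis i 1)" a 0, OF _ this] assms(1)
  have "((\<lambda>z. inverse z) \<circ> (\<lambda>t. f (x + t *\<^sub>R axis i 1)) has_vector_derivative a * - (inverse (f x) ^ 2)) (at 0)"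
    by (simp add: has_partial_def)
  then show ?thesis unfolding has_partial_def by (simp add: o_def power2_eq_square)
qed

text \<open>
  A product rule turns one product into a sum of products, so the coinduction needs a class that is
  closed under all the operations at once.
\<close>

inductive_set smooth_closure :: "(real^'n::finite) set \<Rightarrow> (real^'n \<Rightarrow> complex) set" for X where
  base: "smooth_on X f \<Longrightarrow> f \<in> smooth_closure X"
| const: "(\<lambda>x. c) \<in> smooth_closure X"
| add: "f \<in> smooth_closure X \<Longrightarrow> g \<in> smooth_closure X \<Longrightarrow> (\<lambda>x. f x + g x) \<in> smooth_closure X"
| mult: "f \<in> smooth_closure X \<Longrightarrow> g \<in> smooth_closure X \<Longrightarrow> (\<lambda>x. f x * g x) \<in> smooth_closure X"
| inv: "f \<in> smooth_closure X \<Longrightarrow> (\<And>x. x \<in> X \<Longrightarrow> f x \<noteq> 0) \<Longrightarrow> (\<lambda>x. inverse (f x)) \<in> smooth_closure X"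

lemma smooth_closure_smooth:
  assumes "open X" "f \<in> smooth_closure X"
  shows "smooth_on X f"
proof (rule smooth_on_coinduct[OF assms])
  fix f assume "f \<in> smooth_closure X"
  then show "continuous_on X f"
  proof induction
    case (base f)
    then show ?case by (rule smooth_on_continuous0)
  qed (auto intro!: continuous_intros)
next
  fix f i assume "f \<in> smooth_closure X"
  then show "\<exists>f'\<in>smooth_closure X. \<forall>x\<in>X. has_partial i f (f' x) x"
  proof induction
    case (base f)
    then show ?case
      by (intro bexI[of _ "partial_derivative i f"])
         (auto intro: smooth_on_has_partial0 smooth_closure.base smooth_on_partial)
  next
    case (const c)
    show ?case by (intro bexI[of _ "\<lambda>x. 0"]) (auto intro: has_partial_const smooth_closure.const)
  next
    case (add f g)
    then obtain f' g' where "f' \<in> smooth_closure X" "g' \<in> smooth_closure X"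
      "\<forall>x\<in>X. has_partial i f (f' x) x" "\<forall>x\<in>X. has_partial i g (g' x) x" by blast
    then show ?case
      by (intro bexI[of _ "\<lambda>x. f' x + g' x"]) (auto intro: has_partial_add smooth_closure.add)
  next
    case (mult f g)
    then obtain f' g' where "f' \<in> smooth_closure X" "g' \<in> smooth_closure X"
      "\<forall>x\<in>X. has_partial i f (f' x) x" "\<forall>x\<in>X. has_partial i g (g' x) x" by blast
    then show ?case using mult
      by (intro bexI[of _ "\<lambda>x. f' x * g x + f x * g' x"])
         (auto intro: has_partial_mult smooth_closure.add smooth_closure.mult)
  next
    case (inv f)
    then obtain f' where f': "f' \<in> smooth_closure X" "\<forall>x\<in>X. has_partial i f (f' x) x"
      by blast
    have "(\<lambda>x. - 1 * f' x * (inverse (f x) * inverse (f x))) \<in> smooth_closure X"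
      by (rule smooth_closure.mult[OF smooth_closure.mult[OF smooth_closure.const f'(1)]
        smooth_closure.mult[OF smooth_closure.inv[OF inv(1,2)] smooth_closure.inv[OF inv(1,2)]]])
    moreover have "has_partial i (\<lambda>x. inverse (f x)) (- 1 * f' x * (inverse (f x) * inverse (f x))) x"
      if "x \<in> X" for x
      using has_partial_inverse[OF bspec[OF f'(2) that] inv(2)[OF that]] by simp
    ultimately show ?case by (intro bexI ballI)
  qed
qed

lemma smooth_on_const: "open X \<Longrightarrow> smooth_on X (\<lambda>x. c)"
  by (rule smooth_closure_smooth[OF _ smooth_closure.const])

lemma smooth_on_add: "open X \<Longrightarrow> smooth_on X f \<Longrightarrow> smooth_on X g \<Longrightarrow> smooth_on X (\<lambda>x. f x + g x)"
  by (rule smooth_closure_smooth[OF _ smooth_closure.add[OF smooth_closure.base smooth_closure.base]])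

lemma smooth_on_mult: "open X \<Longrightarrow> smooth_on X f \<Longrightarrow> smooth_on X g \<Longrightarrow> smooth_on X (\<lambda>x. f x * g x)"
  by (rule smooth_closure_smooth[OF _ smooth_closure.mult[OF smooth_closure.base smooth_closure.base]])

lemma smooth_on_inverse:
  "open X \<Longrightarrow> smooth_on X f \<Longrightarrow> (\<And>x. x \<in> X \<Longrightarrow> f x \<noteq> 0) \<Longrightarrow> smooth_on X (\<lambda>x. inverse (f x))"
  by (rule smooth_closure_smooth[OF _ smooth_closure.inv[OF smooth_closure.base]])

lemma smooth_on_cmult: "open X \<Longrightarrow> smooth_on X f \<Longrightarrow> smooth_on X (\<lambda>x. c * f x)"
  by (auto intro: smooth_on_mult smooth_on_const)

lemma smooth_on_diff: "open X \<Longrightarrow> smooth_on X f \<Longrightarrow> smooth_on X g \<Longrightarrow> smooth_on X (\<lambda>x. f x - g x)"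
  using smooth_on_add[of X f "\<lambda>x. (-1) * g x"] smooth_on_cmult[of X g "-1"] by simp

lemma smooth_on_sum:
  "open X \<Longrightarrow> (\<And>i. i \<in> I \<Longrightarrow> smooth_on X (f i)) \<Longrightarrow> smooth_on X (\<lambda>x. \<Sum>i\<in>I. f i x)"
  by (induction I rule: infinite_finite_induct) (auto intro: smooth_on_const smooth_on_add)

lemma smooth_on_prod:
  "open X \<Longrightarrow> (\<And>i. i \<in> I \<Longrightarrow> smooth_on X (f i)) \<Longrightarrow> smooth_on X (\<lambda>x. \<Prod>i\<in>I. f i x)"
  by (induction I rule: infinite_finite_induct) (auto intro: smooth_on_const smooth_on_mult)

lemma iter_partial_add:
  assumes "open X" "smooth_on X f" "smooth_on X g" "x \<in> X"
  shows "iter_partial js (\<lambda>x. f x + g x) x = iter_partial js f x + iter_partial js g x"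
  using assms(4)
proof (induction js arbitrary: x)
  case (Cons i js)
  have "has_partial i (\<lambda>x. iter_partial js f x + iter_partial js g x)
     (iter_partial (i#js) f x + iter_partial (i#js) g x) x"
    by (intro has_partial_add smooth_on_has_partial[OF assms(2)] smooth_on_has_partial[OF assms(3)] Cons)
  then have "has_partial i (iter_partial js (\<lambda>x. f x + g x))
     (iter_partial (i#js) f x + iter_partial (i#js) g x) x"
    by (subst has_partial_cong_open[OF assms(1) Cons.prems Cons.IH])
  then show ?case by (simp add: has_partial_unique)
qed auto

lemma iter_partial_zero: "iter_partial js (\<lambda>x. 0) = (\<lambda>x. 0)"
  by (induction js) (auto simp: partial_derivative_def fun_eq_iff)

lemma iter_partial_cmult:
  assumes "open X" "smooth_on X f" "x \<in> X"
  shows "iter_partial js (\<lambda>x. c * f x) x = c * iter_partial js f x"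
  using assms(3)
proof (induction js arbitrary: x)
  case (Cons i js)
  have "has_partial i (\<lambda>x. c * iter_partial js f x) (0 * iter_partial js f x + c * iter_partial (i#js) f x) x"
    by (intro has_partial_mult has_partial_const smooth_on_has_partial[OF assms(2)] Cons)
  then have "has_partial i (iter_partial js (\<lambda>x. c * f x)) (c * iter_partial (i#js) f x) x"
    by (subst has_partial_cong_open[OF assms(1) Cons.prems Cons.IH]) simp_all
  then show ?case by (simp add: has_partial_unique)
qed auto

lemma iter_partial_diff:
  assumes "open X" "smooth_on X f" "smooth_on X g" "x \<in> X"
  shows "iter_partial js (\<lambda>x. f x - g x) x = iter_partial js f x - iter_partial js g x"
proof -
  have "iter_partial js (\<lambda>x. f x + (- 1) * g x) x = iter_partial js f x + (- 1) * iter_partial js g x"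
    unfolding iter_partial_add[OF assms(1,2) smooth_on_cmult[OF assms(1,3)] assms(4)]
      iter_partial_cmult[OF assms(1,3,4)] ..
  then show ?thesis by simp
qed

lemma iter_partial_sum:
  assumes "open X" "finite I" "\<And>i. i \<in> I \<Longrightarrow> smooth_on X (f i)" "x \<in> X"
  shows "iter_partial js (\<lambda>x. \<Sum>i\<in>I. f i x) x = (\<Sum>i\<in>I. iter_partial js (f i) x)"
  using assms(2,3)
proof induction
  case empty
  then show ?case using iter_partial_zero[of js] by simp
next
  case (insert i I)
  have "iter_partial js (\<lambda>x. f i x + (\<Sum>i\<in>I. f i x)) x = iter_partial js (f i) x + iter_partial js (\<lambda>x. \<Sum>i\<in>I. f i x) x"
    using insert assms by (intro iter_partial_add[of X] smooth_on_sum) auto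
  then show ?case using insert by simp
qed

section \<open>Jets\<close>

text \<open>
  The sum over words of length at most \<open>m\<close> is equivalent to the maximum in the definition of the
  topology, and behaves well under sums and products.
\<close>

definition jet :: "nat \<Rightarrow> (real^'n::finite \<Rightarrow> complex) \<Rightarrow> real^'n \<Rightarrow> real" where
  "jet m f x = (\<Sum>js | length js \<le> m. norm (iter_partial js f x))"

lemma finite_lists_le: "finite {js :: 'n::finite list. length js \<le> m}"
  using finite_lists_length_le[of "UNIV :: 'n set" m] by simp

lemma jet_nonneg: "jet m f x \<ge> 0"
  unfolding jet_def by (rule sum_nonneg) auto

lemma jet_ge: "length js \<le> m \<Longrightarrow> norm (iter_partial js f x) \<le> jet m f x"
  unfolding jet_def by (rule member_le_sum) (auto simp: finite_lists_le)

lemma jet_mono: "m \<le> n \<Longrightarrow> jet m f x \<le> jet n f x"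
  unfolding jet_def by (rule sum_mono2) (auto simp: finite_lists_le)

text \<open>
  The number of words of length at most \<open>m\<close>, hence the constant in passing from a bound on each
  derivative to a bound on the jet. The type argument fixes the alphabet.
\<close>

definition num_words :: "'n::finite itself \<Rightarrow> nat \<Rightarrow> real" where
  "num_words _ m = real (card {js :: 'n list. length js \<le> m})"

lemma num_words_ge1: "num_words TYPE('n::finite) m \<ge> 1"
proof -
  have "[] \<in> {js :: 'n list. length js \<le> m}" by simp
  then have "card {js :: 'n list. length js \<le> m} \<noteq> 0" using finite_lists_le[of m] card_0_eq by blast
  then show ?thesis unfolding num_words_def by simp
qed

lemma jet_le:
  fixes f :: "real^'n::finite \<Rightarrow> complex"
  assumes "\<And>js. length js \<le> m \<Longrightarrow> norm (iter_partial js f x) \<le> B"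
  shows "jet m f x \<le> num_words TYPE('n) m * B"
  using sum_mono[of "{js :: 'n list. length js \<le> m}" "\<lambda>js. norm (iter_partial js f x)" "\<lambda>_. B"] assms
  unfolding jet_def num_words_def by auto

lemma jet_cong_open:
  assumes "open X" "x \<in> X" "\<And>y. y \<in> X \<Longrightarrow> f y = g y"
  shows "jet m f x = jet m g x"
  unfolding jet_def using iter_partial_cong_open[OF assms] by simp

lemma jet_zero: "jet m (\<lambda>x. 0) x = 0"
  unfolding jet_def by (simp add: iter_partial_zero)

lemma jet_add:
  assumes "open X" "smooth_on X f" "smooth_on X g" "x \<in> X"
  shows "jet m (\<lambda>x. f x + g x) x \<le> jet m f x + jet m g x"
  unfolding jet_def sum.distrib[symmetric]
  by (rule sum_mono) (simp add: iter_partial_add[OF assms] norm_triangle_ineq)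

lemma jet_diff:
  assumes "open X" "smooth_on X f" "smooth_on X g" "x \<in> X"
  shows "jet m (\<lambda>x. f x - g x) x \<le> jet m f x + jet m g x"
  unfolding jet_def sum.distrib[symmetric]
  by (rule sum_mono) (simp add: iter_partial_diff[OF assms] norm_triangle_ineq4)

lemma jet_cmult:
  assumes "open X" "smooth_on X f" "x \<in> X"
  shows "jet m (\<lambda>x. c * f x) x = norm c * jet m f x"
  unfolding jet_def sum_distrib_left
  by (rule sum.cong) (simp_all add: iter_partial_cmult[OF assms] norm_mult)

lemma jet_sum:
  assumes "open X" "finite I" "\<And>i. i \<in> I \<Longrightarrow> smooth_on X (f i)" "x \<in> X"
  shows "jet m (\<lambda>x. \<Sum>i\<in>I. f i x) x \<le> (\<Sum>i\<in>I. jet m (f i) x)"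
  using assms(2,3)
proof induction
  case empty
  then show ?case by (simp add: jet_zero)
next
  case (insert i I)
  have "jet m (\<lambda>x. f i x + (\<Sum>i\<in>I. f i x)) x \<le> jet m (f i) x + jet m (\<lambda>x. \<Sum>i\<in>I. f i x) x"
    using insert assms by (intro jet_add[of X] smooth_on_sum) auto
  then show ?case using insert by simp
qed

lemma jet_iter:
  fixes f :: "real^'n::finite \<Rightarrow> complex"
  shows "jet m (iter_partial ks f) x \<le> jet (m + length ks) f x"
  unfolding jet_def iter_partial_append[symmetric]
proof -
  have "(\<Sum>js | length js \<le> m. norm (iter_partial (js @ ks) f x)) =
     (\<Sum>js \<in> (\<lambda>js. js @ ks) ` {js. length js \<le> m}. norm (iter_partial js f x))"
    by (subst sum.reindex) (auto intro: inj_onI)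
  also have "\<dots> \<le> (\<Sum>js | length js \<le> m + length ks. norm (iter_partial js f x))"
    by (rule sum_mono2) (auto simp: finite_lists_le)
  finally show "(\<Sum>js | length js \<le> m. norm (iter_partial (js @ ks) f x))
     \<le> (\<Sum>js | length js \<le> m + length ks. norm (iter_partial js f x))" .
qed

text \<open>
  Peeling off the innermost derivative keeps the remaining word untouched and doubles the number of
  terms, which gives the factor \<open>2 ^ length js\<close>.
\<close>

lemma norm_iter_partial_mult:
  fixes f g :: "real^'n::finite \<Rightarrow> complex"
  assumes X: "open X" and "smooth_on X f" "smooth_on X g" "x \<in> X" "length js \<le> m"
  shows "norm (iter_partial js (\<lambda>x. f x * g x) x) \<le> 2 ^ length js * (jet m f x * jet m g x)"
proof -
  have gen: "smooth_on X F \<Longrightarrow> smooth_on X G \<Longrightarrow>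
      (\<And>ks. length ks \<le> length js \<Longrightarrow> norm (iter_partial ks F x) \<le> a) \<Longrightarrow>
      (\<And>ks. length ks \<le> length js \<Longrightarrow> norm (iter_partial ks G x) \<le> b) \<Longrightarrow>
      norm (iter_partial js (\<lambda>x. F x * G x) x) \<le> 2 ^ length js * (a * b)" for F G a b
  proof (induction js arbitrary: F G rule: rev_induct)
    case Nil
    then show ?case using Nil(3)[of "[]"] Nil(4)[of "[]"]
      by (auto simp: norm_mult intro!: mult_mono intro: order_trans[OF norm_ge_zero])
  next
    case (snoc i js)
    let ?F' = "partial_derivative i F" and ?G' = "partial_derivative i G"
    have FG: "has_partial i (\<lambda>x. F x * G x) (?F' x * G x + F x * ?G' x) x" if "x \<in> X" for x
      by (intro has_partial_mult smooth_on_has_partial0[OF snoc.prems(1)] smooth_on_has_partial0[OF snoc.prems(2)] that)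
    have "iter_partial (js @ [i]) (\<lambda>x. F x * G x) x = iter_partial js (partial_derivative i (\<lambda>x. F x * G x)) x"
      by (simp add: iter_partial_append)
    also have "\<dots> = iter_partial js (\<lambda>x. ?F' x * G x + F x * ?G' x) x"
      by (rule iter_partial_cong_open[OF X assms(4)]) (use FG has_partial_unique in blast)
    also have "\<dots> = iter_partial js (\<lambda>x. ?F' x * G x) x + iter_partial js (\<lambda>x. F x * ?G' x) x"
      by (intro iter_partial_add[OF X _ _ assms(4)] smooth_on_mult[OF X] smooth_on_partial snoc.prems)
    finally have eq: "iter_partial (js @ [i]) (\<lambda>x. F x * G x) x = \<dots>" .
    have F': "norm (iter_partial ks ?F' x) \<le> a" if "length ks \<le> length js" for ks
      using snoc.prems(3)[of "ks @ [i]"] that by (simp add: iter_partial_append)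
    have G': "norm (iter_partial ks ?G' x) \<le> b" if "length ks \<le> length js" for ks
      using snoc.prems(4)[of "ks @ [i]"] that by (simp add: iter_partial_append)
    have "norm (iter_partial js (\<lambda>x. ?F' x * G x) x) \<le> 2 ^ length js * (a * b)"
      by (rule snoc.IH) (use snoc.prems F' in \<open>auto intro: smooth_on_partial\<close>)
    moreover have "norm (iter_partial js (\<lambda>x. F x * ?G' x) x) \<le> 2 ^ length js * (a * b)"
      by (rule snoc.IH) (use snoc.prems G' in \<open>auto intro: smooth_on_partial\<close>)
    ultimately show ?case unfolding eq
      using norm_triangle_ineq[of "iter_partial js (\<lambda>x. ?F' x * G x) x" "iter_partial js (\<lambda>x. F x * ?G' x) x"]
      by simp
  qed
  show ?thesis by (rule gen) (use assms in \<open>auto intro!: jet_ge\<close>)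
qed

lemma jet_mult:
  fixes f g :: "real^'n::finite \<Rightarrow> complex"
  assumes "open X" "smooth_on X f" "smooth_on X g" "x \<in> X"
  shows "jet m (\<lambda>x. f x * g x) x \<le> num_words TYPE('n) m * 2 ^ m * (jet m f x * jet m g x)"
proof -
  have "norm (iter_partial js (\<lambda>x. f x * g x) x) \<le> 2 ^ m * (jet m f x * jet m g x)" if "length js \<le> m" for js
  proof -
    have "2 ^ length js * (jet m f x * jet m g x) \<le> 2 ^ m * (jet m f x * jet m g x)"
      by (intro mult_right_mono mult_nonneg_nonneg jet_nonneg power_increasing that) auto
    with norm_iter_partial_mult[OF assms that] show ?thesis by linarith
  qed
  from jet_le[OF this] show ?thesis by (simp add: mult.assoc)
qed

lemma continuous_on_jet: "smooth_on X f \<Longrightarrow> continuous_on X (jet m f)"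
  unfolding jet_def by (intro continuous_intros smooth_on_continuous)

lemma jet_bounded_compact:
  assumes "smooth_on X f" "compact K" "K \<subseteq> X"
  obtains B where "B > 0" "\<And>x. x \<in> K \<Longrightarrow> jet m f x \<le> B"
proof -
  have "compact (jet m f ` K)"
    using assms by (intro compact_continuous_image continuous_on_subset[OF continuous_on_jet])
  then obtain B where "\<forall>y\<in>jet m f ` K. norm y \<le> B" using compact_imp_bounded bounded_iff by metis
  then show ?thesis using that[of "max B 1"] by force
qed

lemma foldr_D_op:
  assumes "open X" "smooth_on X f" "x \<in> X"
  shows "foldr D_op js f x = (- \<i>) ^ length js * iter_partial js f x"
  using assms(3)
proof (induction js arbitrary: x)
  case (Cons i js)
  have "partial_derivative i (foldr D_op js f) x = partial_derivative i (\<lambda>x. (- \<i>) ^ length js * iter_partial js f x) x"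
    by (rule partial_derivative_cong_open[OF assms(1) Cons.prems Cons.IH])
  also have "\<dots> = (- \<i>) ^ length js * partial_derivative i (iter_partial js f) x"
    using iter_partial_cmult[OF assms(1) smooth_on_iter[OF assms(2)] Cons.prems, of "[i]"] by simp
  finally have "partial_derivative i (foldr D_op js f) x = \<dots>" .
  moreover have "foldr D_op (i # js) f x = - \<i> * partial_derivative i (foldr D_op js f) x"
    by (simp add: D_op_def)
  ultimately show ?case by simp
qed auto

lemma diff_op_smooth:
  assumes "open X" "smooth_on X f" "x \<in> X"
  shows "diff_op P f x = (\<Sum>\<alpha>\<in>Poly_Mapping.keys P. Poly_Mapping.lookup P \<alpha> *
     (- \<i>) ^ length (multi_index_list \<alpha>) * iter_partial (multi_index_list \<alpha>) f x)"
  unfolding diff_op_def D_power_def using foldr_D_op[OF assms] by (simp add: mult.assoc)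

lemma diff_op_cong_open:
  assumes "open X" "smooth_on X f" "x \<in> X" "\<And>y. y \<in> X \<Longrightarrow> f y = g y"
  shows "diff_op P f x = diff_op P g x"
  using diff_op_smooth[OF assms(1-3)] diff_op_smooth[OF assms(1) smooth_on_cong[OF assms(1,2,4)] assms(3)]
   iter_partial_cong_open[OF assms(1,3,4)] by simp

lemma smooth_on_diff_op:
  assumes "open X" "smooth_on X f"
  shows "smooth_on X (diff_op P f)"
proof (rule smooth_on_cong[OF assms(1)])
  show "smooth_on X (\<lambda>x. \<Sum>\<alpha>\<in>Poly_Mapping.keys P. Poly_Mapping.lookup P \<alpha> *
     (- \<i>) ^ length (multi_index_list \<alpha>) * iter_partial (multi_index_list \<alpha>) f x)"
    by (intro smooth_on_sum smooth_on_cmult assms smooth_on_iter)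
qed (simp add: diff_op_smooth[OF assms])

lemma diff_op_linear:
  assumes "open X" "smooth_on X f" "smooth_on X g" "x \<in> X"
  shows "diff_op P (\<lambda>x. a * f x + b * g x) x = a * diff_op P f x + b * diff_op P g x"
proof -
  have "smooth_on X (\<lambda>x. a * f x + b * g x)" by (intro smooth_on_add smooth_on_cmult assms)
  then show ?thesis using assms
    by (simp add: diff_op_smooth[of X] iter_partial_add[OF assms(1) smooth_on_cmult smooth_on_cmult]
      iter_partial_cmult sum_distrib_left sum.distrib[symmetric] algebra_simps)
qed

lemma diff_op_add:
  assumes "open X" "smooth_on X f" "smooth_on X g" "x \<in> X"
  shows "diff_op P (\<lambda>x. f x + g x) x = diff_op P f x + diff_op P g x"
  using diff_op_linear[OF assms, of P 1 1] by simp

lemma diff_op_diff: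
  assumes "open X" "smooth_on X f" "smooth_on X g" "x \<in> X"
  shows "diff_op P (\<lambda>x. f x - g x) x = diff_op P f x - diff_op P g x"
  using diff_op_linear[OF assms, of P 1 "-1"] by simp

lemma diff_op_cmult:
  assumes "open X" "smooth_on X f" "x \<in> X"
  shows "diff_op P (\<lambda>x. c * f x) x = c * diff_op P f x"
  using diff_op_linear[OF assms(1,2,2,3), of P c 0] by simp

lemma diff_op_zero: "diff_op P (\<lambda>x. 0) x = 0"
  using diff_op_cmult[OF open_UNIV smooth_on_const[OF open_UNIV], of x P 0] by simp

lemma diff_op_sum:
  assumes "open X" "finite I" "\<And>i. i \<in> I \<Longrightarrow> smooth_on X (f i)" "x \<in> X"
  shows "diff_op P (\<lambda>x. \<Sum>i\<in>I. f i x) x = (\<Sum>i\<in>I. diff_op P (f i) x)"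
  using assms(2,3)
proof induction
  case (insert i I)
  have "diff_op P (\<lambda>x. f i x + (\<Sum>i\<in>I. f i x)) x = diff_op P (f i) x + diff_op P (\<lambda>x. \<Sum>i\<in>I. f i x) x"
    using insert assms by (intro diff_op_add[of X] smooth_on_sum) auto
  then show ?case using insert by simp
qed (simp add: diff_op_zero)

text \<open>
  The constants depend only on \<open>P\<close>; they must not depend on the function, since the neighbourhood of
  zero to be constructed treats all solutions alike.
\<close>

lemma jet_diff_op:
  fixes P :: "'n::finite cpoly"
  obtains C q where "C \<ge> 0" "\<And>(X::(real^'n) set) f x m. open X \<Longrightarrow> smooth_on X f \<Longrightarrow> x \<in> X \<Longrightarrow>
     jet m (diff_op P f) x \<le> C * jet (m + q) f x"
proof -
  let ?q = "Max (insert 0 ((\<lambda>\<alpha>. length (multi_index_list \<alpha>)) ` Poly_Mapping.keys P))"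
  let ?C = "\<Sum>\<alpha>\<in>Poly_Mapping.keys P. norm (Poly_Mapping.lookup P \<alpha>)"
  have "jet m (diff_op P f) x \<le> ?C * jet (m + ?q) f x"
    if X: "open X" "smooth_on X f" "x \<in> X" for X and f :: "real^'n \<Rightarrow> complex" and x m
  proof -
    let ?h = "\<lambda>\<alpha> x. Poly_Mapping.lookup P \<alpha> *
     (- \<i>) ^ length (multi_index_list \<alpha>) * iter_partial (multi_index_list \<alpha>) f x"
    have sm: "smooth_on X (?h \<alpha>)" for \<alpha> by (intro smooth_on_cmult X smooth_on_iter)
    have "jet m (diff_op P f) x = jet m (\<lambda>x. \<Sum>\<alpha>\<in>Poly_Mapping.keys P. ?h \<alpha> x) x"
      by (rule jet_cong_open[OF X(1,3)]) (rule diff_op_smooth[OF X(1,2)])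
    also have "\<dots> \<le> (\<Sum>\<alpha>\<in>Poly_Mapping.keys P. jet m (?h \<alpha>) x)"
      by (rule jet_sum[OF X(1)]) (auto intro: sm X)
    also have "\<dots> \<le> (\<Sum>\<alpha>\<in>Poly_Mapping.keys P. norm (Poly_Mapping.lookup P \<alpha>) * jet (m + ?q) f x)"
    proof (rule sum_mono)
      fix \<alpha> assume a: "\<alpha> \<in> Poly_Mapping.keys P"
      have "jet m (?h \<alpha>) x = norm (Poly_Mapping.lookup P \<alpha>) * jet m (iter_partial (multi_index_list \<alpha>) f) x"
        by (subst jet_cmult[OF X(1) smooth_on_iter[OF X(2)] X(3)]) (simp add: norm_mult norm_power)
      also have "jet m (iter_partial (multi_index_list \<alpha>) f) x \<le> jet (m + length (multi_index_list \<alpha>)) f x"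
        by (rule jet_iter)
      also have "\<dots> \<le> jet (m + ?q) f x" using a by (intro jet_mono add_left_mono Max_ge) auto
      finally show "jet m (?h \<alpha>) x \<le> norm (Poly_Mapping.lookup P \<alpha>) * jet (m + ?q) f x"
        by (simp add: mult_left_mono)
    qed
    finally show ?thesis by (simp add: sum_distrib_right)
  qed
  then show ?thesis using that[of ?C ?q] by (simp add: sum_nonneg)
qed

section \<open>Integrals depending on a parameter\<close>

lemma tendsto_integral_dominated_at:
  fixes f :: "'b::first_countable_topology \<Rightarrow> 'a \<Rightarrow> complex"
  assumes meas: "\<And>t. f t \<in> borel_measurable M" "g \<in> borel_measurable M"
    and lim: "\<And>y. ((\<lambda>t. f t y) \<longlongrightarrow> g y) (at a)"
    and bnd: "\<forall>\<^sub>F t in at a. \<forall>y. norm (f t y) \<le> b y" and b: "integrable M b"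
  shows "((\<lambda>t. \<integral>y. f t y \<partial>M) \<longlongrightarrow> (\<integral>y. g y \<partial>M)) (at a)"
  unfolding tendsto_at_iff_sequentially comp_def
proof (intro allI impI)
  fix X assume X: "\<forall>i. X i \<in> UNIV - {a}" "X \<longlonglongrightarrow> a"
  have Xf: "filterlim X (at a) sequentially"
    using X by (auto simp: filterlim_at)
  then obtain N where N: "\<And>n. n \<ge> N \<Longrightarrow> \<forall>y. norm (f (X n) y) \<le> b y"
    using eventually_compose_filterlim[OF bnd Xf] unfolding eventually_sequentially by blast
  show "(\<lambda>n. \<integral>y. f (X n) y \<partial>M) \<longlonglongrightarrow> (\<integral>y. g y \<partial>M)"
  proof (rule LIMSEQ_offset[where k = N], rule integral_dominated_convergence[OF meas(2,1) b])
    show "AE y in M. (\<lambda>i. f (X (i + N)) y) \<longlonglongrightarrow> g y"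
      using filterlim_compose[OF lim Xf] by (intro always_eventually allI LIMSEQ_ignore_initial_segment)
    show "\<And>i. AE y in M. norm (f (X (i + N)) y) \<le> b y" using N by auto
  qed
qed

lemma has_vector_derivative_iff_quotient:
  fixes f :: "real \<Rightarrow> complex"
  shows "(f has_vector_derivative d) (at 0) \<longleftrightarrow> ((\<lambda>t. (1 / t) *\<^sub>R (f t - f 0)) \<longlongrightarrow> d) (at 0)"
proof -
  have "norm (f t - f 0 - t *\<^sub>R d) / norm t = norm ((1 / t) *\<^sub>R (f t - f 0) - d)" if "t \<noteq> 0" for t
  proof -
    have "(1 / t) *\<^sub>R (f t - f 0) - d = (1 / t) *\<^sub>R (f t - f 0 - t *\<^sub>R d)"
      using that by (simp add: algebra_simps)
    then show ?thesis by simp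
  qed
  then have "\<forall>\<^sub>F t in at 0. norm (f t - f 0 - t *\<^sub>R d) / norm t = norm ((1 / t) *\<^sub>R (f t - f 0) - d)"
    unfolding eventually_at_filter by (intro always_eventually) blast
  then have "((\<lambda>t. norm (f t - f 0 - t *\<^sub>R d) / norm t) \<longlongrightarrow> 0) (at 0) \<longleftrightarrow>
      ((\<lambda>t. norm ((1 / t) *\<^sub>R (f t - f 0) - d)) \<longlongrightarrow> 0) (at 0)"
    by (rule tendsto_cong)
  also have "\<dots> \<longleftrightarrow> ((\<lambda>t. (1 / t) *\<^sub>R (f t - f 0)) \<longlongrightarrow> d) (at 0)"
    unfolding tendsto_norm_zero_iff by (rule LIM_zero_iff)
  finally show ?thesis
    by (simp add: has_vector_derivative_def has_derivative_iff_norm bounded_linear_scaleR_left)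
qed

lemma has_vector_derivative_integral:
  fixes f f' :: "real \<Rightarrow> 'a \<Rightarrow> complex"
  assumes int: "\<And>t. \<bar>t\<bar> < 1 \<Longrightarrow> integrable M (f t)"
    and deriv: "\<And>t y. \<bar>t\<bar> < 1 \<Longrightarrow> ((\<lambda>s. f s y) has_vector_derivative f' t y) (at t)"
    and meas: "f' 0 \<in> borel_measurable M"
    and bnd: "\<And>t y. \<bar>t\<bar> < 1 \<Longrightarrow> norm (f' t y) \<le> b y" and b: "integrable M b"
  shows "((\<lambda>t. \<integral>y. f t y \<partial>M) has_vector_derivative (\<integral>y. f' 0 y \<partial>M)) (at 0)"
proof -
  have lip: "norm (f t y - f 0 y) \<le> b y * \<bar>t\<bar>" if "\<bar>t\<bar> < 1" for t y
  proof -
    have "norm (f t y - f 0 y) \<le> b y * norm (t - 0)"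
    proof (rule differentiable_bound[where S="{-1<..<1}" and f="\<lambda>s. f s y" and f'="\<lambda>t h. h *\<^sub>R f' t y"])
      show "((\<lambda>s. f s y) has_derivative (\<lambda>h. h *\<^sub>R f' x y)) (at x within {-1<..<1})" if "x \<in> {-1<..<1}" for x
      proof -
        have "((\<lambda>s. f s y) has_vector_derivative f' x y) (at x)" by (rule deriv) (use that in auto)
        then show ?thesis unfolding has_vector_derivative_def by (rule has_derivative_at_withinI)
      qed
      show "onorm (\<lambda>h. h *\<^sub>R f' x y) \<le> b y" if "x \<in> {-1<..<1}" for x
        using bnd[of x y] that by (intro onorm_le) (auto simp: mult.commute[of "b y"] intro!: mult_left_mono)
    qed (use that in auto)
    then show ?thesis by simp
  qed
  \<comment> \<open>The difference quotient is replaced by 0 for large \<open>t\<close> so that it is measurable for every \<open>t\<close>.\<close>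
  let ?q = "\<lambda>t y. if \<bar>t\<bar> < 1 then (1 / t) *\<^sub>R (f t y - f 0 y) else 0"
  have "((\<lambda>t. \<integral>y. ?q t y \<partial>M) \<longlongrightarrow> (\<integral>y. f' 0 y \<partial>M)) (at 0)"
  proof (rule tendsto_integral_dominated_at[OF _ meas _ _ b])
    show "?q t \<in> borel_measurable M" for t
      using int[of t] int[of 0] by (cases "\<bar>t\<bar> < 1") (auto intro!: borel_measurable_scaleR borel_measurable_diff)
    fix y
    have "((\<lambda>t. (1 / t) *\<^sub>R (f t y - f 0 y)) \<longlongrightarrow> f' 0 y) (at 0)"
      using deriv[of 0 y] has_vector_derivative_iff_quotient[of "\<lambda>t. f t y"] by simp
    moreover have "\<forall>\<^sub>F t in at (0::real). (1 / t) *\<^sub>R (f t y - f 0 y) = ?q t y"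
      unfolding eventually_at by (auto intro!: exI[of _ 1] simp: dist_real_def)
    ultimately show "((\<lambda>t. ?q t y) \<longlongrightarrow> f' 0 y) (at 0)" by (rule Lim_transform_eventually)
  next
    have *: "norm (?q t y) \<le> b y" if "t \<noteq> 0" for t y
    proof (cases "\<bar>t\<bar> < 1")
      case True
      have "norm (?q t y) = norm (f t y - f 0 y) / \<bar>t\<bar>" using True by simp
      also have "\<dots> \<le> (b y * \<bar>t\<bar>) / \<bar>t\<bar>" using lip[OF True] by (rule divide_right_mono) auto
      finally show ?thesis using that by simp
    next
      case False
      then show ?thesis using bnd[of 0 y] order_trans[OF norm_ge_zero] by auto
    qed
    show "\<forall>\<^sub>F t in at 0. \<forall>y. norm (?q t y) \<le> b y"
      unfolding eventually_at using * by (auto intro!: exI[of _ 1])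
  qed
  moreover have "\<forall>\<^sub>F t in at (0::real). (\<integral>y. ?q t y \<partial>M) = (1 / t) *\<^sub>R ((\<integral>y. f t y \<partial>M) - (\<integral>y. f 0 y \<partial>M))"
    unfolding eventually_at
    using int by (intro exI[of _ 1]) (auto simp: dist_real_def)
  ultimately have "((\<lambda>t. (1 / t) *\<^sub>R ((\<integral>y. f t y \<partial>M) - (\<integral>y. f 0 y \<partial>M))) \<longlongrightarrow> (\<integral>y. f' 0 y \<partial>M)) (at 0)"
    by (rule Lim_transform_eventually)
  then show ?thesis
    by (subst has_vector_derivative_iff_quotient)
qed

lemma integrable_compact_support:
  fixes u :: "real^'n::finite \<Rightarrow> complex"
  assumes "continuous_on UNIV u" "\<And>x. norm x > R \<Longrightarrow> u x = 0"
  shows "integrable lborel u"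
proof -
  have "integrable lborel (\<lambda>x. indicator (cball 0 R) x *\<^sub>R u x)"
    using borel_integrable_compact[of "cball 0 R" u] assms(1) continuous_on_subset by auto
  also have "(\<lambda>x. indicator (cball 0 R) x *\<^sub>R u x) = u"
    using assms(2) by (auto simp: indicator_def fun_eq_iff not_le)
  finally show ?thesis .
qed

lemma bounded_compact_support:
  fixes u :: "real^'n::finite \<Rightarrow> complex"
  assumes "continuous_on UNIV u" "\<And>x. norm x > R \<Longrightarrow> u x = 0"
  obtains B where "B > 0" "\<And>x. norm (u x) \<le> B"
proof -
  have "compact (u ` cball 0 R)"
    using assms by (intro compact_continuous_image continuous_on_subset[OF assms(1)]) auto
  then obtain B where B: "\<forall>y\<in>u ` cball 0 R. norm y \<le> B" using compact_imp_bounded bounded_iff by metis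
  have "norm (u x) \<le> max B 1" for x
  proof (cases "norm x > R")
    case False
    then show ?thesis using B by (auto simp: le_max_iff_disj)
  qed (use assms(2) in auto)
  then show ?thesis using that[of "max B 1"] by auto
qed

lemma lborel_integral_affine:
  fixes f :: "'a::euclidean_space \<Rightarrow> complex"
  assumes c: "c \<noteq> 0" and [measurable]: "f \<in> borel_measurable borel"
  shows "(\<integral>x. f x \<partial>lborel) = (\<bar>c\<bar> ^ DIM('a)) *\<^sub>R (\<integral>x. f (t + c *\<^sub>R x) \<partial>lborel)"
proof -
  have "(\<integral>x. f x \<partial>lborel) = (\<integral>x. f x \<partial>(density (distr lborel borel (\<lambda>x. t + c *\<^sub>R x)) (\<lambda>_. ennreal (\<bar>c\<bar> ^ DIM('a)))))"
    using lborel_affine[OF c, of t] by (simp add: ennreal_power)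
  also have "\<dots> = (\<integral>x. (\<bar>c\<bar> ^ DIM('a)) *\<^sub>R f (t + c *\<^sub>R x) \<partial>lborel)"
    by (subst integral_density) (auto simp: integral_distr)
  finally show ?thesis by simp
qed

lemma lborel_integral_translate:
  fixes f :: "'a::euclidean_space \<Rightarrow> complex"
  assumes "f \<in> borel_measurable borel"
  shows "(\<integral>x. f (x + t) \<partial>lborel) = (\<integral>x. f x \<partial>lborel)"
  using lborel_integral_affine[of 1 f t] assms by (simp add: add.commute)

lemma integrable_translate:
  fixes f :: "'a::euclidean_space \<Rightarrow> complex"
  assumes "integrable lborel f"
  shows "integrable lborel (\<lambda>x. f (x + t))"
proof -
  have "integrable (distr lborel borel ((+) t)) f" unfolding lborel_distr_plus by fact
  then show ?thesis using assms by (subst (asm) integrable_distr_eq) (auto simp: add.commute)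
qed

text \<open>
  By translation invariance \<open>t \<mapsto> \<integral>x. u (x + t e)\<close> is constant, and its derivative at 0 is the
  integral of the partial derivative.
\<close>

lemma integral_partial_zero:
  fixes u u' :: "real^'n::finite \<Rightarrow> complex"
  assumes u: "continuous_on UNIV u" "\<And>x. norm x > R \<Longrightarrow> u x = 0"
    and u': "continuous_on UNIV u'" "\<And>x. norm x > R \<Longrightarrow> u' x = 0"
    and d: "\<And>x. has_partial i u (u' x) x"
  shows "(\<integral>x. u' x \<partial>lborel) = 0"
proof -
  obtain B where B: "B > 0" "\<And>x. norm (u' x) \<le> B" using bounded_compact_support[OF u'] by blast
  let ?e = "axis i 1 :: real^'n"
  let ?b = "\<lambda>x::real^'n. B * indicator (cball 0 (R + 1)) x"
  have "((\<lambda>t. \<integral>x. u (x + t *\<^sub>R ?e) \<partial>lborel) has_vector_derivative (\<integral>x. u' (x + 0 *\<^sub>R ?e) \<partial>lborel)) (at 0)"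
  proof (rule has_vector_derivative_integral[where b = ?b])
    show "integrable lborel (\<lambda>x. u (x + t *\<^sub>R ?e))" for t
      by (intro integrable_translate integrable_compact_support[OF u])
    show "((\<lambda>s. u (y + s *\<^sub>R ?e)) has_vector_derivative u' (y + t *\<^sub>R ?e)) (at t)" for t y
      by (rule has_partial_at[OF d])
    show "(\<lambda>x. u' (x + 0 *\<^sub>R ?e)) \<in> borel_measurable lborel"
      using borel_measurable_continuous_onI[OF u'(1)] by simp
    have "integrable lborel (indicator (cball 0 (R + 1)) :: real^'n \<Rightarrow> real)"
      by (rule integrable_real_indicator) (use emeasure_lborel_cball_finite[of "0::real^'n" "R + 1"] in simp_all)
    then show "integrable lborel ?b" by simp
    fix t :: real and y :: "real^'n" assume t: "\<bar>t\<bar> < 1"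
    show "norm (u' (y + t *\<^sub>R ?e)) \<le> ?b y"
    proof (cases "norm y \<le> R + 1")
      case True then show ?thesis using B by simp
    next
      case False
      have "norm y \<le> norm (y + t *\<^sub>R ?e) + norm (t *\<^sub>R ?e)"
        using norm_triangle_ineq4[of "y + t *\<^sub>R ?e" "t *\<^sub>R ?e"] by simp
      with False t have "norm (y + t *\<^sub>R ?e) > R" by simp
      then show ?thesis using u'(2) B by (simp add: indicator_def)
    qed
  qed
  moreover have "(\<integral>x. u (x + t *\<^sub>R ?e) \<partial>lborel) = (\<integral>x. u x \<partial>lborel)" for t
    by (rule lborel_integral_translate) (use borel_measurable_continuous_onI[OF u(1)] in simp)
  ultimately have "((\<lambda>t::real. \<integral>x. u x \<partial>lborel) has_vector_derivative (\<integral>x. u' x \<partial>lborel)) (at 0)" by simp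
  moreover have "((\<lambda>t::real. \<integral>x. u x \<partial>lborel) has_vector_derivative 0) (at 0)"
    by (auto intro!: derivative_eq_intros)
  ultimately show ?thesis using vector_derivative_unique_at by blast
qed

text \<open>
  Lebesgue measure on \<open>real ^ 'n\<close> is by definition the image of a product over the basis vectors;
  the index of a basis vector \<open>axis i 1\<close> is recovered by a definite description.
\<close>

lemma integral_prod_coords:
  fixes f :: "'n::finite \<Rightarrow> real \<Rightarrow> complex"
  assumes "\<And>i. integrable lborel (f i)"
  shows "integrable lborel (\<lambda>x::real^'n. \<Prod>i\<in>UNIV. f i (x $ i))"
    and "(\<integral>x. (\<Prod>i\<in>UNIV. f i ((x::real^'n) $ i)) \<partial>lborel) = (\<Prod>i\<in>UNIV. \<integral>t. f i t \<partial>lborel)"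
proof -
  have [measurable]: "f i \<in> borel_measurable borel" for i using assms[of i] by auto
  interpret P: product_sigma_finite "\<lambda>_::real^'n. lborel :: real measure" ..
  let ?ix = "\<lambda>b::real^'n. THE i. b = axis i 1"
  have ix: "?ix (axis i 1) = i" for i :: 'n by (auto simp: axis_eq_axis)
  have Basis: "(Basis :: (real^'n) set) = (\<lambda>i. axis i 1) ` UNIV"
    by (auto simp: Basis_vec_def)
  have inj: "inj (\<lambda>i::'n. axis i (1::real))" by (auto simp: inj_def axis_eq_axis)
  have coord: "(\<Sum>b\<in>Basis. y b *\<^sub>R b) $ i = y (axis i 1)" for y :: "real^'n \<Rightarrow> real" and i
    using inner_sum_left_Basis[of "axis i 1 :: real^'n" y] by (simp add: inner_axis Basis)
  have prod: "(\<Prod>i\<in>UNIV. f i ((\<Sum>b\<in>Basis. y b *\<^sub>R b) $ i)) = (\<Prod>b\<in>Basis. f (?ix b) (y b))" for y :: "real^'n \<Rightarrow> real"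
    unfolding Basis by (subst prod.reindex[OF inj]) (simp add: coord[unfolded Basis] ix del: sum_component)
  have T[measurable]: "(\<lambda>y. \<Sum>b\<in>Basis. y b *\<^sub>R b) \<in> measurable (\<Pi>\<^sub>M b\<in>Basis. lborel) (borel :: (real^'n) measure)"
    by measurable
  have F[measurable]: "(\<lambda>x::real^'n. \<Prod>i\<in>UNIV. f i (x $ i)) \<in> borel_measurable borel"
    by measurable
  have "integrable (\<Pi>\<^sub>M b\<in>(Basis :: (real^'n) set). lborel) (\<lambda>y. \<Prod>b\<in>Basis. f (?ix b) (y b))"
    by (rule P.product_integrable_prod) (use assms in auto)
  then show "integrable lborel (\<lambda>x::real^'n. \<Prod>i\<in>UNIV. f i (x $ i))"
    by (subst lborel_eq, subst integrable_distr_eq) (simp_all add: prod del: sum_component)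
  have "(\<integral>x. (\<Prod>i\<in>UNIV. f i ((x::real^'n) $ i)) \<partial>lborel) =
      (\<integral>y. (\<Prod>b\<in>Basis. f (?ix b) (y b)) \<partial>(\<Pi>\<^sub>M b\<in>(Basis :: (real^'n) set). lborel))"
    by (subst lborel_eq, subst integral_distr) (simp_all add: prod del: sum_component)
  also have "\<dots> = (\<Prod>b\<in>Basis. \<integral>t. f (?ix b) t \<partial>lborel)"
    by (rule P.product_integral_prod) (use assms in auto)
  also have "\<dots> = (\<Prod>i\<in>UNIV. \<integral>t. f i t \<partial>lborel)"
    unfolding Basis by (subst prod.reindex[OF inj]) (simp add: ix)
  finally show "(\<integral>x. (\<Prod>i\<in>UNIV. f i ((x::real^'n) $ i)) \<partial>lborel) = (\<Prod>i\<in>UNIV. \<integral>t. f i t \<partial>lborel)" .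
qed

section \<open>The Fourier--Laplace transform\<close>

text \<open>
  The components of the complex frequency \<open>\<eta> + \<i> \<xi>\<close>. The function \<open>wave \<eta> \<xi>\<close> below is the
  exponential with that frequency, so \<open>freq \<eta> \<xi> i\<close> is its eigenvalue under the \<open>i\<close>-th
  partial derivative.
\<close>

definition freq :: "real^'n \<Rightarrow> real^'n \<Rightarrow> 'n::finite \<Rightarrow> complex" where
  "freq \<eta> \<xi> i = Complex (\<eta> $ i) (\<xi> $ i)"

definition wave :: "real^'n \<Rightarrow> real^'n \<Rightarrow> real^'n::finite \<Rightarrow> complex" where
  "wave \<eta> \<xi> x = exp (Complex (\<eta> \<bullet> x) (\<xi> \<bullet> x))"

definition fourier_laplace :: "(real^'n \<Rightarrow> complex) \<Rightarrow> real^'n \<Rightarrow> real^'n::finite \<Rightarrow> complex" where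
  "fourier_laplace g \<eta> \<xi> = (\<integral>x. g x * wave \<eta> \<xi> (- x) \<partial>lborel)"

lemma norm_wave: "norm (wave \<eta> \<xi> x) = exp (\<eta> \<bullet> x)"
  by (simp add: wave_def norm_exp_eq_Re)

lemma wave_line: "wave \<eta> \<xi> (x + s *\<^sub>R axis i 1) = wave \<eta> \<xi> x * exp (of_real s * freq \<eta> \<xi> i)"
  unfolding wave_def freq_def exp_add[symmetric]
  by (rule arg_cong[where f=exp]) (simp add: complex_eq_iff inner_add_right inner_axis)

lemma wave_nz: "wave \<eta> \<xi> x \<noteq> 0" by (simp add: wave_def)

lemma wave_minus: "wave \<eta> \<xi> (- x) = inverse (wave \<eta> \<xi> x)"
  unfolding wave_def exp_minus[symmetric]
  by (rule arg_cong[where f=exp]) (simp add: complex_eq_iff)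

lemma wave_add_fun: "wave \<eta> \<xi> (x + y) = wave \<eta> \<xi> x * wave \<eta> \<xi> y"
  unfolding wave_def exp_add[symmetric]
  by (rule arg_cong[where f=exp]) (simp add: complex_eq_iff inner_add_right)

lemma continuous_wave [continuous_intros]:
  assumes "continuous_on S a" "continuous_on S b" "continuous_on S c"
  shows "continuous_on S (\<lambda>y. wave (a y) (b y) (c y))"
proof -
  have "continuous_on S (\<lambda>y. exp (of_real (a y \<bullet> c y) + \<i> * of_real (b y \<bullet> c y)))"
    by (intro continuous_intros assms)
  then show ?thesis by (simp add: wave_def Complex_eq)
qed

lemma continuous_freq [continuous_intros]:
  assumes "continuous_on S a" "continuous_on S b"
  shows "continuous_on S (\<lambda>y. freq (a y) (b y) i)"
proof -
  have "continuous_on S (\<lambda>y. of_real (a y $ i) + \<i> * of_real (b y $ i))"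
    by (intro continuous_intros assms)
  then show ?thesis by (simp add: freq_def Complex_eq)
qed

lemma has_partial_wave: "has_partial i (wave \<eta> \<xi>) (freq \<eta> \<xi> i * wave \<eta> \<xi> x) x"
proof -
  have "((\<lambda>t. wave \<eta> \<xi> x * exp (t *\<^sub>R freq \<eta> \<xi> i)) has_vector_derivative
      wave \<eta> \<xi> x * (freq \<eta> \<xi> i * exp (0 *\<^sub>R freq \<eta> \<xi> i))) (at (0::real))"
    by (intro has_vector_derivative_mult_right exp_scaleR_has_vector_derivative_left)
  then show ?thesis unfolding has_partial_def wave_line by (simp add: scaleR_conv_of_real mult.commute)
qed

lemma has_partial_wave_neg:
  "has_partial i (\<lambda>x. wave \<eta> \<xi> (- x)) (- freq \<eta> \<xi> i * wave \<eta> \<xi> (- x)) x"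
  using has_partial_inverse[OF has_partial_wave wave_nz, of i \<eta> \<xi> x] wave_nz[of \<eta> \<xi> x]
  by (simp add: wave_minus field_simps)

definition test_fun :: "(real^'n::finite \<Rightarrow> complex) \<Rightarrow> bool" where
  "test_fun g \<longleftrightarrow> smooth_on UNIV g \<and> (\<exists>R. \<forall>x. norm x > R \<longrightarrow> g x = 0)"

lemma iter_partial_zero_outside:
  assumes "closed S" "\<And>x. x \<notin> S \<Longrightarrow> g x = 0" "x \<notin> S"
  shows "iter_partial js g x = 0"
proof -
  have "iter_partial js g x = iter_partial js (\<lambda>_. 0) x"
    by (rule iter_partial_cong_open[where X = "- S"]) (use assms in auto)
  then show ?thesis by (simp add: iter_partial_zero)
qed

lemma test_fun_iter:
  assumes "test_fun g"
  shows "test_fun (iter_partial js g)"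
proof -
  obtain R where R: "\<And>x. norm x > R \<Longrightarrow> g x = 0" using assms by (auto simp: test_fun_def)
  have "iter_partial js g x = 0" if "norm x > R" for x
    by (rule iter_partial_zero_outside[where S = "cball 0 R"]) (use that R in auto)
  then show ?thesis using assms smooth_on_iter by (auto simp: test_fun_def)
qed

lemma test_fun_partial: "test_fun g \<Longrightarrow> test_fun (partial_derivative i g)"
  using test_fun_iter[of g "[i]"] by simp

lemma test_fun_continuous: "test_fun g \<Longrightarrow> continuous_on UNIV g"
  unfolding test_fun_def by (auto intro: smooth_on_continuous0)

lemma fourier_laplace_integrable:
  assumes "test_fun g"
  shows "integrable lborel (\<lambda>x. g x * wave \<eta> \<xi> (- x))"
proof -
  obtain R where R: "\<And>x. norm x > R \<Longrightarrow> g x = 0" using assms by (auto simp: test_fun_def)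
  show ?thesis
    by (rule integrable_compact_support[where R = R])
       (use R in \<open>auto intro!: continuous_intros test_fun_continuous[OF assms]\<close>)
qed

text \<open>
  Integration by parts: the derivative of \<open>g\<close> times the exponential integrates to zero.
\<close>

lemma fourier_laplace_partial:
  assumes "test_fun g"
  shows "fourier_laplace (partial_derivative i g) \<eta> \<xi> = freq \<eta> \<xi> i * fourier_laplace g \<eta> \<xi>"
proof -
  obtain R where R: "\<And>x. norm x > R \<Longrightarrow> g x = 0" using assms by (auto simp: test_fun_def)
  have R': "partial_derivative i g x = 0" if "norm x > R" for x
    using iter_partial_zero_outside[where S = "cball 0 R" and js = "[i]" and g = g] R that by auto
  let ?u' = "\<lambda>x. partial_derivative i g x * wave \<eta> \<xi> (- x) + g x * (- freq \<eta> \<xi> i * wave \<eta> \<xi> (- x))"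
  have "(\<integral>x. ?u' x \<partial>lborel) = 0"
  proof (rule integral_partial_zero[where u = "\<lambda>x. g x * wave \<eta> \<xi> (- x)" and R = R])
    show "has_partial i (\<lambda>x. g x * wave \<eta> \<xi> (- x)) (?u' x) x" for x
      using assms by (intro has_partial_mult has_partial_wave_neg smooth_on_has_partial0[of UNIV])
        (auto simp: test_fun_def)
  qed (use R R' test_fun_continuous[OF assms] test_fun_continuous[OF test_fun_partial[OF assms]]
       in \<open>auto intro!: continuous_intros\<close>)
  also have "?u' = (\<lambda>x. partial_derivative i g x * wave \<eta> \<xi> (- x) - freq \<eta> \<xi> i * (g x * wave \<eta> \<xi> (- x)))"
    by (simp add: fun_eq_iff algebra_simps)
  finally show ?thesis
    using fourier_laplace_integrable[OF assms] fourier_laplace_integrable[OF test_fun_partial[OF assms]]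
    unfolding fourier_laplace_def by (subst (asm) Bochner_Integration.integral_diff) auto
qed

lemma fourier_laplace_iter:
  assumes "test_fun g"
  shows "fourier_laplace (iter_partial js g) \<eta> \<xi> = (\<Prod>j\<leftarrow>js. freq \<eta> \<xi> j) * fourier_laplace g \<eta> \<xi>"
  by (induction js) (simp_all add: fourier_laplace_partial test_fun_iter assms)

lemma fourier_laplace_bound:
  fixes g :: "real^'n::finite \<Rightarrow> complex"
  assumes g: "test_fun g" and R: "R \<ge> 0" "\<And>x. norm x > R \<Longrightarrow> g x = 0"
    and B: "\<And>x. norm x \<le> R \<Longrightarrow> norm (g x) * exp (- (\<eta> \<bullet> x)) \<le> B"
  shows "norm (fourier_laplace g \<eta> \<xi>) \<le> measure lborel (cball (0::real^'n) R) * B"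
proof -
  have fin: "emeasure lborel (cball (0::real^'n) R) < \<infinity>" by (rule emeasure_lborel_cball_finite)
  have B0: "B \<ge> 0" using B[of 0] R(1) order_trans[OF norm_ge_zero[of "g 0"]] by simp
  have int: "integrable lborel (\<lambda>x::real^'n. B * indicator (cball 0 R) x)"
    by (intro integrable_mult_right integrable_real_indicator) (use fin in auto)
  have "norm (fourier_laplace g \<eta> \<xi>) \<le> (\<integral>x. B * indicator (cball (0::real^'n) R) x \<partial>lborel)"
    unfolding fourier_laplace_def
  proof (rule Bochner_Integration.integral_norm_bound_integral[OF fourier_laplace_integrable[OF g] int])
    fix x :: "real^'n"
    show "norm (g x * wave \<eta> \<xi> (- x)) \<le> B * indicator (cball 0 R) x"
      using R(2)[of x] B[of x] B0 by (cases "norm x > R") (auto simp: norm_mult norm_wave)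
  qed
  also have "\<dots> = measure lborel (cball (0::real^'n) R) * B"
    by simp
  finally show ?thesis .
qed

lemma continuous_fourier_laplace:
  assumes "test_fun g"
  shows "continuous_on UNIV (fourier_laplace g \<eta>)"
proof (rule continuous_at_imp_continuous_on, rule ballI)
  fix \<xi>
  show "isCont (fourier_laplace g \<eta>) \<xi>" unfolding isCont_def fourier_laplace_def
  proof (rule tendsto_integral_dominated_at[where b = "\<lambda>x. norm (g x * wave \<eta> 0 (- x))"])
    show "(\<lambda>x. g x * wave \<eta> \<xi> (- x)) \<in> borel_measurable lborel" for \<xi>
      using fourier_laplace_integrable[OF assms] by (rule borel_measurable_integrable)
    show "((\<lambda>t. g y * wave \<eta> t (- y)) \<longlongrightarrow> g y * wave \<eta> \<xi> (- y)) (at \<xi>)" for y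
    proof -
      have "continuous_on UNIV (\<lambda>t. g y * wave \<eta> t (- y))" by (intro continuous_intros)
      then have "isCont (\<lambda>t. g y * wave \<eta> t (- y)) \<xi>" by (simp add: continuous_on_eq_continuous_at)
      then show ?thesis by (simp add: isCont_def)
    qed
    show "integrable lborel (\<lambda>x. norm (g x * wave \<eta> 0 (- x)))"
      by (intro integrable_norm fourier_laplace_integrable assms)
    show "(\<lambda>y. g y * wave \<eta> \<xi> (- y)) \<in> borel_measurable lborel"
      using fourier_laplace_integrable[OF assms] by (rule borel_measurable_integrable)
  qed (auto simp: norm_mult norm_wave)
qed

text \<open>
  An integrable majorant of product form, so that its integrability reduces to one variable.
\<close>

definition decay :: "real^'n::finite \<Rightarrow> real" where
  "decay \<xi> = (\<Prod>i\<in>UNIV. inverse (1 + (\<xi> $ i)\<^sup>2))"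

lemma decay_pos: "decay \<xi> > 0"
  unfolding decay_def by (intro prod_pos) (auto intro!: add_pos_nonneg)

lemma integrable_decay: "integrable lborel (decay :: real^'n::finite \<Rightarrow> real)"
proof -
  have 1: "integrable lborel (\<lambda>x::real. inverse (1 + x\<^sup>2))"
    using integrable_inverse_1_plus_square by (simp add: set_integrable_def)
  have "integrable lborel (\<lambda>x::real. complex_of_real (inverse (1 + x\<^sup>2)))"
    using 1 by (rule integrable_of_real)
  then have "integrable lborel (\<lambda>\<xi>::real^'n. \<Prod>i\<in>UNIV. complex_of_real (inverse (1 + (\<xi> $ i)\<^sup>2)))"
    using integral_prod_coords(1)[of "\<lambda>_ x. complex_of_real (inverse (1 + x\<^sup>2))"] by simp
  then have "integrable lborel (\<lambda>\<xi>::real^'n. norm (\<Prod>i\<in>UNIV. complex_of_real (inverse (1 + (\<xi> $ i)\<^sup>2))))"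
    by (rule integrable_norm)
  also have "(\<lambda>\<xi>::real^'n. norm (\<Prod>i\<in>UNIV. complex_of_real (inverse (1 + (\<xi> $ i)\<^sup>2)))) = decay"
    unfolding decay_def prod_norm[symmetric] norm_of_real
    by (intro ext prod.cong refl abs_of_nonneg) auto
  finally show ?thesis .
qed

text \<open>
  The reason is \<open>1 + (\<xi> $ i)\<^sup>2 \<le> 2 max 1 \<bar>freq \<eta> \<xi> i\<bar>\<^sup>2\<close>, with a
  constant that does not involve \<open>\<eta>\<close>. So the loss in passing from \<open>B\<close> to the decay in \<open>\<xi>\<close> is
  uniform in \<open>\<eta>\<close>, as needed when \<open>\<eta>\<close> tends to infinity.
\<close>

lemma fourier_laplace_decay:
  fixes g :: "real^'n::finite \<Rightarrow> complex"
  assumes g: "test_fun g"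
    and B: "\<And>js. length js \<le> m + 2 * CARD('n) \<Longrightarrow> norm (fourier_laplace (iter_partial js g) \<eta> \<xi>) \<le> B"
    and js: "length js \<le> m"
  shows "norm (fourier_laplace g \<eta> \<xi>) * (\<Prod>j\<leftarrow>js. norm (freq \<eta> \<xi> j)) \<le> 2 ^ CARD('n) * B * decay \<xi>"
proof -
  let ?z = "freq \<eta> \<xi>"
  let ?S = "{i. norm (?z i) > 1}"
  \<comment> \<open>Differentiating twice in each direction with large frequency supplies the quadratic decay.\<close>
  obtain xs where xs: "set xs = ?S" "distinct xs" using finite_distinct_list[of ?S] by auto
  have len: "length xs \<le> CARD('n)"
    using xs distinct_card[OF xs(2)] card_mono[of "UNIV::'n set" ?S] by simp
  have pl: "(\<Prod>j\<leftarrow>ks. norm (?z j)) = norm (\<Prod>j\<leftarrow>ks. ?z j)" for ks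
    by (induction ks) (auto simp: norm_mult)
  have "(\<Prod>i\<in>UNIV. 1 + (\<xi> $ i)\<^sup>2) \<le> (\<Prod>i\<in>(UNIV::'n set). 2 * (if i \<in> ?S then norm (?z i) ^ 2 else 1))"
  proof (rule prod_mono, intro conjI)
    fix i :: 'n
    have a: "(\<xi> $ i)\<^sup>2 \<le> norm (?z i) ^ 2" by (simp add: freq_def cmod_power2)
    show "1 + (\<xi> $ i)\<^sup>2 \<le> 2 * (if i \<in> ?S then norm (?z i) ^ 2 else 1)"
    proof (cases "i \<in> ?S")
      case True
      then have "norm (?z i) ^ 2 \<ge> 1 ^ 2" by (intro power_mono) auto
      then have "1 + (\<xi> $ i)\<^sup>2 \<le> 2 * norm (?z i) ^ 2" using a unfolding one_power2 by linarith
      then show ?thesis using True by simp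
    next
      case False
      then have "norm (?z i) ^ 2 \<le> 1" by (simp add: power_le_one)
      then show ?thesis using a False by simp
    qed
  qed (auto intro: add_nonneg_nonneg)
  also have "\<dots> = 2 ^ CARD('n) * (\<Prod>i\<in>?S. norm (?z i) ^ 2)"
    by (simp add: prod.distrib prod.If_cases)
  also have "(\<Prod>i\<in>?S. norm (?z i) ^ 2) = (\<Prod>j\<leftarrow>xs @ xs. norm (?z j))"
    using xs by (simp add: prod.distinct_set_conv_list[symmetric] power2_eq_square prod.distrib)
  finally have 1: "(\<Prod>i\<in>UNIV. 1 + (\<xi> $ i)\<^sup>2) \<le> 2 ^ CARD('n) * (\<Prod>j\<leftarrow>xs @ xs. norm (?z j))" .
  have "norm (fourier_laplace (iter_partial (xs @ xs @ js) g) \<eta> \<xi>) \<le> B"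
    by (rule B) (use len js in simp)
  then have 2: "(\<Prod>j\<leftarrow>xs @ xs. norm (?z j)) * ((\<Prod>j\<leftarrow>js. norm (?z j)) * norm (fourier_laplace g \<eta> \<xi>)) \<le> B"
    unfolding fourier_laplace_iter[OF g] norm_mult pl[symmetric] by (simp add: mult.assoc)
  have nn: "(\<Prod>j\<leftarrow>js. norm (?z j)) * norm (fourier_laplace g \<eta> \<xi>) \<ge> 0" unfolding pl by simp
  note mult_right_mono[OF 1 nn]
  also have "2 ^ CARD('n) * (\<Prod>j\<leftarrow>xs @ xs. norm (?z j)) * ((\<Prod>j\<leftarrow>js. norm (?z j)) * norm (fourier_laplace g \<eta> \<xi>))
      \<le> 2 ^ CARD('n) * B"
    unfolding mult.assoc[of "2 ^ CARD('n)"] by (rule mult_left_mono[OF 2]) simp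
  finally have "(\<Prod>i\<in>UNIV. 1 + (\<xi> $ i)\<^sup>2) * ((\<Prod>j\<leftarrow>js. norm (?z j)) * norm (fourier_laplace g \<eta> \<xi>)) \<le> 2 ^ CARD('n) * B" .
  moreover have "decay \<xi> = inverse (\<Prod>i\<in>UNIV. 1 + (\<xi> $ i)\<^sup>2)"
    by (simp add: decay_def prod_inversef[symmetric] o_def)
  moreover have "(\<Prod>i\<in>UNIV. 1 + (\<xi> $ i)\<^sup>2) > 0"
    by (intro prod_pos) (auto intro!: add_pos_nonneg)
  ultimately show ?thesis by (simp add: field_simps)
qed

section \<open>Fourier inversion\<close>

text \<open>
  The characteristic function of the standard normal distribution, rewritten as a Lebesgue integral.
\<close>

lemma std_normal_integral:
  "integrable lborel (\<lambda>t::real. complex_of_real (std_normal_density t) * exp (\<i> * of_real (s * t)))"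
  "(\<integral>t. complex_of_real (std_normal_density t) * exp (\<i> * of_real (s * t)) \<partial>lborel) = of_real (exp (- (s\<^sup>2) / 2))"
proof -
  interpret real_distribution std_normal_distribution by (rule real_dist_normal_dist)
  have [measurable]: "(\<lambda>t::real. exp (\<i> * complex_of_real (s * t))) \<in> borel_measurable borel"
    by (intro borel_measurable_continuous_onI continuous_intros)
  have "integrable lborel (\<lambda>t::real. complex_of_real (std_normal_density t))"
    by (intro integrable_of_real integrable_normal_density) simp
  then show "integrable lborel (\<lambda>t::real. complex_of_real (std_normal_density t) * exp (\<i> * of_real (s * t)))"
    by (rule Bochner_Integration.integrable_bound) (auto simp: norm_mult)
  have "char std_normal_distribution s = (\<integral>t. std_normal_density t *\<^sub>R exp (\<i> * of_real (s * t)) \<partial>lborel)"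
    unfolding char_def by (subst integral_density) (auto simp: normal_density_nonneg)
  then show "(\<integral>t. complex_of_real (std_normal_density t) * exp (\<i> * of_real (s * t)) \<partial>lborel) = of_real (exp (- (s\<^sup>2) / 2))"
    by (simp add: char_std_normal_distribution scaleR_conv_of_real)
qed

definition gaussian :: "real^'n::finite \<Rightarrow> real" where
  "gaussian \<xi> = (\<Prod>i\<in>UNIV. std_normal_density (\<xi> $ i))"

definition gaussian_hat :: "real^'n::finite \<Rightarrow> real" where
  "gaussian_hat s = (\<Prod>i\<in>UNIV. exp (- ((s $ i)\<^sup>2) / 2))"

lemma gaussian_fourier:
  fixes s :: "real^'n::finite"
  shows "integrable lborel (\<lambda>\<xi>. of_real (gaussian \<xi>) * wave 0 \<xi> s)"
    and "(\<integral>\<xi>. of_real (gaussian \<xi>) * wave 0 \<xi> s \<partial>lborel) = of_real (gaussian_hat s)"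
proof -
  let ?f = "\<lambda>i t. complex_of_real (std_normal_density t) * exp (\<i> * of_real (s $ i * t))"
  have eq: "of_real (gaussian \<xi>) * wave 0 \<xi> s = (\<Prod>i\<in>UNIV. ?f i (\<xi> $ i))" for \<xi>
  proof -
    have "wave 0 \<xi> s = exp (\<i> * of_real (\<xi> \<bullet> s))" by (simp add: wave_def Complex_eq)
    also have "\<dots> = (\<Prod>i\<in>UNIV. exp (\<i> * of_real (s $ i * \<xi> $ i)))"
      by (simp add: inner_vec_def exp_sum sum_distrib_left mult.commute)
    finally show ?thesis by (simp add: gaussian_def prod.distrib)
  qed
  show "integrable lborel (\<lambda>\<xi>. of_real (gaussian \<xi>) * wave 0 \<xi> s)"
    unfolding eq by (rule integral_prod_coords(1)) (rule std_normal_integral)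
  show "(\<integral>\<xi>. of_real (gaussian \<xi>) * wave 0 \<xi> s \<partial>lborel) = of_real (gaussian_hat s)"
    unfolding eq by (subst integral_prod_coords(2)) (simp_all add: std_normal_integral[simplified] gaussian_hat_def)
qed

lemma gaussian_hat_integral:
  shows "integrable lborel (\<lambda>s::real^'n::finite. complex_of_real (gaussian_hat s))"
    and "(\<integral>s. complex_of_real (gaussian_hat (s::real^'n)) \<partial>lborel) \<noteq> 0"
proof -
  let ?g = "\<lambda>t::real. complex_of_real (exp (- (t\<^sup>2) / 2))"
  have e: "?g t = of_real (sqrt (2 * pi)) * complex_of_real (std_normal_density t)" for t
    by (simp add: std_normal_density_def)
  have i: "integrable lborel (\<lambda>t::real. complex_of_real (std_normal_density t))"
    by (intro integrable_of_real integrable_normal_density) simp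
  have 1: "integrable lborel ?g" unfolding e by (intro integrable_mult_right i)
  have "(\<integral>t. ?g t \<partial>lborel) = of_real (sqrt (2 * pi))"
    unfolding e using std_normal_integral(2)[of 0] by simp
  then have 2: "(\<integral>t. ?g t \<partial>lborel) \<noteq> 0" by (simp del: of_real_exp)
  have eq: "complex_of_real (gaussian_hat s) = (\<Prod>i\<in>UNIV. ?g (s $ i))" for s :: "real^'n"
    by (simp add: gaussian_hat_def)
  show "integrable lborel (\<lambda>s::real^'n::finite. complex_of_real (gaussian_hat s))"
    unfolding eq by (rule integral_prod_coords(1)[OF 1])
  show "(\<integral>s. complex_of_real (gaussian_hat (s::real^'n)) \<partial>lborel) \<noteq> 0"
    unfolding eq by (subst integral_prod_coords(2)[OF 1]) (use 2 in \<open>simp del: of_real_exp\<close>)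
qed

lemma gaussian_props:
  fixes \<xi> :: "real^'n::finite"
  shows "gaussian \<xi> \<ge> 0" "gaussian \<xi> \<le> gaussian (0::real^'n)" "gaussian (0::real^'n) > 0"
  "continuous_on UNIV (gaussian :: real^'n \<Rightarrow> real)" "continuous_on UNIV (gaussian_hat :: real^'n \<Rightarrow> real)"
proof -
  show "gaussian \<xi> \<ge> 0" unfolding gaussian_def by (intro prod_nonneg) auto
  show "gaussian \<xi> \<le> gaussian (0::real^'n)" unfolding gaussian_def
    by (intro prod_mono conjI) (auto simp: std_normal_density_def divide_right_mono)
  show "gaussian (0::real^'n::finite) > 0" unfolding gaussian_def
    by (intro prod_pos) (auto simp: std_normal_density_def)
  show "continuous_on UNIV (gaussian :: real^'n \<Rightarrow> real)"
    unfolding gaussian_def std_normal_density_def by (intro continuous_intros) auto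
  show "continuous_on UNIV (gaussian_hat :: real^'n \<Rightarrow> real)"
    unfolding gaussian_hat_def by (intro continuous_intros) auto
qed

text \<open>
  The constant \<open>(2 * pi) ^ CARD('n)\<close> of Fourier inversion, in the form in which the Gaussian
  regularisation produces it.
\<close>

definition inv_const :: "'n::finite itself \<Rightarrow> complex" where
  "inv_const _ = (\<integral>s. complex_of_real (gaussian_hat (s::real^'n)) \<partial>lborel) / of_real (gaussian (0::real^'n))"

lemma inv_const_nz: "inv_const TYPE('n::finite) \<noteq> 0"
  unfolding inv_const_def using gaussian_hat_integral(2) gaussian_props(3)[where 'n='n] by (simp del: of_real_prod)

text \<open>
  The Gaussian factor makes the double integral absolutely convergent, so the order of integration can be
  exchanged; the inner integral is then a rescaled Gaussian in \<open>x - y\<close>, which the substitution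
  \<open>y = x - \<epsilon> s\<close> normalises.
\<close>

lemma gaussian_regularised_inversion:
  fixes g :: "real^'n::finite \<Rightarrow> complex"
  assumes g: "test_fun g" and \<epsilon>: "\<epsilon> > 0"
  shows "(\<integral>\<xi>. fourier_laplace g \<eta> \<xi> * wave \<eta> \<xi> x * of_real (gaussian (\<epsilon> *\<^sub>R \<xi>)) \<partial>lborel) =
     (\<integral>s. g (x + (- \<epsilon>) *\<^sub>R s) * wave \<eta> 0 (\<epsilon> *\<^sub>R s) * of_real (gaussian_hat s) \<partial>lborel)"
proof -
  let ?n = "DIM(real^'n)"
  let ?F = "\<lambda>y \<xi>. g y * wave \<eta> \<xi> (x - y) * of_real (gaussian (\<epsilon> *\<^sub>R \<xi>))"
  have cg: "continuous_on UNIV g" by (rule test_fun_continuous[OF g])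
  have meas: "case_prod ?F \<in> borel_measurable (lborel \<Otimes>\<^sub>M lborel)"
  proof -
    have "continuous_on UNIV (\<lambda>p. g (fst p) * wave \<eta> (snd p) (x - fst p) * of_real (gaussian (\<epsilon> *\<^sub>R snd p)))"
      by (intro continuous_intros continuous_on_compose2[OF cg] continuous_on_compose2[OF gaussian_props(4)]) auto
    then have "(\<lambda>p. g (fst p) * wave \<eta> (snd p) (x - fst p) * of_real (gaussian (\<epsilon> *\<^sub>R snd p))) \<in> borel_measurable borel"
      by (rule borel_measurable_continuous_onI)
    then show ?thesis unfolding lborel_prod by (simp add: case_prod_beta)
  qed
  have int\<epsilon>: "integrable lborel (\<lambda>\<xi>::real^'n. gaussian (\<epsilon> *\<^sub>R \<xi>))"
  proof -
    have "integrable lborel (\<lambda>\<xi>::real^'n. norm (complex_of_real (gaussian \<xi>) * wave 0 \<xi> 0))"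
      by (intro integrable_norm gaussian_fourier)
    then have i: "integrable lborel (gaussian :: real^'n \<Rightarrow> real)"
      using gaussian_props(1)[where 'n='n] by (simp add: norm_mult norm_wave abs_of_nonneg)
    have m[measurable]: "(gaussian :: real^'n \<Rightarrow> real) \<in> borel_measurable borel"
      by (rule borel_measurable_continuous_onI[OF gaussian_props(4)])
    have "integrable (density (distr lborel borel (\<lambda>x. 0 + \<epsilon> *\<^sub>R x)) (\<lambda>_. ennreal (\<bar>\<epsilon>\<bar> ^ ?n))) (gaussian :: real^'n \<Rightarrow> real)"
      using i lborel_affine[of \<epsilon> "0 :: real^'n"] \<epsilon> by (simp add: ennreal_power)
    then have "integrable lborel (\<lambda>\<xi>::real^'n. \<bar>\<epsilon>\<bar> ^ ?n * gaussian (\<epsilon> *\<^sub>R \<xi>))"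
      by (subst (asm) integrable_density) (auto simp: integrable_distr_eq)
    then have "integrable lborel (\<lambda>\<xi>::real^'n. inverse (\<bar>\<epsilon>\<bar> ^ ?n) * (\<bar>\<epsilon>\<bar> ^ ?n * gaussian (\<epsilon> *\<^sub>R \<xi>)))"
      by (rule integrable_mult_right)
    then show ?thesis using \<epsilon> by (simp add: mult.assoc[symmetric])
  qed
  have norms: "norm (?F y \<xi>) = norm (g y * wave \<eta> 0 (x - y)) * gaussian (\<epsilon> *\<^sub>R \<xi>)" for y \<xi>
    using gaussian_props(1)[of "\<epsilon> *\<^sub>R \<xi>"] by (simp add: norm_mult norm_wave)
  have gw: "integrable lborel (\<lambda>y. g y * wave \<eta> 0 (x - y))"
  proof -
    have "integrable lborel (\<lambda>y. wave \<eta> 0 x * (g y * wave \<eta> 0 (- y)))"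
      by (intro integrable_mult_right fourier_laplace_integrable g)
    moreover have "wave \<eta> 0 (x - y) = wave \<eta> 0 x * wave \<eta> 0 (- y)" for y
      using wave_add_fun[of \<eta> 0 x "- y"] by simp
    ultimately show ?thesis by (simp add: mult_ac)
  qed
  have int: "integrable (lborel \<Otimes>\<^sub>M lborel) (case_prod ?F)"
  proof (rule lborel_pair.Fubini_integrable[OF meas])
    show "integrable lborel (\<lambda>y. \<integral>\<xi>. norm (case_prod ?F (y, \<xi>)) \<partial>lborel)"
      unfolding case_prod_conv norms by (simp add: gw int\<epsilon>)
    show "AE y in lborel. integrable lborel (\<lambda>\<xi>. case_prod ?F (y, \<xi>))"
    proof (intro always_eventually allI)
      fix y
      have "integrable lborel (\<lambda>\<xi>::real^'n. norm (g y * wave \<eta> 0 (x - y)) * gaussian (\<epsilon> *\<^sub>R \<xi>))"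
        by (intro integrable_mult_right int\<epsilon>)
      then show "integrable lborel (\<lambda>\<xi>. case_prod ?F (y, \<xi>))"
      proof (rule Bochner_Integration.integrable_bound)
        have "continuous_on UNIV (?F y)"
          by (intro continuous_intros continuous_on_compose2[OF gaussian_props(4)]) auto
        then show "(\<lambda>\<xi>. case_prod ?F (y, \<xi>)) \<in> borel_measurable lborel"
          using borel_measurable_continuous_onI by auto
        show "AE \<xi> in lborel. norm (case_prod ?F (y, \<xi>)) \<le> norm (norm (g y * wave \<eta> 0 (x - y)) * gaussian (\<epsilon> *\<^sub>R \<xi>))"
          unfolding case_prod_conv norms by simp
      qed
    qed
  qed
  have "(\<integral>\<xi>. fourier_laplace g \<eta> \<xi> * wave \<eta> \<xi> x * of_real (gaussian (\<epsilon> *\<^sub>R \<xi>)) \<partial>lborel) = (\<integral>\<xi>. (\<integral>y. ?F y \<xi> \<partial>lborel) \<partial>lborel)"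
  proof (rule Bochner_Integration.integral_cong[OF refl])
    fix \<xi> :: "real^'n"
    have eqF: "(\<lambda>y. ?F y \<xi>) = (\<lambda>y. (g y * wave \<eta> \<xi> (- y)) * (wave \<eta> \<xi> x * of_real (gaussian (\<epsilon> *\<^sub>R \<xi>))))"
      using wave_add_fun[of \<eta> \<xi> x "- _"] by (auto simp: fun_eq_iff mult_ac)
    then show "fourier_laplace g \<eta> \<xi> * wave \<eta> \<xi> x * of_real (gaussian (\<epsilon> *\<^sub>R \<xi>)) = (\<integral>y. ?F y \<xi> \<partial>lborel)"
      unfolding eqF fourier_laplace_def integral_mult_left_zero by (simp only: mult.assoc)
  qed
  also have "\<dots> = (\<integral>y. (\<integral>\<xi>. ?F y \<xi> \<partial>lborel) \<partial>lborel)"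
    by (rule lborel_pair.Fubini_integral[OF int])
  also have "\<dots> = (\<integral>y. (g y * wave \<eta> 0 (x - y)) * (inverse (\<epsilon> ^ ?n) *\<^sub>R of_real (gaussian_hat ((1 / \<epsilon>) *\<^sub>R (x - y)))) \<partial>lborel)"
  proof (rule Bochner_Integration.integral_cong[OF refl])
    fix y :: "real^'n"
    have w: "wave \<eta> \<xi> (x - y) = wave \<eta> 0 (x - y) * wave 0 \<xi> (x - y)" for \<xi>
      unfolding wave_def exp_add[symmetric] by (rule arg_cong[where f=exp]) (simp add: complex_eq_iff)
    have c: "continuous_on UNIV (\<lambda>\<xi>. of_real (gaussian \<xi>) * wave 0 \<xi> ((1 / \<epsilon>) *\<^sub>R (x - y)))"
      by (intro continuous_intros continuous_on_compose2[OF gaussian_props(4)]) auto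
    have sc: "wave 0 (\<epsilon> *\<^sub>R \<xi>) ((1 / \<epsilon>) *\<^sub>R (x - y)) = wave 0 \<xi> (x - y)" for \<xi>
      using \<epsilon> by (simp add: wave_def)
    have "of_real (gaussian_hat ((1 / \<epsilon>) *\<^sub>R (x - y))) = (\<integral>\<xi>. of_real (gaussian \<xi>) * wave 0 \<xi> ((1 / \<epsilon>) *\<^sub>R (x - y)) \<partial>lborel)"
      by (rule gaussian_fourier(2)[symmetric])
    also have "\<dots> = (\<epsilon> ^ ?n) *\<^sub>R (\<integral>\<xi>. of_real (gaussian (\<epsilon> *\<^sub>R \<xi>)) * wave 0 \<xi> (x - y) \<partial>lborel)"
      using lborel_integral_affine[of \<epsilon> "\<lambda>\<xi>. of_real (gaussian \<xi>) * wave 0 \<xi> ((1 / \<epsilon>) *\<^sub>R (x - y))" 0]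
        borel_measurable_continuous_onI[OF c] \<epsilon> by (simp add: sc)
    finally have "(\<integral>\<xi>. of_real (gaussian (\<epsilon> *\<^sub>R \<xi>)) * wave 0 \<xi> (x - y) \<partial>lborel) =
        inverse (\<epsilon> ^ ?n) *\<^sub>R of_real (gaussian_hat ((1 / \<epsilon>) *\<^sub>R (x - y)))"
      using \<epsilon> by simp
    moreover have "(\<integral>\<xi>. ?F y \<xi> \<partial>lborel) = (\<integral>\<xi>. (g y * wave \<eta> 0 (x - y)) * (of_real (gaussian (\<epsilon> *\<^sub>R \<xi>)) * wave 0 \<xi> (x - y)) \<partial>lborel)"
      by (rule Bochner_Integration.integral_cong[OF refl]) (subst w, simp add: mult_ac)
    ultimately show "(\<integral>\<xi>. ?F y \<xi> \<partial>lborel) = (g y * wave \<eta> 0 (x - y)) * (inverse (\<epsilon> ^ ?n) *\<^sub>R of_real (gaussian_hat ((1 / \<epsilon>) *\<^sub>R (x - y))))"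
      by simp
  qed
  also have "\<dots> = (\<integral>s. g (x + (- \<epsilon>) *\<^sub>R s) * wave \<eta> 0 (\<epsilon> *\<^sub>R s) * of_real (gaussian_hat s) \<partial>lborel)"
  proof -
    let ?h = "\<lambda>y. (g y * wave \<eta> 0 (x - y)) * (inverse (\<epsilon> ^ ?n) *\<^sub>R of_real (gaussian_hat ((1 / \<epsilon>) *\<^sub>R (x - y))))"
    have c: "continuous_on UNIV ?h"
      by (intro continuous_intros continuous_on_compose2[OF cg] continuous_on_compose2[OF gaussian_props(5)]) auto
    have "(\<integral>y. ?h y \<partial>lborel) = (\<bar>- \<epsilon>\<bar> ^ ?n) *\<^sub>R (\<integral>s. ?h (x + (- \<epsilon>) *\<^sub>R s) \<partial>lborel)"
      by (rule lborel_integral_affine) (use \<epsilon> borel_measurable_continuous_onI[OF c] in auto)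
    also have "\<dots> = (\<integral>s. (\<epsilon> ^ ?n) *\<^sub>R ?h (x + (- \<epsilon>) *\<^sub>R s) \<partial>lborel)" using \<epsilon> by simp
    also have "\<dots> = (\<integral>s. g (x + (- \<epsilon>) *\<^sub>R s) * wave \<eta> 0 (\<epsilon> *\<^sub>R s) * of_real (gaussian_hat s) \<partial>lborel)"
      by (rule Bochner_Integration.integral_cong[OF refl]) (use \<epsilon> in simp)
    finally show ?thesis .
  qed
  finally show ?thesis .
qed

text \<open>
  Both sides of the regularised identity converge by dominated convergence as \<open>\<epsilon>\<close> tends to 0. The
  right-hand side does not depend on \<open>\<eta>\<close>: this is the shift of the contour of integration.
\<close>

theorem fourier_inversion:
  fixes g :: "real^'n::finite \<Rightarrow> complex"
  assumes g: "test_fun g" and int: "integrable lborel (fourier_laplace g \<eta>)"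
  shows "(\<integral>\<xi>. fourier_laplace g \<eta> \<xi> * wave \<eta> \<xi> x \<partial>lborel) = inv_const TYPE('n) * g x"
proof -
  have cg: "continuous_on UNIV g" by (rule test_fun_continuous[OF g])
  have cl: "continuous_on UNIV (fourier_laplace g \<eta>)" by (rule continuous_fourier_laplace[OF g])
  obtain R where R: "\<And>x. norm x > R \<Longrightarrow> g x = 0" using g by (auto simp: test_fun_def)
  let ?\<epsilon> = "\<lambda>k::nat. 1 / real (Suc k)"
  have e0: "?\<epsilon> \<longlonglongrightarrow> 0" by (rule LIMSEQ_Suc[OF lim_1_over_n])
  let ?L = "\<lambda>k. (\<integral>\<xi>. fourier_laplace g \<eta> \<xi> * wave \<eta> \<xi> x * of_real (gaussian (?\<epsilon> k *\<^sub>R \<xi>)) \<partial>lborel)"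
  have ci: "continuous_on UNIV (\<lambda>\<xi>. fourier_laplace g \<eta> \<xi> * wave \<eta> \<xi> x * of_real (gaussian (e *\<^sub>R \<xi>)))" for e
    by (intro continuous_intros cl continuous_on_compose2[OF gaussian_props(4)]) auto
  have "?L \<longlonglongrightarrow> (\<integral>\<xi>. fourier_laplace g \<eta> \<xi> * wave \<eta> \<xi> x * of_real (gaussian (0::real^'n)) \<partial>lborel)"
  proof (rule integral_dominated_convergence[where w = "\<lambda>\<xi>. norm (fourier_laplace g \<eta> \<xi>) * (exp (\<eta> \<bullet> x) * gaussian (0::real^'n))"])
    show "(\<lambda>\<xi>. fourier_laplace g \<eta> \<xi> * wave \<eta> \<xi> x * of_real (gaussian (0::real^'n))) \<in> borel_measurable lborel"
      using borel_measurable_continuous_onI[OF ci[of 0]] by simp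
    show "(\<lambda>\<xi>. fourier_laplace g \<eta> \<xi> * wave \<eta> \<xi> x * of_real (gaussian (?\<epsilon> k *\<^sub>R \<xi>))) \<in> borel_measurable lborel" for k
      using borel_measurable_continuous_onI[OF ci[of "?\<epsilon> k"]] by simp
    show "integrable lborel (\<lambda>\<xi>. norm (fourier_laplace g \<eta> \<xi>) * (exp (\<eta> \<bullet> x) * gaussian (0::real^'n)))"
      by (intro integrable_mult_left integrable_norm int)
    show "AE \<xi> in lborel. (\<lambda>k. fourier_laplace g \<eta> \<xi> * wave \<eta> \<xi> x * of_real (gaussian (?\<epsilon> k *\<^sub>R \<xi>))) \<longlonglongrightarrow>
        fourier_laplace g \<eta> \<xi> * wave \<eta> \<xi> x * of_real (gaussian (0::real^'n))"
    proof (intro always_eventually allI tendsto_intros)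
      fix \<xi> :: "real^'n"
      have "(\<lambda>k. ?\<epsilon> k *\<^sub>R \<xi>) \<longlonglongrightarrow> 0 *\<^sub>R \<xi>" by (intro tendsto_intros e0)
      then show "(\<lambda>k. gaussian (?\<epsilon> k *\<^sub>R \<xi>)) \<longlonglongrightarrow> gaussian (0::real^'n)"
        using continuous_on_tendsto_compose[OF gaussian_props(4), of "\<lambda>k. ?\<epsilon> k *\<^sub>R \<xi>" 0] by simp
    qed
    show "AE \<xi> in lborel. norm (fourier_laplace g \<eta> \<xi> * wave \<eta> \<xi> x * of_real (gaussian (?\<epsilon> k *\<^sub>R \<xi>)))
        \<le> norm (fourier_laplace g \<eta> \<xi>) * (exp (\<eta> \<bullet> x) * gaussian (0::real^'n))" for k
    proof (intro always_eventually allI)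
      fix \<xi> :: "real^'n"
      show "norm (fourier_laplace g \<eta> \<xi> * wave \<eta> \<xi> x * of_real (gaussian (?\<epsilon> k *\<^sub>R \<xi>)))
        \<le> norm (fourier_laplace g \<eta> \<xi>) * (exp (\<eta> \<bullet> x) * gaussian (0::real^'n))"
        using gaussian_props(1,2)[of "?\<epsilon> k *\<^sub>R \<xi>"]
        by (auto simp: norm_mult norm_wave mult.assoc intro!: mult_left_mono)
    qed
  qed
  moreover have "?L \<longlonglongrightarrow> (\<integral>s. g x * of_real (gaussian_hat (s::real^'n)) \<partial>lborel)"
  proof -
    let ?K = "\<lambda>k s. g (x + (- ?\<epsilon> k) *\<^sub>R s) * wave \<eta> 0 (?\<epsilon> k *\<^sub>R s) * of_real (gaussian_hat s)"
    obtain B where B: "B > 0" "\<And>y. norm (g y * wave \<eta> 0 (x - y)) \<le> B"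
    proof (rule bounded_compact_support[where u = "\<lambda>y. g y * wave \<eta> 0 (x - y)" and R = R])
      show "continuous_on UNIV (\<lambda>y. g y * wave \<eta> 0 (x - y))" by (intro continuous_intros cg)
    qed (use R in auto)
    have cK: "continuous_on UNIV (\<lambda>s. g (x + (- e) *\<^sub>R s) * wave \<eta> 0 (e *\<^sub>R s) * of_real (gaussian_hat s))" for e
      by (intro continuous_intros continuous_on_compose2[OF cg] continuous_on_compose2[OF gaussian_props(5)]) auto
    have "(\<lambda>k. \<integral>s. ?K k s \<partial>lborel) \<longlonglongrightarrow> (\<integral>s. g x * of_real (gaussian_hat (s::real^'n)) \<partial>lborel)"
    proof (rule integral_dominated_convergence[where w = "\<lambda>s::real^'n. B * norm (complex_of_real (gaussian_hat s))"])
      show "(\<lambda>s::real^'n. g x * of_real (gaussian_hat s)) \<in> borel_measurable lborel"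
        using borel_measurable_continuous_onI[OF cK[of 0]] by (simp add: wave_def Complex_eq)
      show "?K k \<in> borel_measurable lborel" for k
        using borel_measurable_continuous_onI[OF cK[of "?\<epsilon> k"]] by simp
      show "integrable lborel (\<lambda>s::real^'n. B * norm (complex_of_real (gaussian_hat s)))"
        by (intro integrable_mult_right integrable_norm gaussian_hat_integral)
      show "AE s::real^'n in lborel. (\<lambda>k. ?K k s) \<longlonglongrightarrow> g x * of_real (gaussian_hat s)"
      proof (intro always_eventually allI)
        fix s :: "real^'n"
        have "continuous_on UNIV (\<lambda>e. g (x + (- e) *\<^sub>R s) * wave \<eta> 0 (e *\<^sub>R s) * of_real (gaussian_hat s))"
          by (intro continuous_intros continuous_on_compose2[OF cg]) auto
        from continuous_on_tendsto_compose[OF this e0]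
        show "(\<lambda>k. ?K k s) \<longlonglongrightarrow> g x * of_real (gaussian_hat s)"
          by (simp add: wave_def Complex_eq)
      qed
      show "AE s in lborel. norm (?K k s) \<le> B * norm (complex_of_real (gaussian_hat s))" for k
      proof (intro always_eventually allI)
        fix s :: "real^'n"
        have "norm (g (x + (- ?\<epsilon> k) *\<^sub>R s) * wave \<eta> 0 (?\<epsilon> k *\<^sub>R s)) \<le> B"
          using B(2)[of "x + (- ?\<epsilon> k) *\<^sub>R s"] by simp
        then show "norm (?K k s) \<le> B * norm (complex_of_real (gaussian_hat s))"
          unfolding norm_mult[of "g (x + (- ?\<epsilon> k) *\<^sub>R s) * wave \<eta> 0 (?\<epsilon> k *\<^sub>R s)"]
          by (rule mult_right_mono) simp
      qed
    qed
    then show ?thesis using gaussian_regularised_inversion[OF g, of "?\<epsilon> _" \<eta> x] by simp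
  qed
  ultimately have "(\<integral>\<xi>. fourier_laplace g \<eta> \<xi> * wave \<eta> \<xi> x * of_real (gaussian (0::real^'n)) \<partial>lborel) =
      (\<integral>s. g x * of_real (gaussian_hat (s::real^'n)) \<partial>lborel)"
    by (rule LIMSEQ_unique)
  then have "(\<integral>\<xi>. fourier_laplace g \<eta> \<xi> * wave \<eta> \<xi> x \<partial>lborel) * of_real (gaussian (0::real^'n)) =
      g x * (\<integral>s. of_real (gaussian_hat (s::real^'n)) \<partial>lborel)"
    by simp
  then show ?thesis using gaussian_props(3)[where 'n='n]
    unfolding inv_const_def by (simp add: field_simps)
qed

section \<open>Superpositions of exponentials\<close>

definition superpose :: "(real^'n \<Rightarrow> complex) \<Rightarrow> real^'n \<Rightarrow> real^'n::finite \<Rightarrow> complex" where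
  "superpose m \<eta> x = (\<integral>\<xi>. m \<xi> * wave \<eta> \<xi> x \<partial>lborel)"

text \<open>
  The amplitudes for which every formal derivative of the superposition converges absolutely.
\<close>

definition rapid :: "(real^'n \<Rightarrow> complex) \<Rightarrow> real^'n::finite \<Rightarrow> bool" where
  "rapid m \<eta> \<longleftrightarrow> m \<in> borel_measurable borel \<and>
     (\<forall>js. integrable lborel (\<lambda>\<xi>. norm (m \<xi>) * norm (\<Prod>j\<leftarrow>js. freq \<eta> \<xi> j)))"

lemma measurable_freq_prod [measurable]: "(\<lambda>\<xi>. \<Prod>j\<leftarrow>js. freq \<eta> \<xi> j) \<in> borel_measurable borel"
proof (induction js)
  case (Cons j js)
  have [measurable]: "(\<lambda>\<xi>. freq \<eta> \<xi> j) \<in> borel_measurable borel"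
    by (intro borel_measurable_continuous_onI continuous_intros)
  show ?case using Cons by simp
qed simp

lemma measurable_wave [measurable]: "(\<lambda>\<xi>. wave \<eta> \<xi> x) \<in> borel_measurable borel"
  by (intro borel_measurable_continuous_onI continuous_intros)

lemma rapid_mult_freq:
  assumes "rapid m \<eta>"
  shows "rapid (\<lambda>\<xi>. m \<xi> * (\<Prod>j\<leftarrow>js. freq \<eta> \<xi> j)) \<eta>"
  unfolding rapid_def
proof (intro conjI allI)
  have [measurable]: "m \<in> borel_measurable borel" using assms by (simp add: rapid_def)
  show "(\<lambda>\<xi>. m \<xi> * (\<Prod>j\<leftarrow>js. freq \<eta> \<xi> j)) \<in> borel_measurable borel" by measurable
  fix ks
  have "integrable lborel (\<lambda>\<xi>. norm (m \<xi>) * norm (\<Prod>j\<leftarrow>js @ ks. freq \<eta> \<xi> j))"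
    using assms unfolding rapid_def by blast
  then show "integrable lborel (\<lambda>\<xi>. norm (m \<xi> * (\<Prod>j\<leftarrow>js. freq \<eta> \<xi> j)) * norm (\<Prod>j\<leftarrow>ks. freq \<eta> \<xi> j))"
    by (simp add: norm_mult mult.assoc)
qed

lemma superpose_integrable:
  assumes "rapid m \<eta>"
  shows "integrable lborel (\<lambda>\<xi>. m \<xi> * wave \<eta> \<xi> x)"
proof -
  have [measurable]: "m \<in> borel_measurable borel" using assms by (simp add: rapid_def)
  have "integrable lborel (\<lambda>\<xi>. norm (m \<xi>) * norm (\<Prod>j\<leftarrow>[]. freq \<eta> \<xi> j))"
    using assms unfolding rapid_def by blast
  then have "integrable lborel (\<lambda>\<xi>. norm (m \<xi>) * exp (\<eta> \<bullet> x))" by simp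
  then show ?thesis
    by (rule Bochner_Integration.integrable_bound) (auto simp: norm_mult norm_wave)
qed

text \<open>
  On a unit segment the exponential grows at most by \<open>exp \<bar>\<eta> $ i\<bar>\<close>, which provides the integrable
  majorant for differentiation under the integral sign.
\<close>

lemma has_partial_superpose:
  fixes m :: "real^'n::finite \<Rightarrow> complex"
  assumes m: "rapid m \<eta>"
  shows "has_partial i (superpose m \<eta>) (superpose (\<lambda>\<xi>. m \<xi> * freq \<eta> \<xi> i) \<eta> x) x"
proof -
  have mf: "rapid (\<lambda>\<xi>. m \<xi> * freq \<eta> \<xi> i) \<eta>" using rapid_mult_freq[OF m, of "[i]"] by simp
  let ?b = "\<lambda>\<xi>. norm (m \<xi> * freq \<eta> \<xi> i) * exp (\<eta> \<bullet> x + \<bar>\<eta> $ i\<bar>)"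
  have "((\<lambda>t. \<integral>\<xi>. m \<xi> * wave \<eta> \<xi> (x + t *\<^sub>R axis i 1) \<partial>lborel) has_vector_derivative
      (\<integral>\<xi>. m \<xi> * freq \<eta> \<xi> i * wave \<eta> \<xi> (x + 0 *\<^sub>R axis i 1) \<partial>lborel)) (at 0)"
  proof (rule has_vector_derivative_integral[where b = ?b])
    show "integrable lborel (\<lambda>\<xi>. m \<xi> * wave \<eta> \<xi> (x + t *\<^sub>R axis i 1))" for t
      by (rule superpose_integrable[OF m])
    show "(\<lambda>\<xi>. m \<xi> * freq \<eta> \<xi> i * wave \<eta> \<xi> (x + 0 *\<^sub>R axis i 1)) \<in> borel_measurable lborel"
      by (rule borel_measurable_integrable[OF superpose_integrable[OF mf]])
    have "integrable lborel (\<lambda>\<xi>. norm (m \<xi> * freq \<eta> \<xi> i) * norm (\<Prod>j\<leftarrow>[]. freq \<eta> \<xi> j))"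
      using mf unfolding rapid_def by blast
    then show "integrable lborel ?b" by simp
    fix t :: real and \<xi> :: "real^'n"
    have "((\<lambda>s. wave \<eta> \<xi> (x + s *\<^sub>R axis i 1)) has_vector_derivative
        freq \<eta> \<xi> i * wave \<eta> \<xi> (x + t *\<^sub>R axis i 1)) (at t)"
      by (rule has_partial_at[OF has_partial_wave])
    then show "((\<lambda>s. m \<xi> * wave \<eta> \<xi> (x + s *\<^sub>R axis i 1)) has_vector_derivative
        m \<xi> * freq \<eta> \<xi> i * wave \<eta> \<xi> (x + t *\<^sub>R axis i 1)) (at t)"
      unfolding mult.assoc by (rule has_vector_derivative_mult_right)
    assume t: "\<bar>t\<bar> < 1"
    have "\<eta> \<bullet> (x + t *\<^sub>R axis i 1) = \<eta> \<bullet> x + t * \<eta> $ i" by (simp add: inner_add_right inner_axis)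
    moreover have "t * \<eta> $ i \<le> \<bar>t\<bar> * \<bar>\<eta> $ i\<bar>" by (metis abs_ge_self abs_mult)
    moreover have "\<bar>t\<bar> * \<bar>\<eta> $ i\<bar> \<le> 1 * \<bar>\<eta> $ i\<bar>" using t by (intro mult_right_mono) auto
    ultimately have "exp (\<eta> \<bullet> (x + t *\<^sub>R axis i 1)) \<le> exp (\<eta> \<bullet> x + \<bar>\<eta> $ i\<bar>)" by simp
    then show "norm (m \<xi> * freq \<eta> \<xi> i * wave \<eta> \<xi> (x + t *\<^sub>R axis i 1)) \<le> ?b \<xi>"
      unfolding norm_mult[of "m \<xi> * freq \<eta> \<xi> i"] norm_wave by (rule mult_left_mono) simp
  qed
  then show ?thesis unfolding has_partial_def superpose_def by simp
qed

lemma continuous_superpose: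
  assumes m: "rapid m \<eta>"
  shows "continuous_on UNIV (superpose m \<eta>)"
proof (rule continuous_at_imp_continuous_on, rule ballI)
  fix x
  let ?b = "\<lambda>\<xi>. norm (m \<xi>) * exp (\<eta> \<bullet> x + norm \<eta>)"
  show "isCont (superpose m \<eta>) x" unfolding isCont_def superpose_def
  proof (rule tendsto_integral_dominated_at[where b = ?b])
    show "(\<lambda>\<xi>. m \<xi> * wave \<eta> \<xi> y) \<in> borel_measurable lborel"
        "(\<lambda>\<xi>. m \<xi> * wave \<eta> \<xi> x) \<in> borel_measurable lborel" for y
      by (rule borel_measurable_integrable[OF superpose_integrable[OF m]])+
    have "integrable lborel (\<lambda>\<xi>. norm (m \<xi>) * norm (\<Prod>j\<leftarrow>[]. freq \<eta> \<xi> j))"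
      using m unfolding rapid_def by blast
    then show "integrable lborel ?b" by simp
    show "((\<lambda>t. m \<xi> * wave \<eta> \<xi> t) \<longlongrightarrow> m \<xi> * wave \<eta> \<xi> x) (at x)" for \<xi>
    proof -
      have "continuous_on UNIV (\<lambda>t. m \<xi> * wave \<eta> \<xi> t)" by (intro continuous_intros)
      then have "isCont (\<lambda>t. m \<xi> * wave \<eta> \<xi> t) x" by (simp add: continuous_on_eq_continuous_at)
      then show ?thesis by (simp add: isCont_def)
    qed
    show "\<forall>\<^sub>F t in at x. \<forall>\<xi>. norm (m \<xi> * wave \<eta> \<xi> t) \<le> ?b \<xi>"
      unfolding eventually_at
    proof (intro exI[of _ 1] conjI ballI impI allI)
      fix t \<xi> assume "t \<noteq> x \<and> dist t x < 1"
      then have "norm (t - x) \<le> 1" by (simp add: dist_norm)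
      have "\<eta> \<bullet> t = \<eta> \<bullet> x + \<eta> \<bullet> (t - x)" by (simp add: inner_diff_right)
      also have "\<eta> \<bullet> (t - x) \<le> norm \<eta> * norm (t - x)" by (rule norm_cauchy_schwarz)
      also have "\<dots> \<le> norm \<eta> * 1" by (rule mult_left_mono) (use \<open>norm (t - x) \<le> 1\<close> in auto)
      finally have "exp (\<eta> \<bullet> t) \<le> exp (\<eta> \<bullet> x + norm \<eta>)" by simp
      then show "norm (m \<xi> * wave \<eta> \<xi> t) \<le> ?b \<xi>"
        unfolding norm_mult norm_wave by (rule mult_left_mono) simp
    qed auto
  qed
qed

lemma iter_partial_superpose:
  assumes m: "rapid m \<eta>"
  shows "iter_partial js (superpose m \<eta>) = superpose (\<lambda>\<xi>. m \<xi> * (\<Prod>j\<leftarrow>js. freq \<eta> \<xi> j)) \<eta>"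
proof (induction js)
  case (Cons i js)
  show ?case
  proof
    fix x
    have "has_partial i (iter_partial js (superpose m \<eta>))
      (superpose (\<lambda>\<xi>. m \<xi> * (\<Prod>j\<leftarrow>js. freq \<eta> \<xi> j) * freq \<eta> \<xi> i) \<eta> x) x"
      unfolding Cons by (rule has_partial_superpose[OF rapid_mult_freq[OF m]])
    then show "iter_partial (i # js) (superpose m \<eta>) x = superpose (\<lambda>\<xi>. m \<xi> * (\<Prod>j\<leftarrow>i # js. freq \<eta> \<xi> j)) \<eta> x"
      by (simp add: has_partial_unique mult.assoc mult.commute[of "freq \<eta> _ i"])
  qed
qed simp

lemma smooth_on_superpose:
  assumes m: "rapid m \<eta>"
  shows "smooth_on UNIV (superpose m \<eta>)"
  unfolding smooth_on_def iter_partial_superpose[OF m]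
proof (intro allI conjI ballI)
  fix js i x
  show "continuous_on UNIV (superpose (\<lambda>\<xi>. m \<xi> * (\<Prod>j\<leftarrow>js. freq \<eta> \<xi> j)) \<eta>)"
    by (rule continuous_superpose[OF rapid_mult_freq[OF m]])
  show "(\<lambda>t. superpose (\<lambda>\<xi>. m \<xi> * (\<Prod>j\<leftarrow>js. freq \<eta> \<xi> j)) \<eta> (x + t *\<^sub>R axis i 1)) differentiable at 0"
    using has_partial_superpose[OF rapid_mult_freq[OF m], of i js x]
    unfolding has_partial_def by (rule differentiableI_vector)
qed

text \<open>
  The eigenvalue of \<open>P(D)\<close> on \<open>wave \<eta> \<xi>\<close>.
\<close>

definition symbol :: "'n cpoly \<Rightarrow> real^'n \<Rightarrow> real^'n::finite \<Rightarrow> complex" where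
  "symbol P \<eta> \<xi> = (\<Sum>\<alpha>\<in>Poly_Mapping.keys P. Poly_Mapping.lookup P \<alpha> *
     (- \<i>) ^ length (multi_index_list \<alpha>) * (\<Prod>j\<leftarrow>multi_index_list \<alpha>. freq \<eta> \<xi> j))"

lemma measurable_symbol [measurable]: "symbol P \<eta> \<in> borel_measurable borel"
  unfolding symbol_def by measurable

lemma diff_op_superpose:
  assumes m: "rapid m \<eta>"
  shows "diff_op P (superpose m \<eta>) x = (\<integral>\<xi>. symbol P \<eta> \<xi> * m \<xi> * wave \<eta> \<xi> x \<partial>lborel)"
proof -
  have "diff_op P (superpose m \<eta>) x = (\<Sum>\<alpha>\<in>Poly_Mapping.keys P. Poly_Mapping.lookup P \<alpha> *
     (- \<i>) ^ length (multi_index_list \<alpha>) * (\<integral>\<xi>. m \<xi> * (\<Prod>j\<leftarrow>multi_index_list \<alpha>. freq \<eta> \<xi> j) * wave \<eta> \<xi> x \<partial>lborel))"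
    unfolding diff_op_smooth[OF open_UNIV smooth_on_superpose[OF m] UNIV_I] iter_partial_superpose[OF m] superpose_def ..
  also have "\<dots> = (\<integral>\<xi>. (\<Sum>\<alpha>\<in>Poly_Mapping.keys P. (Poly_Mapping.lookup P \<alpha> *
     (- \<i>) ^ length (multi_index_list \<alpha>)) * (m \<xi> * (\<Prod>j\<leftarrow>multi_index_list \<alpha>. freq \<eta> \<xi> j) * wave \<eta> \<xi> x)) \<partial>lborel)"
    by (subst Bochner_Integration.integral_sum)
       (auto intro!: integrable_mult_right superpose_integrable[OF rapid_mult_freq[OF m]])
  also have "\<dots> = (\<integral>\<xi>. symbol P \<eta> \<xi> * m \<xi> * wave \<eta> \<xi> x \<partial>lborel)"
    unfolding symbol_def sum_distrib_right
    by (intro Bochner_Integration.integral_cong refl sum.cong) (simp add: mult_ac)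
  finally show ?thesis .
qed

section \<open>Finite differences\<close>

text \<open>
  Pascal's rule: a difference of order \<open>a + 1\<close> is the difference of order \<open>a\<close> of first differences.
\<close>

lemma alternating_binomial_Suc:
  fixes f :: "nat \<Rightarrow> complex"
  shows "(\<Sum>l\<le>Suc a. (- 1) ^ l * of_nat (Suc a choose l) * f l) =
     (\<Sum>l\<le>a. (- 1) ^ l * of_nat (a choose l) * (f l - f (Suc l)))"
proof -
  have "(\<Sum>l\<le>Suc a. (- 1) ^ l * of_nat (Suc a choose l) * f l) =
      f 0 + (\<Sum>l\<le>a. - ((- 1) ^ l * of_nat (a choose l) * f (Suc l)) - (- 1) ^ l * of_nat (a choose Suc l) * f (Suc l))"
    by (subst sum.atMost_Suc_shift) (simp add: algebra_simps)
  also have "\<dots> = (f 0 + (\<Sum>l\<le>a. (- 1) ^ Suc l * of_nat (a choose Suc l) * f (Suc l)))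
      - (\<Sum>l\<le>a. (- 1) ^ l * of_nat (a choose l) * f (Suc l))"
    by (simp add: sum_subtractf sum_negf)
  also have "f 0 + (\<Sum>l\<le>a. (- 1) ^ Suc l * of_nat (a choose Suc l) * f (Suc l)) =
      (\<Sum>l\<le>Suc a. (- 1) ^ l * of_nat (a choose l) * f l)"
    by (subst sum.atMost_Suc_shift) simp
  also have "\<dots> = (\<Sum>l\<le>a. (- 1) ^ l * of_nat (a choose l) * f l)" by simp
  finally show ?thesis by (simp add: sum_subtractf algebra_simps)
qed

text \<open>
  A first difference lowers the degree of a polynomial by one, so the \<open>a\<close>-th difference kills degrees
  below \<open>a\<close> and turns degree \<open>a\<close> into a constant independent of the base point \<open>\<tau>\<close>.
\<close>

lemma finite_difference:
  fixes \<tau> s :: complex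
  assumes "b \<le> a"
  shows "(\<Sum>l\<le>a. (- 1) ^ l * of_nat (a choose l) * (\<tau> + s * of_nat l) ^ b) =
     (if b = a then (- s) ^ a * fact a else 0)"
  using assms
proof (induction a arbitrary: b \<tau>)
  case (Suc a)
  let ?S = "\<lambda>a b. (\<Sum>l\<le>a. (- 1) ^ l * of_nat (a choose l) * (\<tau> + s * of_nat l) ^ b)"
  have step: "y ^ b - (y + s) ^ b = - (\<Sum>c<b. of_nat (b choose c) * s ^ (b - c) * y ^ c)" for y :: complex
  proof -
    have "(y + s) ^ b = (\<Sum>c\<le>b. of_nat (b choose c) * y ^ c * s ^ (b - c))" by (rule binomial_ring)
    also have "\<dots> = (\<Sum>c<b. of_nat (b choose c) * y ^ c * s ^ (b - c)) + y ^ b"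
      by (simp add: lessThan_Suc_atMost[symmetric])
    finally show ?thesis by (simp add: mult_ac)
  qed
  have "?S (Suc a) b = (\<Sum>l\<le>a. (- 1) ^ l * of_nat (a choose l) * ((\<tau> + s * of_nat l) ^ b - (\<tau> + s * of_nat (Suc l)) ^ b))"
    by (rule alternating_binomial_Suc)
  also have "\<dots> = (\<Sum>l\<le>a. (- 1) ^ l * of_nat (a choose l) * ((\<tau> + s * of_nat l) ^ b - ((\<tau> + s * of_nat l) + s) ^ b))"
    by (simp add: algebra_simps)
  also have "\<dots> = (\<Sum>l\<le>a. \<Sum>c<b. - (of_nat (b choose c) * s ^ (b - c)) * ((- 1) ^ l * of_nat (a choose l) * (\<tau> + s * of_nat l) ^ c))"
    unfolding step sum_negf[symmetric] sum_distrib_left by (intro sum.cong refl) (simp add: mult_ac)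
  also have "\<dots> = (\<Sum>c<b. \<Sum>l\<le>a. - (of_nat (b choose c) * s ^ (b - c)) * ((- 1) ^ l * of_nat (a choose l) * (\<tau> + s * of_nat l) ^ c))"
    by (rule sum.swap)
  also have "\<dots> = (\<Sum>c<b. - (of_nat (b choose c) * s ^ (b - c)) * ?S a c)"
    unfolding sum_distrib_left ..
  also have "\<dots> = (\<Sum>c<b. if c = a then - (of_nat (b choose c) * s ^ (b - c)) * ((- s) ^ a * fact a) else 0)"
    using Suc.prems by (intro sum.cong refl) (subst Suc.IH, auto)
  also have "\<dots> = (if b = Suc a then (- s) ^ Suc a * fact (Suc a) else 0)"
    using Suc.prems by (auto simp: sum.delta algebra_simps)
  finally show ?case .
qed auto

section \<open>Solving the equation with exponential weights\<close>

lemma prod_list_count: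
  fixes f :: "'n::finite \<Rightarrow> complex"
  shows "(\<Prod>j\<leftarrow>js. f j) = (\<Prod>j\<in>UNIV. f j ^ count_list js j)"
proof (induction js)
  case (Cons i js)
  have "(\<Prod>j\<in>UNIV. f j ^ count_list (i # js) j) = (\<Prod>j\<in>UNIV. (if i = j then f j else 1) * f j ^ count_list js j)"
    by (intro prod.cong refl) auto
  then show ?case using Cons by (simp add: prod.distrib)
qed simp

lemma ex_list_count: "\<exists>js. \<forall>j::'n::finite. count_list js j = \<gamma> j"
proof (intro exI allI)
  fix j
  show "count_list (multi_index_list (Abs_poly_mapping \<gamma>)) j = \<gamma> j"
    by (simp add: multi_index_list_count Abs_poly_mapping_inverse)
qed

text \<open>
  Complex conjugation becomes an affine substitution in the frequency with coefficients depending on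
  \<open>\<eta>\<close>. This makes the conjugate of the symbol a polynomial in the frequency again.
\<close>

lemma cnj_freq: "cnj (freq \<eta> \<xi> j) = 2 * of_real (\<eta> $ j) - freq \<eta> \<xi> j"
  by (simp add: freq_def complex_eq_iff)

text \<open>
  The coefficient of \<open>\<Prod>j. (- z j) ^ \<gamma> j\<close> in \<open>\<Prod>j. (2 \<eta> j - z j) ^ \<alpha> j\<close>.
\<close>

definition shift_coeff :: "('n::finite \<Rightarrow> nat) \<Rightarrow> ('n \<Rightarrow> nat) \<Rightarrow> real^'n \<Rightarrow> complex" where
  "shift_coeff \<alpha> \<gamma> \<eta> = (\<Prod>j\<in>UNIV. of_nat (\<alpha> j choose \<gamma> j) * (2 * of_real (\<eta> $ j)) ^ (\<alpha> j - \<gamma> j))"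

definition indices_le :: "('n::finite \<Rightarrow> nat) \<Rightarrow> ('n \<Rightarrow> nat) set" where
  "indices_le \<alpha> = (\<Pi>\<^sub>E j\<in>UNIV. {..\<alpha> j})"

lemma finite_indices_le: "finite (indices_le \<alpha>)"
  unfolding indices_le_def by (intro finite_PiE) auto

lemma cnj_symbol:
  "cnj (symbol P \<eta> \<xi>) = (\<Sum>\<alpha>\<in>Poly_Mapping.keys P. \<Sum>\<gamma>\<in>indices_le (Poly_Mapping.lookup \<alpha>).
     (cnj (Poly_Mapping.lookup P \<alpha>) * \<i> ^ length (multi_index_list \<alpha>) * shift_coeff (Poly_Mapping.lookup \<alpha>) \<gamma> \<eta>)
       * (\<Prod>j\<in>UNIV. (- freq \<eta> \<xi> j) ^ \<gamma> j))"
proof -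
  have "cnj (\<Prod>j\<leftarrow>multi_index_list \<alpha>. freq \<eta> \<xi> j) =
      (\<Sum>\<gamma>\<in>indices_le (Poly_Mapping.lookup \<alpha>). shift_coeff (Poly_Mapping.lookup \<alpha>) \<gamma> \<eta> * (\<Prod>j\<in>UNIV. (- freq \<eta> \<xi> j) ^ \<gamma> j))" for \<alpha>
  proof -
    have "cnj (\<Prod>j\<leftarrow>multi_index_list \<alpha>. freq \<eta> \<xi> j) =
        (\<Prod>j\<in>UNIV. (- freq \<eta> \<xi> j + 2 * of_real (\<eta> $ j)) ^ Poly_Mapping.lookup \<alpha> j)"
      by (simp add: prod_list_count multi_index_list_count cnj_freq)
    also have "\<dots> = (\<Prod>j\<in>UNIV. \<Sum>k\<le>Poly_Mapping.lookup \<alpha> j. of_nat (Poly_Mapping.lookup \<alpha> j choose k) *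
        (- freq \<eta> \<xi> j) ^ k * (2 * of_real (\<eta> $ j)) ^ (Poly_Mapping.lookup \<alpha> j - k))"
      by (simp only: binomial_ring)
    also have "\<dots> = (\<Sum>\<gamma>\<in>indices_le (Poly_Mapping.lookup \<alpha>). \<Prod>j\<in>UNIV. of_nat (Poly_Mapping.lookup \<alpha> j choose \<gamma> j) *
        (- freq \<eta> \<xi> j) ^ \<gamma> j * (2 * of_real (\<eta> $ j)) ^ (Poly_Mapping.lookup \<alpha> j - \<gamma> j))"
      unfolding indices_le_def by (rule prod_sum_PiE) auto
    also have "\<dots> = (\<Sum>\<gamma>\<in>indices_le (Poly_Mapping.lookup \<alpha>). shift_coeff (Poly_Mapping.lookup \<alpha>) \<gamma> \<eta> * (\<Prod>j\<in>UNIV. (- freq \<eta> \<xi> j) ^ \<gamma> j))"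
      unfolding shift_coeff_def prod.distrib[symmetric] by (intro sum.cong prod.cong refl) (simp add: mult_ac)
    finally show ?thesis .
  qed
  then show ?thesis unfolding symbol_def
    by (simp add: sum_distrib_left mult.assoc)
qed

definition lattice :: "('n::finite \<Rightarrow> nat) \<Rightarrow> real^'n" where
  "lattice l = (\<chi> j. real (l j))"

text \<open>
  The weights of the mixed difference of order \<open>A j\<close> in the \<open>j\<close>-th variable.
\<close>

definition diff_weight :: "('n::finite \<Rightarrow> nat) \<Rightarrow> ('n \<Rightarrow> nat) \<Rightarrow> complex" where
  "diff_weight A l = (\<Prod>j\<in>UNIV. (- 1) ^ l j * of_nat (A j choose l j))"

text \<open>
  The sum factorises over the variables. Unless \<open>\<alpha> = A\<close> and \<open>\<gamma> = 0\<close>, some factor is a difference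
  of order \<open>A j\<close> of a power with smaller exponent, because the total degree of \<open>\<alpha>\<close> is at most that of \<open>A\<close>.
\<close>

lemma difference_shift_coeff:
  fixes A \<alpha> \<gamma> :: "'n::finite \<Rightarrow> nat"
  assumes deg: "(\<Sum>j\<in>UNIV. \<alpha> j) \<le> (\<Sum>j\<in>UNIV. A j)" and \<gamma>: "\<gamma> \<in> indices_le \<alpha>"
  shows "(\<Sum>l\<in>indices_le A. diff_weight A l * shift_coeff \<alpha> \<gamma> (\<eta> + lattice l)) =
     (if \<alpha> = A \<and> \<gamma> = (\<lambda>_. 0) then (\<Prod>j\<in>UNIV. (- 2) ^ A j * fact (A j)) else 0)"
proof -
  let ?T = "\<lambda>j. (\<Sum>l\<le>A j. (- 1) ^ l * of_nat (A j choose l) * (2 * of_real (\<eta> $ j) + 2 * of_nat l) ^ (\<alpha> j - \<gamma> j)) :: complex"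
  have "(\<Sum>l\<in>indices_le A. diff_weight A l * shift_coeff \<alpha> \<gamma> (\<eta> + lattice l)) =
      (\<Sum>l\<in>indices_le A. \<Prod>j\<in>UNIV. of_nat (\<alpha> j choose \<gamma> j) * ((- 1) ^ l j * of_nat (A j choose l j) *
        (2 * of_real (\<eta> $ j) + 2 * of_nat (l j)) ^ (\<alpha> j - \<gamma> j)))"
    unfolding diff_weight_def shift_coeff_def lattice_def prod.distrib[symmetric]
    by (intro sum.cong prod.cong refl) (simp add: algebra_simps)
  also have "\<dots> = (\<Prod>j\<in>UNIV. \<Sum>l\<le>A j. of_nat (\<alpha> j choose \<gamma> j) * ((- 1) ^ l * of_nat (A j choose l) *
        (2 * of_real (\<eta> $ j) + 2 * of_nat l) ^ (\<alpha> j - \<gamma> j)))"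
    unfolding indices_le_def by (rule prod_sum_PiE[symmetric]) auto
  also have "\<dots> = (\<Prod>j\<in>UNIV. of_nat (\<alpha> j choose \<gamma> j) * ?T j)"
    by (simp add: sum_distrib_left)
  finally have eq: "(\<Sum>l\<in>indices_le A. diff_weight A l * shift_coeff \<alpha> \<gamma> (\<eta> + lattice l)) = \<dots>" .
  show ?thesis
  proof (cases "\<alpha> = A \<and> \<gamma> = (\<lambda>_. 0)")
    case True
    then have "?T j = (- 2) ^ A j * fact (A j)" for j by (simp add: finite_difference)
    then show ?thesis unfolding eq using True by simp
  next
    case False
    have "\<exists>j. \<alpha> j - \<gamma> j < A j"
    proof (rule ccontr)
      assume "\<nexists>j. \<alpha> j - \<gamma> j < A j"
      then have ge: "A j \<le> \<alpha> j - \<gamma> j" for j by (meson not_less)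
      have le: "\<gamma> j \<le> \<alpha> j" for j using \<gamma> by (auto simp: indices_le_def)
      have "\<alpha> j = A j" for j
      proof (rule ccontr)
        assume "\<alpha> j \<noteq> A j"
        then have "A j < \<alpha> j" using ge[of j] by simp
        then have "(\<Sum>j\<in>UNIV. A j) < (\<Sum>j\<in>UNIV. \<alpha> j)"
          using ge by (intro sum_strict_mono_ex1) (auto intro: order_trans[OF _ diff_le_self])
        then show False using deg by simp
      qed
      moreover from this have "\<gamma> j = 0" for j using ge[of j] le[of j] by (metis diff_diff_cancel diff_is_0_eq' le_antisym diff_le_self diff_self_eq_0)
      ultimately show False using False by blast
    qed
    then obtain j where "\<alpha> j - \<gamma> j < A j" by blast
    then have "?T j = 0" by (subst finite_difference) auto
    then show ?thesis unfolding eq using False by (subst prod_zero) auto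
  qed
qed

lemma norm_prod_list: "norm (\<Prod>j\<leftarrow>js. f j :: complex) = (\<Prod>j\<leftarrow>js. norm (f j))"
  by (induction js) (auto simp: norm_mult)

lemma fourier_laplace_uniform_decay:
  fixes g :: "real^'n::finite \<Rightarrow> complex"
  assumes g: "test_fun g" and R: "R \<ge> 0" "\<And>x. norm x > R \<Longrightarrow> g x = 0"
    and B: "\<And>ks x. length ks \<le> m + 2 * CARD('n) \<Longrightarrow> norm x \<le> R \<Longrightarrow>
      norm (iter_partial ks g x) * exp (- (\<eta> \<bullet> x)) \<le> B"
    and js: "length js \<le> m"
  shows "norm (fourier_laplace g \<eta> \<xi>) * norm (\<Prod>j\<leftarrow>js. freq \<eta> \<xi> j) \<le>
    2 ^ CARD('n) * (measure lborel (cball (0::real^'n) R) * B) * decay \<xi>"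
  unfolding norm_prod_list
proof (rule fourier_laplace_decay[OF g _ js])
  fix ks :: "'n list" assume ks: "length ks \<le> m + 2 * CARD('n)"
  show "norm (fourier_laplace (iter_partial ks g) \<eta> \<xi>) \<le> measure lborel (cball (0::real^'n) R) * B"
  proof (rule fourier_laplace_bound[OF test_fun_iter[OF g] R(1)])
    show "iter_partial ks g x = 0" if "norm x > R" for x
      by (rule iter_partial_zero_outside[where S = "cball 0 R"]) (use that R in auto)
  qed (rule B[OF ks])
qed

lemma fourier_laplace_rapid:
  fixes g :: "real^'n::finite \<Rightarrow> complex"
  assumes g: "test_fun g" and [measurable]: "q \<in> borel_measurable borel" and q: "\<And>\<xi>. norm (q \<xi>) \<le> 1"
  shows "rapid (\<lambda>\<xi>. q \<xi> * fourier_laplace g \<eta> \<xi>) \<eta>"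
  unfolding rapid_def
proof (intro conjI allI)
  have [measurable]: "fourier_laplace g \<eta> \<in> borel_measurable borel"
    by (rule borel_measurable_continuous_onI[OF continuous_fourier_laplace[OF g]])
  show "(\<lambda>\<xi>. q \<xi> * fourier_laplace g \<eta> \<xi>) \<in> borel_measurable borel" by measurable
  fix js :: "'n list"
  obtain R0 where R0: "\<And>x. norm x > R0 \<Longrightarrow> g x = 0" using g by (auto simp: test_fun_def)
  define R where "R = max R0 0"
  have R: "R \<ge> 0" "\<And>x. norm x > R \<Longrightarrow> g x = 0" using R0 by (auto simp: R_def)
  let ?M = "length js + 2 * CARD('n)"
  obtain G where G: "G > 0" "\<And>x. x \<in> cball 0 R \<Longrightarrow> jet ?M g x \<le> G"
    using jet_bounded_compact[of UNIV g "cball 0 R"] g by (auto simp: test_fun_def)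
  let ?B = "G * exp (norm \<eta> * R)"
  let ?C = "2 ^ CARD('n) * (measure lborel (cball (0::real^'n) R) * ?B)"
  have *: "norm (fourier_laplace g \<eta> \<xi>) * norm (\<Prod>j\<leftarrow>js. freq \<eta> \<xi> j) \<le> ?C * decay \<xi>" for \<xi>
  proof (rule fourier_laplace_uniform_decay[OF g R, where m = "length js"])
    fix ks :: "'n list" and x :: "real^'n" assume ks: "length ks \<le> ?M" and x: "norm x \<le> R"
    have "- (\<eta> \<bullet> x) \<le> norm \<eta> * norm x" using norm_cauchy_schwarz[of "- \<eta>" x] by simp
    also have "\<dots> \<le> norm \<eta> * R" by (rule mult_left_mono[OF x]) simp
    finally have "exp (- (\<eta> \<bullet> x)) \<le> exp (norm \<eta> * R)" by simp
    moreover have "norm (iter_partial ks g x) \<le> G" using jet_ge[OF ks, of g x] G(2)[of x] x by simp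
    ultimately show "norm (iter_partial ks g x) * exp (- (\<eta> \<bullet> x)) \<le> ?B"
      using G(1) by (intro mult_mono) auto
  qed auto
  show "integrable lborel (\<lambda>\<xi>. norm (q \<xi> * fourier_laplace g \<eta> \<xi>) * norm (\<Prod>j\<leftarrow>js. freq \<eta> \<xi> j))"
  proof (rule Bochner_Integration.integrable_bound)
    show "integrable lborel (\<lambda>\<xi>. ?C * decay \<xi> :: real)" by (intro integrable_mult_right integrable_decay)
    show "AE \<xi> in lborel. norm (norm (q \<xi> * fourier_laplace g \<eta> \<xi>) * norm (\<Prod>j\<leftarrow>js. freq \<eta> \<xi> j)) \<le> norm (?C * decay \<xi>)"
    proof (intro always_eventually allI)
      fix \<xi> :: "real^'n"
      have "norm (q \<xi>) * (norm (fourier_laplace g \<eta> \<xi>) * norm (\<Prod>j\<leftarrow>js. freq \<eta> \<xi> j)) \<le> 1 * (?C * decay \<xi>)"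
        by (intro mult_mono q *) auto
      then show "norm (norm (q \<xi> * fourier_laplace g \<eta> \<xi>) * norm (\<Prod>j\<leftarrow>js. freq \<eta> \<xi> j)) \<le> norm (?C * decay \<xi>)"
        by (simp add: norm_mult mult.assoc)
    qed
  qed measurable
qed

lemma fourier_laplace_rapid1: "test_fun g \<Longrightarrow> rapid (fourier_laplace g \<eta>) \<eta>"
  using fourier_laplace_rapid[of g "\<lambda>_. 1" \<eta>] by simp

text \<open>
  The inverse transform; its independence of \<open>\<eta>\<close> is what allows superpositions over
  different shifted contours to be combined.
\<close>

lemma superpose_fourier_laplace:
  fixes g :: "real^'n::finite \<Rightarrow> complex"
  assumes "test_fun g"
  shows "superpose (fourier_laplace g \<eta>) \<eta> x = inv_const TYPE('n) * g x"
proof -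
  have "integrable lborel (\<lambda>\<xi>. fourier_laplace g \<eta> \<xi> * wave \<eta> \<xi> 0)" by (rule superpose_integrable[OF fourier_laplace_rapid1[OF assms]])
  then have "integrable lborel (fourier_laplace g \<eta>)" by (simp add: wave_def Complex_eq)
  then show ?thesis unfolding superpose_def by (rule fourier_inversion[OF assms])
qed

text \<open>
  Up to sign the integral is an iterated derivative of \<open>superpose (fourier_laplace g \<eta>) \<eta>\<close>, a
  function that does not depend on \<open>\<eta>\<close>.
\<close>

lemma fourier_laplace_monomial_integral:
  fixes g :: "real^'n::finite \<Rightarrow> complex"
  assumes g: "test_fun g"
  shows "integrable lborel (\<lambda>\<xi>. (\<Prod>j\<in>UNIV. (- freq \<eta> \<xi> j) ^ \<gamma> j) * fourier_laplace g \<eta> \<xi> * wave \<eta> \<xi> x)"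
    and "(\<integral>\<xi>. (\<Prod>j\<in>UNIV. (- freq \<eta> \<xi> j) ^ \<gamma> j) * fourier_laplace g \<eta> \<xi> * wave \<eta> \<xi> x \<partial>lborel) =
      (\<integral>\<xi>. (\<Prod>j\<in>UNIV. (- freq 0 \<xi> j) ^ \<gamma> j) * fourier_laplace g 0 \<xi> * wave 0 \<xi> x \<partial>lborel)"
proof -
  obtain js where js: "\<And>j. count_list js j = \<gamma> j" using ex_list_count[of \<gamma>] by blast
  have eq: "(\<Prod>j\<in>UNIV. (- freq \<eta> \<xi> j) ^ \<gamma> j) * fourier_laplace g \<eta> \<xi> * wave \<eta> \<xi> x =
      (- 1) ^ length js * (fourier_laplace g \<eta> \<xi> * (\<Prod>j\<leftarrow>js. freq \<eta> \<xi> j) * wave \<eta> \<xi> x)" for \<eta> \<xi>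
  proof -
    have "(\<Prod>j\<leftarrow>ks. - freq \<eta> \<xi> j) = (- 1) ^ length ks * (\<Prod>j\<leftarrow>ks. freq \<eta> \<xi> j)" for ks
      by (induction ks) auto
    moreover have "(\<Prod>j\<in>UNIV. (- freq \<eta> \<xi> j) ^ \<gamma> j) = (\<Prod>j\<leftarrow>js. - freq \<eta> \<xi> j)"
      by (simp add: prod_list_count js)
    ultimately show ?thesis by (simp add: mult_ac)
  qed
  show "integrable lborel (\<lambda>\<xi>. (\<Prod>j\<in>UNIV. (- freq \<eta> \<xi> j) ^ \<gamma> j) * fourier_laplace g \<eta> \<xi> * wave \<eta> \<xi> x)"
    unfolding eq by (intro integrable_mult_right superpose_integrable rapid_mult_freq fourier_laplace_rapid1 g)
  have w: "superpose (fourier_laplace g \<eta>) \<eta> = superpose (fourier_laplace g 0) 0" for \<eta> using superpose_fourier_laplace[OF g] by (simp add: fun_eq_iff)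
  have "(\<integral>\<xi>. (\<Prod>j\<in>UNIV. (- freq \<eta> \<xi> j) ^ \<gamma> j) * fourier_laplace g \<eta> \<xi> * wave \<eta> \<xi> x \<partial>lborel) =
      (- 1) ^ length js * iter_partial js (superpose (fourier_laplace g \<eta>) \<eta>) x" for \<eta>
    unfolding eq iter_partial_superpose[OF fourier_laplace_rapid1[OF g]] unfolding superpose_def by simp
  then show "(\<integral>\<xi>. (\<Prod>j\<in>UNIV. (- freq \<eta> \<xi> j) ^ \<gamma> j) * fourier_laplace g \<eta> \<xi> * wave \<eta> \<xi> x \<partial>lborel) =
      (\<integral>\<xi>. (\<Prod>j\<in>UNIV. (- freq 0 \<xi> j) ^ \<gamma> j) * fourier_laplace g 0 \<xi> * wave 0 \<xi> x \<partial>lborel)"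
    using w[of \<eta>] by simp
qed

text \<open>
  The conjugate symbol, expanded in powers of the frequency, acts on \<open>g\<close> as a differential operator whose
  coefficients are the polynomials \<open>shift_coeff\<close> in \<open>\<eta>\<close>. A mixed difference whose order is a
  multi-index of maximal total degree in \<open>P\<close> removes all of them but the leading constant.
\<close>

lemma koenig_identity:
  fixes P :: "'n::finite cpoly"
  assumes P: "P \<noteq> 0"
  obtains A :: "'n \<Rightarrow> nat" and \<kappa> :: complex where "\<kappa> \<noteq> 0"
    "\<And>g \<eta> x. test_fun g \<Longrightarrow> (\<Sum>l\<in>indices_le A. diff_weight A l *
       (\<integral>\<xi>. cnj (symbol P (\<eta> + lattice l) \<xi>) * fourier_laplace g (\<eta> + lattice l) \<xi> * wave (\<eta> + lattice l) \<xi> x \<partial>lborel)) = \<kappa> * g x"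
proof -
  let ?K = "Poly_Mapping.keys P"
  let ?deg = "\<lambda>\<alpha>::'n \<Rightarrow>\<^sub>0 nat. \<Sum>j\<in>UNIV. Poly_Mapping.lookup \<alpha> j"
  have K: "finite ?K" "?K \<noteq> {}" using P by auto
  \<comment> \<open>Maximality of the total degree is the hypothesis of \<open>difference_shift_coeff\<close>.\<close>
  have "Max (?deg ` ?K) \<in> ?deg ` ?K" using K by (intro Max_in) auto
  then obtain \<alpha>0 where \<alpha>0: "\<alpha>0 \<in> ?K" "?deg \<alpha>0 = Max (?deg ` ?K)" by auto
  have max: "?deg \<alpha> \<le> ?deg \<alpha>0" if "\<alpha> \<in> ?K" for \<alpha>
    unfolding \<alpha>0(2) using K that by (intro Max_ge) auto
  let ?A = "Poly_Mapping.lookup \<alpha>0"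
  let ?c = "\<lambda>\<alpha>. cnj (Poly_Mapping.lookup P \<alpha>) * \<i> ^ length (multi_index_list \<alpha>)"
  let ?k = "(\<Prod>j\<in>UNIV. (- 2) ^ ?A j * fact (?A j)) :: complex"
  let ?\<kappa> = "?c \<alpha>0 * ?k * inv_const TYPE('n)"
  have "?\<kappa> \<noteq> 0" using \<alpha>0(1) inv_const_nz[where 'n='n] by (auto simp: in_keys_iff)
  moreover have "(\<Sum>l\<in>indices_le ?A. diff_weight ?A l *
       (\<integral>\<xi>. cnj (symbol P (\<eta> + lattice l) \<xi>) * fourier_laplace g (\<eta> + lattice l) \<xi> * wave (\<eta> + lattice l) \<xi> x \<partial>lborel)) = ?\<kappa> * g x"
    if g: "test_fun g" for g :: "real^'n \<Rightarrow> complex" and \<eta> x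
  proof -
    let ?J = "\<lambda>\<gamma>. (\<integral>\<xi>. (\<Prod>j\<in>UNIV. (- freq 0 \<xi> j) ^ \<gamma> j) * fourier_laplace g 0 \<xi> * wave 0 \<xi> x \<partial>lborel)"
    have J0: "?J (\<lambda>_. 0) = inv_const TYPE('n) * g x"
      using superpose_fourier_laplace[OF g, of 0 x] by (simp add: superpose_def)
    have int: "(\<integral>\<xi>. cnj (symbol P \<eta> \<xi>) * fourier_laplace g \<eta> \<xi> * wave \<eta> \<xi> x \<partial>lborel) =
      (\<Sum>\<alpha>\<in>?K. \<Sum>\<gamma>\<in>indices_le (Poly_Mapping.lookup \<alpha>). (?c \<alpha> * shift_coeff (Poly_Mapping.lookup \<alpha>) \<gamma> \<eta>) * ?J \<gamma>)" for \<eta>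
    proof -
      let ?M = "\<lambda>\<gamma> \<xi>. (\<Prod>j\<in>UNIV. (- freq \<eta> \<xi> j) ^ \<gamma> j) * fourier_laplace g \<eta> \<xi> * wave \<eta> \<xi> x"
      have "(\<integral>\<xi>. cnj (symbol P \<eta> \<xi>) * fourier_laplace g \<eta> \<xi> * wave \<eta> \<xi> x \<partial>lborel) =
        (\<integral>\<xi>. (\<Sum>\<alpha>\<in>?K. \<Sum>\<gamma>\<in>indices_le (Poly_Mapping.lookup \<alpha>). (?c \<alpha> * shift_coeff (Poly_Mapping.lookup \<alpha>) \<gamma> \<eta>) * ?M \<gamma> \<xi>) \<partial>lborel)"
        unfolding cnj_symbol sum_distrib_right by (intro Bochner_Integration.integral_cong refl sum.cong) (simp add: mult.assoc)
      also have "\<dots> = (\<Sum>\<alpha>\<in>?K. (\<integral>\<xi>. (\<Sum>\<gamma>\<in>indices_le (Poly_Mapping.lookup \<alpha>). (?c \<alpha> * shift_coeff (Poly_Mapping.lookup \<alpha>) \<gamma> \<eta>) * ?M \<gamma> \<xi>) \<partial>lborel))"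
        by (intro Bochner_Integration.integral_sum Bochner_Integration.integrable_sum integrable_mult_right fourier_laplace_monomial_integral(1) g)
      also have "\<dots> = (\<Sum>\<alpha>\<in>?K. \<Sum>\<gamma>\<in>indices_le (Poly_Mapping.lookup \<alpha>). (\<integral>\<xi>. (?c \<alpha> * shift_coeff (Poly_Mapping.lookup \<alpha>) \<gamma> \<eta>) * ?M \<gamma> \<xi> \<partial>lborel))"
        by (intro sum.cong refl Bochner_Integration.integral_sum integrable_mult_right fourier_laplace_monomial_integral(1) g)
      also have "\<dots> = (\<Sum>\<alpha>\<in>?K. \<Sum>\<gamma>\<in>indices_le (Poly_Mapping.lookup \<alpha>). (?c \<alpha> * shift_coeff (Poly_Mapping.lookup \<alpha>) \<gamma> \<eta>) * ?J \<gamma>)"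
        unfolding integral_mult_right_zero fourier_laplace_monomial_integral(2)[OF g, of \<eta>] ..
      finally show ?thesis .
    qed
    let ?s = "\<lambda>\<alpha> \<gamma> l. shift_coeff (Poly_Mapping.lookup \<alpha>) \<gamma> (\<eta> + lattice l)"
    have "(\<Sum>l\<in>indices_le ?A. diff_weight ?A l *
       (\<integral>\<xi>. cnj (symbol P (\<eta> + lattice l) \<xi>) * fourier_laplace g (\<eta> + lattice l) \<xi> * wave (\<eta> + lattice l) \<xi> x \<partial>lborel))
      = (\<Sum>l\<in>indices_le ?A. \<Sum>\<alpha>\<in>?K. \<Sum>\<gamma>\<in>indices_le (Poly_Mapping.lookup \<alpha>). ?c \<alpha> * ?J \<gamma> * (diff_weight ?A l * ?s \<alpha> \<gamma> l))"
      unfolding int sum_distrib_left by (intro sum.cong refl) (simp add: mult_ac)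
    also have "\<dots> = (\<Sum>\<alpha>\<in>?K. \<Sum>l\<in>indices_le ?A. \<Sum>\<gamma>\<in>indices_le (Poly_Mapping.lookup \<alpha>). ?c \<alpha> * ?J \<gamma> * (diff_weight ?A l * ?s \<alpha> \<gamma> l))"
      by (rule sum.swap)
    also have "\<dots> = (\<Sum>\<alpha>\<in>?K. \<Sum>\<gamma>\<in>indices_le (Poly_Mapping.lookup \<alpha>). \<Sum>l\<in>indices_le ?A. ?c \<alpha> * ?J \<gamma> * (diff_weight ?A l * ?s \<alpha> \<gamma> l))"
      by (intro sum.cong refl sum.swap)
    also have "\<dots> = (\<Sum>\<alpha>\<in>?K. \<Sum>\<gamma>\<in>indices_le (Poly_Mapping.lookup \<alpha>). ?c \<alpha> * ?J \<gamma> *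
        (if Poly_Mapping.lookup \<alpha> = ?A \<and> \<gamma> = (\<lambda>_. 0) then ?k else 0))"
      unfolding sum_distrib_left[symmetric]
      by (intro sum.cong refl arg_cong2[where f="(*)"] difference_shift_coeff max)
    also have "\<dots> = (\<Sum>\<alpha>\<in>?K. if \<alpha> = \<alpha>0 then (\<Sum>\<gamma>\<in>indices_le ?A. if \<gamma> = (\<lambda>_. 0) then ?c \<alpha>0 * ?J \<gamma> * ?k else 0) else 0)"
    proof (rule sum.cong[OF refl])
      fix \<alpha> :: "'n \<Rightarrow>\<^sub>0 nat"
      have "Poly_Mapping.lookup \<alpha> = ?A \<longleftrightarrow> \<alpha> = \<alpha>0" by (metis poly_mapping_eq_iff)
      then show "(\<Sum>\<gamma>\<in>indices_le (Poly_Mapping.lookup \<alpha>). ?c \<alpha> * ?J \<gamma> *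
          (if Poly_Mapping.lookup \<alpha> = ?A \<and> \<gamma> = (\<lambda>_. 0) then ?k else 0)) =
        (if \<alpha> = \<alpha>0 then (\<Sum>\<gamma>\<in>indices_le ?A. if \<gamma> = (\<lambda>_. 0) then ?c \<alpha>0 * ?J \<gamma> * ?k else 0) else 0)"
        by (simp add: if_distrib[where f="\<lambda>y. _ * y"] cong: if_cong)
    qed
    also have "\<dots> = (\<Sum>\<gamma>\<in>indices_le ?A. if \<gamma> = (\<lambda>_. 0) then ?c \<alpha>0 * ?J \<gamma> * ?k else 0)"
      using \<alpha>0(1) K(1) by (simp add: sum.delta)
    also have "\<dots> = ?c \<alpha>0 * ?J (\<lambda>_. 0) * ?k"
      using finite_indices_le[of ?A] by (subst sum.delta) (auto simp: indices_le_def)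
    finally show ?thesis unfolding J0 by (simp add: mult_ac)
  qed
  ultimately show ?thesis using that by blast
qed

text \<open>
  The difference grid is placed at \<open>t *\<^sub>R \<eta>\<close>. Since \<open>\<eta> \<bullet> x \<ge> b\<close> on the support of \<open>g\<close>, the
  transform is of size \<open>exp (- t b)\<close>, and the exponentials are of size \<open>exp (t (\<eta> \<bullet> x))\<close>; the
  bounded grid offsets only change the constant, which therefore serves all \<open>t\<close> and \<open>\<eta>\<close>. For
  \<open>P = 0\<close> the equation is solvable for \<open>g = 0\<close> only, whence the extra hypothesis.
\<close>

theorem exponentially_weighted_solution:
  fixes P :: "'n::finite cpoly" and R r :: real and N :: nat
  assumes R: "R \<ge> 0"
  obtains C where "C \<ge> 0"
    "\<And>g (\<eta> :: real^'n) b t G. t \<ge> 0 \<Longrightarrow> test_fun g \<Longrightarrow> (\<And>x. norm x > R \<Longrightarrow> g x = 0) \<Longrightarrow>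
       (\<And>x. g x \<noteq> 0 \<Longrightarrow> \<eta> \<bullet> x \<ge> b) \<Longrightarrow> (P = 0 \<Longrightarrow> g = (\<lambda>x. 0)) \<Longrightarrow>
       (\<And>x. jet (N + 2 * CARD('n)) g x \<le> G) \<Longrightarrow>
       \<exists>h. smooth_on UNIV h \<and> (\<forall>x. diff_op P h x = g x) \<and>
         (\<forall>x. norm x \<le> r \<longrightarrow> jet N h x \<le> C * exp (t * (\<eta> \<bullet> x - b)) * G)"
proof (cases "P = 0")
  case True
  show ?thesis
  proof (rule that[of 0])
    fix g :: "real^'n \<Rightarrow> complex"
    assume "P = 0 \<Longrightarrow> g = (\<lambda>x. 0)"
    then show "\<exists>h. smooth_on UNIV h \<and> (\<forall>x. diff_op P h x = g x) \<and>
         (\<forall>x. norm x \<le> r \<longrightarrow> jet N h x \<le> 0 * exp (t * (\<eta> \<bullet> x - b)) * G)" for \<eta> b t G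
      using True by (intro exI[of _ "\<lambda>x. 0"]) (auto simp: smooth_on_const diff_op_zero jet_zero)
  qed simp
next
  case False
  obtain A :: "'n \<Rightarrow> nat" and \<kappa> where \<kappa>: "\<kappa> \<noteq> 0"
    and koenig: "\<And>g \<eta> x. test_fun g \<Longrightarrow> (\<Sum>l\<in>indices_le A. diff_weight A l *
       (\<integral>\<xi>. cnj (symbol P (\<eta> + lattice l) \<xi>) * fourier_laplace g (\<eta> + lattice l) \<xi> * wave (\<eta> + lattice l) \<xi> x \<partial>lborel)) = \<kappa> * g x"
    by (rule koenig_identity[OF False], rule that, assumption, assumption)
  define D where "D = Max ((\<lambda>l. norm (lattice l :: real^'n)) ` indices_le A)"
  have D: "norm (lattice l :: real^'n) \<le> D" if "l \<in> indices_le A" for l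
    unfolding D_def using finite_indices_le that by (intro Max_ge) auto
  let ?v = "measure lborel (cball (0::real^'n) R)"
  define E where "E = 2 ^ CARD('n) * (?v * exp (D * R)) * exp (D * \<bar>r\<bar>) * (\<integral>\<xi>. decay (\<xi>::real^'n) \<partial>lborel)"
  define C where "C = num_words TYPE('n) N * (norm (1 / \<kappa>) * ((\<Sum>l\<in>indices_le A. norm (diff_weight A l)) * E))"
  have dec0: "(\<integral>\<xi>. decay (\<xi>::real^'n) \<partial>lborel) \<ge> 0"
    by (rule Bochner_Integration.integral_nonneg) (simp add: decay_pos less_imp_le)
  have E0: "E \<ge> 0" unfolding E_def using dec0 by simp
  have C0: "C \<ge> 0" unfolding C_def using num_words_ge1[where 'n='n and m=N] E0
    by (intro mult_nonneg_nonneg sum_nonneg) auto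
  show ?thesis
  proof (rule that[OF C0])
    fix g :: "real^'n \<Rightarrow> complex" and \<eta> :: "real^'n" and b t G :: real
    assume t: "t \<ge> 0" and g: "test_fun g" and gR: "\<And>x. norm x > R \<Longrightarrow> g x = 0"
      and gb: "\<And>x. g x \<noteq> 0 \<Longrightarrow> \<eta> \<bullet> x \<ge> b" and G: "\<And>x. jet (N + 2 * CARD('n)) g x \<le> G"
    have G0: "G \<ge> 0" using G[of 0] jet_nonneg order_trans by blast
    let ?e = "\<lambda>l. t *\<^sub>R \<eta> + lattice l :: real^'n"
    \<comment> \<open>At a zero of the symbol the quotient is 0 by convention. This is harmless: the conjugate
        vanishes there too, so multiplying by the symbol still gives the conjugate.\<close>
    let ?q = "\<lambda>l \<xi>. cnj (symbol P (?e l) \<xi>) / symbol P (?e l) \<xi>"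
    let ?m = "\<lambda>l \<xi>. ?q l \<xi> * fourier_laplace g (?e l) \<xi>"
    let ?h = "\<lambda>l. superpose (?m l) (?e l)"
    let ?H = "\<lambda>x. (1 / \<kappa>) * (\<Sum>l\<in>indices_le A. diff_weight A l * ?h l x)"
    have "cnj \<in> borel_measurable borel" by (intro borel_measurable_continuous_onI continuous_intros)
    then have qm: "?q l \<in> borel_measurable borel" for l
      by (intro borel_measurable_divide measurable_compose[OF measurable_symbol] measurable_symbol)
    have q1: "norm (?q l \<xi>) \<le> 1" for l \<xi> by (simp add: norm_divide)
    have mr: "rapid (?m l) (?e l)" for l by (rule fourier_laplace_rapid[OF g qm q1])
    have hs: "smooth_on UNIV (\<lambda>x. diff_weight A l * ?h l x)" for l
      by (intro smooth_on_cmult smooth_on_superpose mr open_UNIV)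
    have sums: "smooth_on UNIV (\<lambda>x. \<Sum>l\<in>indices_le A. diff_weight A l * ?h l x)"
      by (rule smooth_on_sum[OF open_UNIV hs])
    have H: "smooth_on UNIV ?H" by (rule smooth_on_cmult[OF open_UNIV sums])
    have PH: "diff_op P ?H x = g x" for x
    proof -
      have "diff_op P ?H x = (1 / \<kappa>) * (\<Sum>l\<in>indices_le A. diff_weight A l * diff_op P (?h l) x)"
        unfolding diff_op_cmult[OF open_UNIV sums UNIV_I] diff_op_sum[OF open_UNIV finite_indices_le hs UNIV_I]
            diff_op_cmult[OF open_UNIV smooth_on_superpose[OF mr] UNIV_I] ..
      also have "\<dots> = (1 / \<kappa>) * (\<Sum>l\<in>indices_le A. diff_weight A l *
         (\<integral>\<xi>. cnj (symbol P (?e l) \<xi>) * fourier_laplace g (?e l) \<xi> * wave (?e l) \<xi> x \<partial>lborel))"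
      proof -
        have "symbol P (?e l) \<xi> * ?m l \<xi> * wave (?e l) \<xi> x = cnj (symbol P (?e l) \<xi>) * fourier_laplace g (?e l) \<xi> * wave (?e l) \<xi> x" for l \<xi>
          by (cases "symbol P (?e l) \<xi> = 0") auto
        then show ?thesis unfolding diff_op_superpose[OF mr] by (simp only:)
      qed
      also have "\<dots> = g x" unfolding koenig[OF g] using \<kappa> by simp
      finally show ?thesis .
    qed
    have bound: "jet N ?H x \<le> C * exp (t * (\<eta> \<bullet> x - b)) * G" if x: "norm x \<le> r" for x
    proof -
      let ?B = "exp (D * R) * exp (- t * b) * G"
      let ?X = "exp (t * (\<eta> \<bullet> x - b)) * G"
      have hb: "norm (iter_partial js (?h l) x) \<le> E * ?X" if js: "length js \<le> N" and l: "l \<in> indices_le A" for js l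
      proof -
        have dec: "norm (fourier_laplace g (?e l) \<xi>) * norm (\<Prod>j\<leftarrow>js. freq (?e l) \<xi> j) \<le> 2 ^ CARD('n) * (?v * ?B) * decay \<xi>" for \<xi>
        proof (rule fourier_laplace_uniform_decay[OF g R gR, where m = N])
          fix ks :: "'n list" and y :: "real^'n" assume ks: "length ks \<le> N + 2 * CARD('n)" and y: "norm y \<le> R"
          show "norm (iter_partial ks g y) * exp (- (?e l \<bullet> y)) \<le> ?B"
          proof (cases "\<eta> \<bullet> y \<ge> b")
            case True
            have "- (lattice l \<bullet> y) \<le> norm (lattice l :: real^'n) * norm y"
              using norm_cauchy_schwarz[of "- lattice l" y] by simp
            also have "\<dots> \<le> D * R" using D[OF l] y by (intro mult_mono) (auto intro: order_trans[OF norm_ge_zero])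
            finally have "- (?e l \<bullet> y) \<le> D * R + (- t * b)"
              using mult_left_mono[OF True t] by (simp add: inner_add_left)
            then have "exp (- (?e l \<bullet> y)) \<le> exp (D * R) * exp (- t * b)" by (simp add: exp_add[symmetric])
            moreover have "norm (iter_partial ks g y) \<le> G" using jet_ge[OF ks, of g y] G[of y] by simp
            ultimately have "norm (iter_partial ks g y) * exp (- (?e l \<bullet> y)) \<le> G * (exp (D * R) * exp (- t * b))"
              using G0 by (intro mult_mono) auto
            then show ?thesis by (simp add: mult_ac)
          next
            case False
            have "iter_partial ks g y = 0"
              by (rule iter_partial_zero_outside[where S = "{x. \<eta> \<bullet> x \<ge> b}"])
                 (use gb False closed_halfspace_ge[of b \<eta>] in auto)
            then show ?thesis using G0 by simp
          qed
        qed (use js in auto)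
        have dm: "norm (?m l \<xi> * (\<Prod>j\<leftarrow>js. freq (?e l) \<xi> j) * wave (?e l) \<xi> x) \<le>
            (2 ^ CARD('n) * (?v * ?B) * exp (?e l \<bullet> x)) * decay \<xi>" for \<xi>
        proof -
          have "norm (?q l \<xi>) * (norm (fourier_laplace g (?e l) \<xi>) * norm (\<Prod>j\<leftarrow>js. freq (?e l) \<xi> j)) \<le>
              1 * (2 ^ CARD('n) * (?v * ?B) * decay \<xi>)"
            by (intro mult_mono dec q1) auto
          then have "norm (?q l \<xi>) * (norm (fourier_laplace g (?e l) \<xi>) * norm (\<Prod>j\<leftarrow>js. freq (?e l) \<xi> j)) * exp (?e l \<bullet> x) \<le>
              1 * (2 ^ CARD('n) * (?v * ?B) * decay \<xi>) * exp (?e l \<bullet> x)"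
            by (rule mult_right_mono) simp
          then show ?thesis unfolding norm_mult norm_wave mult_1_left by (simp only: mult_ac)
        qed
        have "norm (iter_partial js (?h l) x) \<le> (\<integral>\<xi>. (2 ^ CARD('n) * (?v * ?B) * exp (?e l \<bullet> x)) * decay (\<xi>::real^'n) \<partial>lborel)"
          unfolding iter_partial_superpose[OF mr] unfolding superpose_def
          by (rule Bochner_Integration.integral_norm_bound_integral[OF superpose_integrable[OF rapid_mult_freq[OF mr]]])
             (use dm in \<open>auto intro!: integrable_mult_right integrable_decay\<close>)
        also have "\<dots> = (2 ^ CARD('n) * (?v * ?B) * (\<integral>\<xi>. decay (\<xi>::real^'n) \<partial>lborel)) * exp (?e l \<bullet> x)" by simp
        also have "\<dots> \<le> (2 ^ CARD('n) * (?v * ?B) * (\<integral>\<xi>. decay (\<xi>::real^'n) \<partial>lborel)) * (exp (t * (\<eta> \<bullet> x)) * exp (D * \<bar>r\<bar>))"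
        proof (rule mult_left_mono)
          have "lattice l \<bullet> x \<le> norm (lattice l :: real^'n) * norm x" by (rule norm_cauchy_schwarz)
          also have "\<dots> \<le> D * \<bar>r\<bar>" using D[OF l] x by (intro mult_mono) (auto intro: order_trans[OF norm_ge_zero])
          finally show "exp (?e l \<bullet> x) \<le> exp (t * (\<eta> \<bullet> x)) * exp (D * \<bar>r\<bar>)"
            by (simp add: inner_add_left exp_add[symmetric])
          show "0 \<le> 2 ^ CARD('n) * (?v * ?B) * (\<integral>\<xi>. decay (\<xi>::real^'n) \<partial>lborel)"
            using G0 dec0 by (intro mult_nonneg_nonneg) auto
        qed
        also have "\<dots> = E * ?X"
          unfolding E_def by (simp add: right_diff_distrib exp_diff exp_minus field_simps)
        finally show ?thesis .
      qed
      have "norm (iter_partial js ?H x) \<le> norm (1 / \<kappa>) * ((\<Sum>l\<in>indices_le A. norm (diff_weight A l)) * (E * ?X))" if js: "length js \<le> N" for js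
      proof -
        have eq: "iter_partial js ?H x = (1 / \<kappa>) * (\<Sum>l\<in>indices_le A. diff_weight A l * iter_partial js (?h l) x)"
          unfolding iter_partial_cmult[OF open_UNIV sums UNIV_I] iter_partial_sum[OF open_UNIV finite_indices_le hs UNIV_I]
            iter_partial_cmult[OF open_UNIV smooth_on_superpose[OF mr] UNIV_I] ..
        have "norm (iter_partial js ?H x) \<le> norm (1 / \<kappa>) * (\<Sum>l\<in>indices_le A. norm (diff_weight A l) * (E * ?X))"
          unfolding eq norm_mult[of "1 / \<kappa>"]
        proof (intro mult_left_mono order_trans[OF norm_sum] sum_mono)
          fix l assume l: "l \<in> indices_le A"
          show "norm (diff_weight A l * iter_partial js (?h l) x) \<le> norm (diff_weight A l) * (E * ?X)"
            unfolding norm_mult by (rule mult_left_mono[OF hb[OF js l]]) simp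
        qed simp
        then show ?thesis by (simp add: sum_distrib_right)
      qed
      from jet_le[OF this] show ?thesis unfolding C_def by (simp add: mult_ac)
    qed
    show "\<exists>h. smooth_on UNIV h \<and> (\<forall>x. diff_op P h x = g x) \<and>
         (\<forall>x. norm x \<le> r \<longrightarrow> jet N h x \<le> C * exp (t * (\<eta> \<bullet> x - b)) * G)"
      using H PH bound by blast
  qed
qed

section \<open>Smooth cut-off functions\<close>

text \<open>
  The class \<open>p (1/t) exp (- 1/t)\<close>, extended by zero, is stable under differentiation; \<open>p = 1\<close> is the
  standard smooth function that is flat at 0.
\<close>

definition flat_exp :: "real poly \<Rightarrow> real \<Rightarrow> real" where
  "flat_exp p t = (if t > 0 then poly p (1 / t) * exp (- (1 / t)) else 0)"

lemma poly_times_exp_tendsto_0: "((\<lambda>x::real. poly p x * exp (- x)) \<longlongrightarrow> 0) at_top"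
proof -
  have "((\<lambda>x::real. \<Sum>i\<le>degree p. coeff p i * (x ^ i / exp x)) \<longlongrightarrow> (\<Sum>i\<le>degree p. coeff p i * 0)) at_top"
    by (intro tendsto_sum tendsto_mult tendsto_const tendsto_power_div_exp_0)
  moreover have "poly p x * exp (- x) = (\<Sum>i\<le>degree p. coeff p i * (x ^ i / exp x))" for x
    by (simp add: poly_altdef sum_distrib_right exp_minus divide_inverse mult.assoc)
  ultimately show ?thesis by simp
qed

lemma flat_DERIV: "(flat_exp p has_real_derivative flat_exp ([:0, 0, 1:] * (p - pderiv p)) t) (at t)"
proof -
  consider "t > 0" | "t < 0" | "t = 0" by linarith
  then show ?thesis
  proof cases
    case 1
    have "((\<lambda>t. poly p (1 / t) * exp (- (1 / t))) has_real_derivative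
        flat_exp ([:0, 0, 1:] * (p - pderiv p)) t) (at t)"
      using 1 by (auto intro!: derivative_eq_intros simp: flat_exp_def field_simps power2_eq_square)
    moreover have "\<forall>\<^sub>F s in nhds t. flat_exp p s = poly p (1 / s) * exp (- (1 / s))"
      using eventually_nhds_in_open[of "{0<..}" t] 1 by (auto elim!: eventually_mono simp: flat_exp_def)
    ultimately show ?thesis by (subst DERIV_cong_ev[OF refl _ refl])
  next
    case 2
    have "((\<lambda>t. 0) has_real_derivative flat_exp ([:0, 0, 1:] * (p - pderiv p)) t) (at t)"
      using 2 by (simp add: flat_exp_def)
    moreover have "\<forall>\<^sub>F s in nhds t. flat_exp p s = 0"
      using eventually_nhds_in_open[of "{..<0}" t] 2 by (auto elim!: eventually_mono simp: flat_exp_def)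
    ultimately show ?thesis by (subst DERIV_cong_ev[OF refl _ refl])
  next
    case 3
    have "((\<lambda>h. flat_exp p h / h) \<longlongrightarrow> 0) (at_right 0)"
    proof -
      have "((\<lambda>h. poly (pCons 0 p) (inverse h) * exp (- inverse h)) \<longlongrightarrow> 0) (at_right (0::real))"
        by (rule filterlim_compose[OF poly_times_exp_tendsto_0 filterlim_inverse_at_top_right])
      moreover have "\<forall>\<^sub>F h in at_right (0::real). poly (pCons 0 p) (inverse h) * exp (- inverse h) = flat_exp p h / h"
        unfolding eventually_at_filter by (auto simp: flat_exp_def field_simps)
      ultimately show ?thesis by (rule Lim_transform_eventually)
    qed
    moreover have "((\<lambda>h. flat_exp p h / h) \<longlongrightarrow> 0) (at_left 0)"
    proof -
      have "\<forall>\<^sub>F h in at_left (0::real). 0 = flat_exp p h / h"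
        unfolding eventually_at_filter by (auto simp: flat_exp_def)
      then show ?thesis by (rule Lim_transform_eventually[OF tendsto_const])
    qed
    ultimately have "((\<lambda>h. flat_exp p h / h) \<longlongrightarrow> 0) (at 0)" by (simp add: filterlim_split_at)
    then show ?thesis using 3 by (simp add: DERIV_def flat_exp_def)
  qed
qed

lemma flat_one: "flat_exp 1 t > 0 \<longleftrightarrow> t > 0" "flat_exp 1 t \<ge> 0" "t \<le> 0 \<Longrightarrow> flat_exp p t = 0"
  by (auto simp: flat_exp_def)

lemma continuous_flat: "continuous_on UNIV (flat_exp p)"
  by (rule continuous_at_imp_continuous_on, rule ballI, rule DERIV_isCont[OF flat_DERIV])

lemma smooth_on_flat_affine:
  fixes \<eta> :: "real^'n::finite"
  shows "smooth_on UNIV (\<lambda>x. complex_of_real (flat_exp p (\<eta> \<bullet> x + b)))"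
proof (rule smooth_on_coinduct[where S = "{f. \<exists>c p. f = (\<lambda>x. c * complex_of_real (flat_exp p (\<eta> \<bullet> x + b)))}"])
  show "(\<lambda>x. complex_of_real (flat_exp p (\<eta> \<bullet> x + b))) \<in> {f. \<exists>c p. f = (\<lambda>x. c * complex_of_real (flat_exp p (\<eta> \<bullet> x + b)))}"
    by (auto intro!: exI[of _ 1] exI[of _ p])
next
  fix f assume "f \<in> {f. \<exists>c p. f = (\<lambda>x. c * complex_of_real (flat_exp p (\<eta> \<bullet> x + b)))}"
  then obtain c p where f: "f = (\<lambda>x. c * complex_of_real (flat_exp p (\<eta> \<bullet> x + b)))" by blast
  show "continuous_on UNIV f" unfolding f
    by (intro continuous_intros continuous_on_compose2[OF continuous_flat]) auto
  fix i
  let ?q = "[:0, 0, 1:] * (p - pderiv p)"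
  have "has_partial i f (c * of_real (\<eta> $ i) * of_real (flat_exp ?q (\<eta> \<bullet> x + b))) x" for x
  proof -
    have "((\<lambda>t. flat_exp p (\<eta> \<bullet> (x + t *\<^sub>R axis i 1) + b)) has_real_derivative flat_exp ?q (\<eta> \<bullet> x + b) * \<eta> $ i) (at 0)"
    proof (rule DERIV_chain2[where f = "flat_exp p"])
      show "(flat_exp p has_real_derivative flat_exp ?q (\<eta> \<bullet> x + b)) (at (\<eta> \<bullet> (x + 0 *\<^sub>R axis i 1) + b))"
        using flat_DERIV[of p] by simp
      show "((\<lambda>t. \<eta> \<bullet> (x + t *\<^sub>R axis i 1) + b) has_real_derivative \<eta> $ i) (at 0)"
        by (auto intro!: derivative_eq_intros simp: inner_add_right inner_axis)
    qed
    then have "((\<lambda>t. c * complex_of_real (flat_exp p (\<eta> \<bullet> (x + t *\<^sub>R axis i 1) + b))) has_vector_derivative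
        c * complex_of_real (flat_exp ?q (\<eta> \<bullet> x + b) * \<eta> $ i)) (at 0)"
      by (intro has_vector_derivative_mult_right has_vector_derivative_of_real)
         (simp add: has_real_derivative_iff_has_vector_derivative)
    then show ?thesis unfolding has_partial_def f by (simp add: mult_ac)
  qed
  then show "\<exists>f'\<in>{f. \<exists>c p. f = (\<lambda>x. c * complex_of_real (flat_exp p (\<eta> \<bullet> x + b)))}. \<forall>x\<in>UNIV. has_partial i f (f' x) x"
    by (intro bexI[of _ "\<lambda>x. c * of_real (\<eta> $ i) * of_real (flat_exp ?q (\<eta> \<bullet> x + b))"]) auto
qed simp

text \<open>
  The denominator is positive, because the two arguments of \<open>flat_exp\<close> add up to 1. The value is 1
  where \<open>\<eta> \<bullet> x + b \<le> 0\<close> and 0 where \<open>\<eta> \<bullet> x + b \<ge> 1\<close>.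
\<close>

definition step :: "real^'n::finite \<Rightarrow> real \<Rightarrow> real^'n \<Rightarrow> complex" where
  "step \<eta> b x = of_real (flat_exp 1 (1 - (\<eta> \<bullet> x + b))) *
     inverse (of_real (flat_exp 1 (1 - (\<eta> \<bullet> x + b))) + of_real (flat_exp 1 (\<eta> \<bullet> x + b)))"

lemma smooth_on_step: "smooth_on UNIV (step \<eta> b)"
proof -
  have eq: "1 - (\<eta> \<bullet> x + b) = (- \<eta>) \<bullet> x + (1 - b)" for x by simp
  have "complex_of_real (flat_exp 1 (1 - (\<eta> \<bullet> x + b))) + of_real (flat_exp 1 (\<eta> \<bullet> x + b)) \<noteq> 0" for x
  proof -
    have "flat_exp 1 (1 - (\<eta> \<bullet> x + b)) + flat_exp 1 (\<eta> \<bullet> x + b) > 0"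
      using flat_one(1,2)[of "1 - (\<eta> \<bullet> x + b)"] flat_one(1,2)[of "\<eta> \<bullet> x + b"]
      by (cases "\<eta> \<bullet> x + b > 0") (auto intro: add_pos_nonneg add_nonneg_pos)
    then show ?thesis by (metis of_real_add of_real_eq_0_iff less_irrefl)
  qed
  then show ?thesis unfolding step_def eq
    by (intro smooth_on_mult smooth_on_inverse smooth_on_add smooth_on_flat_affine open_UNIV) auto
qed

lemma step_eq_1: "\<eta> \<bullet> x + b \<le> 0 \<Longrightarrow> step \<eta> b x = 1"
  using flat_one(1)[of "1 - (\<eta> \<bullet> x + b)"] flat_one(3)[of "\<eta> \<bullet> x + b" 1] by (simp add: step_def)

lemma step_eq_0: "\<eta> \<bullet> x + b \<ge> 1 \<Longrightarrow> step \<eta> b x = 0"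
  using flat_one(3)[of "1 - (\<eta> \<bullet> x + b)" 1] by (simp add: step_def)

lemma ex_bump:
  obtains \<rho> :: "real^'n::finite \<Rightarrow> complex"
  where "test_fun \<rho>" "\<And>x. norm x > 1 \<Longrightarrow> \<rho> x = 0" "(\<integral>x. \<rho> x \<partial>lborel) = 1"
proof -
  \<comment> \<open>A cube of this half-width lies in the unit ball, by comparison with the \<open>l\<^sup>1\<close> norm.\<close>
  define s where "s = 1 / real CARD('n)"
  define r :: "real^'n \<Rightarrow> real" where "r x = (\<Prod>i\<in>UNIV. flat_exp 1 (axis i 1 \<bullet> x + s) * flat_exp 1 (- axis i 1 \<bullet> x + s))" for x
  have s: "s > 0" by (simp add: s_def)
  have r0: "r x \<ge> 0" for x unfolding r_def by (intro prod_nonneg) (simp add: flat_one)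
  have r00: "r 0 > 0" unfolding r_def using s by (intro prod_pos) (simp add: flat_one)
  have rz: "r x = 0" if "norm x > 1" for x
  proof -
    have "\<exists>i. \<bar>x $ i\<bar> > s"
    proof (rule ccontr)
      assume "\<nexists>i. \<bar>x $ i\<bar> > s"
      then have "(\<Sum>i\<in>UNIV. \<bar>x $ i\<bar>) \<le> (\<Sum>i\<in>(UNIV::'n set). s)" by (intro sum_mono) (simp add: not_less)
      then have "norm x \<le> 1" using norm_le_l1_cart[of x] by (simp add: s_def)
      then show False using that by simp
    qed
    then obtain i where "\<bar>x $ i\<bar> > s" by blast
    then have "flat_exp 1 (axis i 1 \<bullet> x + s) * flat_exp 1 (- axis i 1 \<bullet> x + s) = 0"
      by (cases "x $ i > 0") (auto simp: inner_axis' flat_one(3))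
    then show ?thesis unfolding r_def by (intro prod_zero) auto
  qed
  have sm: "smooth_on UNIV (\<lambda>x. complex_of_real (r x))"
    unfolding r_def of_real_prod of_real_mult
    by (intro smooth_on_prod smooth_on_mult smooth_on_flat_affine open_UNIV)
  have tr: "test_fun (\<lambda>x. complex_of_real (r x))" unfolding test_fun_def using sm rz by auto
  have ir: "integrable lborel r"
    using integrable_compact_support[OF test_fun_continuous[OF tr], of 1] rz
    by (simp add: complex_of_real_integrable_eq)
  have "continuous_on UNIV r"
    unfolding r_def by (intro continuous_intros continuous_on_compose2[OF continuous_flat]) auto
  then have "isCont r 0" by (simp add: continuous_on_eq_continuous_at)
  then obtain d where d: "d > 0" "\<And>x. dist x 0 < d \<Longrightarrow> dist (r x) (r 0) < r 0 / 2"
    unfolding continuous_at_eps_delta using r00 half_gt_zero by metis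
  have "(\<integral>x. r 0 / 2 * indicator (cball (0::real^'n) (d / 2)) x \<partial>lborel) \<le> (\<integral>x. r x \<partial>lborel)"
  proof (rule Bochner_Integration.integral_mono[OF _ ir])
    show "integrable lborel (\<lambda>x::real^'n. r 0 / 2 * indicator (cball 0 (d / 2)) x)"
      using emeasure_lborel_cball_finite[of "0::real^'n" "d / 2"]
      by (intro integrable_mult_right integrable_real_indicator) simp_all
    show "r 0 / 2 * indicator (cball (0::real^'n) (d / 2)) x \<le> r x" for x
    proof (cases "x \<in> cball 0 (d / 2)")
      case True
      then have "dist (r x) (r 0) < r 0 / 2" using d by (intro d(2)) (auto simp: dist_commute)
      then have "r 0 / 2 \<le> r x" unfolding dist_real_def by linarith
      then show ?thesis using True by simp
    qed (use r0 in auto)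
  qed
  moreover have "measure lborel (cball (0::real^'n) (d / 2)) > 0"
    using d(1) by (intro content_cball_pos) auto
  then have "r 0 / 2 * measure lborel (cball (0::real^'n) (d / 2)) > 0"
    using r00 by (intro mult_pos_pos) auto
  ultimately have pos: "(\<integral>x. r x \<partial>lborel) > 0" by simp
  let ?I = "complex_of_real (\<integral>x. r x \<partial>lborel)"
  show ?thesis
  proof (rule that)
    show "test_fun (\<lambda>x. inverse ?I * complex_of_real (r x))"
      unfolding test_fun_def using smooth_on_cmult[OF open_UNIV sm] rz by auto
    show "\<And>x. norm x > 1 \<Longrightarrow> inverse ?I * complex_of_real (r x) = 0" using rz by simp
    show "(\<integral>x. inverse ?I * complex_of_real (r x) \<partial>lborel) = 1"
      using pos by (simp add: integral_complex_of_real)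
  qed
qed

section \<open>Polytopes around compact sets\<close>

text \<open>
  Take a slightly enlarged convex hull of \<open>K\<close> inside \<open>X\<close>. Each point of its boundary is separated from
  the hull by a hyperplane, and compactness leaves finitely many of them. The resulting polytope is convex,
  contains the hull and avoids the boundary, so by connectedness it stays inside. The affine functions are
  scaled so that the gap is the interval from 0 to 1.
\<close>

lemma polytope_neighbourhood:
  fixes K X :: "(real^'n::finite) set"
  assumes X: "open X" "convex X" and K: "compact K" "K \<subseteq> X"
  obtains N :: nat and \<eta> :: "nat \<Rightarrow> real^'n" and b :: "nat \<Rightarrow> real"
  where "\<And>k x. k < N \<Longrightarrow> x \<in> K \<Longrightarrow> \<eta> k \<bullet> x + b k \<le> 0"
    "compact {x. \<forall>k<N. \<eta> k \<bullet> x + b k \<le> 1}" "{x. \<forall>k<N. \<eta> k \<bullet> x + b k \<le> 1} \<subseteq> X"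
proof (cases "X = {}")
  case True
  \<comment> \<open>The constant function 2 describes the empty polytope.\<close>
  show ?thesis by (rule that[of 1 "\<lambda>_. 0" "\<lambda>_. 2"]) (use True K in auto)
next
  case False
  then obtain p where p: "p \<in> X" by blast
  \<comment> \<open>The additional point keeps the hull non-empty when \<open>K\<close> is empty.\<close>
  define C where "C = convex hull (insert p K)"
  have C: "compact C" "convex C" "C \<noteq> {}" "insert p K \<subseteq> C" "C \<subseteq> X"
  proof -
    show "compact C" unfolding C_def using K(1) by (intro compact_convex_hull compact_insert)
    show "convex C" unfolding C_def by (rule convex_convex_hull)
    show "insert p K \<subseteq> C" unfolding C_def by (rule hull_subset)
    then show "C \<noteq> {}" by blast
    show "C \<subseteq> X" unfolding C_def using K(2) p X(2) by (intro hull_minimal) auto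
  qed
  obtain r where r: "r > 0" "(\<Union>x\<in>C. cball x r) \<subseteq> X"
    using compact_subset_open_imp_cball_epsilon_subset[OF C(1) X(1) C(5)] by blast
  let ?S = "{x. infdist x C = r}"
  have near: "\<exists>c\<in>C. dist x c \<le> r" if "infdist x C \<le> r" for x
    using infdist_attains_inf[OF compact_imp_closed[OF C(1)] C(3), of x] that by metis
  obtain R where R: "\<And>c. c \<in> C \<Longrightarrow> norm c \<le> R" using compact_imp_bounded[OF C(1)] bounded_iff by metis
  have bdd: "bounded {x. infdist x C \<le> r}"
    unfolding bounded_iff
  proof (intro exI[of _ "R + r"] ballI)
    fix x assume "x \<in> {x. infdist x C \<le> r}"
    then obtain c where "c \<in> C" "dist x c \<le> r" using near by blast
    then show "norm x \<le> R + r" using R[of c] norm_triangle_ineq2[of x c] by (simp add: dist_norm)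
  qed
  have "closed ?S" by (rule closed_Collect_eq) (intro continuous_intros)+
  moreover have "bounded ?S" by (rule bounded_subset[OF bdd]) auto
  ultimately have S: "compact ?S" by (simp add: compact_eq_bounded_closed)
  have "\<exists>\<eta> b. (\<forall>x\<in>C. \<eta> \<bullet> x + b \<le> 0) \<and> \<eta> \<bullet> y + b > 1" if y: "y \<in> ?S" for y
  proof -
    have "y \<notin> C" using y r(1) infdist_zero by auto
    then obtain a c where ac: "a \<bullet> y < c" "\<forall>x\<in>C. a \<bullet> x > c"
      using separating_hyperplane_closed_point[OF C(2) compact_imp_closed[OF C(1)]] by blast
    \<comment> \<open>The scaling gives the value 2 at \<open>y\<close>, hence values above 1 nearby.\<close>
    define m where "m = 2 / (c - a \<bullet> y)"
    have "c - a \<bullet> y > 0" using ac by simp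
    moreover have "2 / e * e = 2" if "e > 0" for e :: real using that by simp
    ultimately have m: "m > 0" "m * (c - a \<bullet> y) = 2" unfolding m_def by (simp, blast)
    have A: "(- m *\<^sub>R a) \<bullet> x + m * c = m * (c - a \<bullet> x)" for x by (simp add: algebra_simps)
    show ?thesis
    proof (intro exI[of _ "- m *\<^sub>R a"] exI[of _ "m * c"] conjI ballI)
      fix x assume "x \<in> C"
      then show "(- m *\<^sub>R a) \<bullet> x + m * c \<le> 0"
        unfolding A using ac m by (intro mult_nonneg_nonpos) (auto simp: less_imp_le)
    qed (unfold A, use m in simp)
  qed
  then obtain \<eta>0 b0 where sep: "\<And>x y. y \<in> ?S \<Longrightarrow> x \<in> C \<Longrightarrow> \<eta>0 y \<bullet> x + b0 y \<le> 0"
    "\<And>y. y \<in> ?S \<Longrightarrow> \<eta>0 y \<bullet> y + b0 y > 1" by metis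
  obtain Y where Y: "Y \<subseteq> ?S" "finite Y" "?S \<subseteq> (\<Union>y\<in>Y. {x. \<eta>0 y \<bullet> x + b0 y > 1})"
  proof (rule compactE_image[OF S])
    show "open {x. \<eta>0 y \<bullet> x + b0 y > 1}" if "y \<in> ?S" for y
      by (intro open_Collect_less continuous_intros)
    show "?S \<subseteq> (\<Union>y\<in>?S. {x. \<eta>0 y \<bullet> x + b0 y > 1})" using sep(2) by blast
  qed blast
  obtain ys where ys: "set ys = Y" using finite_list[OF Y(2)] by blast
  let ?\<eta> = "\<lambda>k. \<eta>0 (ys ! k)" and ?b = "\<lambda>k. b0 (ys ! k)"
  let ?L = "{x. \<forall>k<length ys. ?\<eta> k \<bullet> x + ?b k \<le> 1}"
  have L: "?L = (\<Inter>y\<in>Y. {x. \<eta>0 y \<bullet> x + b0 y \<le> 1})"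
    unfolding ys[symmetric] by (rule set_eqI) (simp add: all_set_conv_all_nth)
  have Lc: "closed ?L" unfolding L by (intro closed_INT ballI closed_Collect_le continuous_intros)
  have half: "{x. \<eta>0 y \<bullet> x + b0 y \<le> 1} = {x. \<eta>0 y \<bullet> x \<le> 1 - b0 y}" for y by auto
  have Lconv: "convex ?L" unfolding L half by (intro convex_INT convex_halfspace_le)
  have CL: "C \<subseteq> ?L" unfolding L
  proof (intro subsetI INT_I CollectI)
    fix x y assume "x \<in> C" "y \<in> Y"
    then show "\<eta>0 y \<bullet> x + b0 y \<le> 1" using sep(1)[of y x] Y(1) by auto
  qed
  have LS: "?L \<inter> ?S = {}"
  proof -
    have False if xL: "x \<in> ?L" and xS: "x \<in> ?S" for x
    proof -
      obtain y where "y \<in> Y" "\<eta>0 y \<bullet> x + b0 y > 1" using subsetD[OF Y(3) xS] by blast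
      then show False using xL unfolding L by force
    qed
    then show ?thesis by blast
  qed
  have Lr: "infdist z C < r" if z: "z \<in> ?L" for z
  proof (rule ccontr)
    assume "\<not> infdist z C < r"
    obtain c where c: "c \<in> C" using C(3) by blast
    have "connected ((\<lambda>x. infdist x C) ` ?L)"
      by (intro connected_continuous_image continuous_intros convex_connected[OF Lconv])
    moreover have "infdist c C \<in> (\<lambda>x. infdist x C) ` ?L" "infdist z C \<in> (\<lambda>x. infdist x C) ` ?L"
      using c CL z by blast+
    moreover have "infdist c C \<le> r" "r \<le> infdist z C" using c r(1) \<open>\<not> infdist z C < r\<close> by auto
    ultimately have "r \<in> (\<lambda>x. infdist x C) ` ?L" by (rule connectedD_interval)
    then show False using LS by auto
  qed
  show ?thesis
  proof (rule that[of "length ys" ?\<eta> ?b])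
    show "?\<eta> k \<bullet> x + ?b k \<le> 0" if "k < length ys" "x \<in> K" for k x
      using sep(1)[of "ys ! k" x] that C(4) ys Y(1) nth_mem by blast
    have "bounded ?L" by (rule bounded_subset[OF bdd]) (use Lr less_imp_le in blast)
    then show "compact ?L" using Lc by (simp only: compact_eq_bounded_closed)
    show "?L \<subseteq> X"
    proof
      fix z assume "z \<in> ?L"
      then obtain c where c: "c \<in> C" "dist z c \<le> r" using near Lr less_imp_le by blast
      then have "z \<in> cball c r" by (simp add: dist_commute)
      then show "z \<in> X" using r(2) c(1) by blast
    qed
  qed
qed

section \<open>Mollification\<close>

text \<open>
  Convolution with \<open>\<rho>\<close> on the scale \<open>\<delta>\<close>, written so that \<open>\<delta>\<close> enters the argument of \<open>F\<close> and
  the kernel \<open>\<rho>\<close> stays fixed.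
\<close>

definition mollify :: "(real^'n \<Rightarrow> complex) \<Rightarrow> (real^'n \<Rightarrow> complex) \<Rightarrow> real \<Rightarrow> real^'n::finite \<Rightarrow> complex" where
  "mollify F \<rho> \<delta> x = (\<integral>y. F (x + (- \<delta>) *\<^sub>R y) * \<rho> y \<partial>lborel)"

lemma test_fun_bounded:
  assumes "test_fun F"
  obtains B where "B > 0" "\<And>x. norm (F x) \<le> B"
proof -
  obtain R where R: "\<And>x. norm x > R \<Longrightarrow> F x = 0" using assms by (auto simp: test_fun_def)
  show ?thesis using bounded_compact_support[OF test_fun_continuous[OF assms], of R] R that by blast
qed

lemma test_fun_integrable: "test_fun \<rho> \<Longrightarrow> integrable lborel \<rho>"
  unfolding test_fun_def by (auto intro: integrable_compact_support smooth_on_continuous0)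

lemma mollify_integrable:
  assumes F: "test_fun F" and \<rho>: "test_fun \<rho>"
  shows "integrable lborel (\<lambda>y. F (x + (- \<delta>) *\<^sub>R y) * \<rho> y)"
proof -
  obtain R where R: "\<And>x. norm x > R \<Longrightarrow> \<rho> x = 0" using \<rho> by (auto simp: test_fun_def)
  show ?thesis
    by (rule integrable_compact_support[where R = R])
       (use R in \<open>auto intro!: continuous_intros continuous_on_compose2[OF test_fun_continuous[OF F]] test_fun_continuous[OF \<rho>]\<close>)
qed

lemma norm_mollify_le:
  assumes F: "test_fun F" and \<rho>: "test_fun \<rho>" and B: "\<And>x. norm (F x) \<le> B"
  shows "norm (mollify F \<rho> \<delta> x) \<le> B * (\<integral>y. norm (\<rho> y) \<partial>lborel)"
proof -
  have "norm (mollify F \<rho> \<delta> x) \<le> (\<integral>y. B * norm (\<rho> y) \<partial>lborel)"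
    unfolding mollify_def
    by (rule Bochner_Integration.integral_norm_bound_integral[OF mollify_integrable[OF F \<rho>]])
       (auto intro!: integrable_mult_right integrable_norm test_fun_integrable[OF \<rho>] mult_right_mono B simp: norm_mult)
  then show ?thesis by simp
qed

lemma has_partial_mollify:
  fixes F :: "real^'n::finite \<Rightarrow> complex"
  assumes F: "test_fun F" and \<rho>: "test_fun \<rho>"
  shows "has_partial i (mollify F \<rho> \<delta>) (mollify (partial_derivative i F) \<rho> \<delta> x) x"
proof -
  let ?F' = "partial_derivative i F"
  obtain B where B: "B > 0" "\<And>x. norm (?F' x) \<le> B" using test_fun_bounded[OF test_fun_partial[OF F]] by blast
  have "((\<lambda>t. \<integral>y. F (x + t *\<^sub>R axis i 1 + (- \<delta>) *\<^sub>R y) * \<rho> y \<partial>lborel) has_vector_derivative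
      (\<integral>y. ?F' (x + 0 *\<^sub>R axis i 1 + (- \<delta>) *\<^sub>R y) * \<rho> y \<partial>lborel)) (at 0)"
  proof (rule has_vector_derivative_integral[where b = "\<lambda>y. B * norm (\<rho> y)"])
    show "integrable lborel (\<lambda>y. F (x + t *\<^sub>R axis i 1 + (- \<delta>) *\<^sub>R y) * \<rho> y)" for t
      by (rule mollify_integrable[OF F \<rho>])
    show "(\<lambda>y. ?F' (x + 0 *\<^sub>R axis i 1 + (- \<delta>) *\<^sub>R y) * \<rho> y) \<in> borel_measurable lborel"
      by (rule borel_measurable_integrable[OF mollify_integrable[OF test_fun_partial[OF F] \<rho>]])
    show "integrable lborel (\<lambda>y. B * norm (\<rho> y))"
      by (intro integrable_mult_right integrable_norm test_fun_integrable \<rho>)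
    show "norm (?F' (x + t *\<^sub>R axis i 1 + (- \<delta>) *\<^sub>R y) * \<rho> y) \<le> B * norm (\<rho> y)" for t y
      unfolding norm_mult by (rule mult_right_mono[OF B(2)]) simp
    show "((\<lambda>s. F (x + s *\<^sub>R axis i 1 + (- \<delta>) *\<^sub>R y) * \<rho> y) has_vector_derivative
        ?F' (x + t *\<^sub>R axis i 1 + (- \<delta>) *\<^sub>R y) * \<rho> y) (at t)" for t y
    proof (rule has_vector_derivative_mult_left)
      have "has_partial i F (?F' (x + (- \<delta>) *\<^sub>R y + t *\<^sub>R axis i 1)) (x + (- \<delta>) *\<^sub>R y + t *\<^sub>R axis i 1)"
        using F by (intro smooth_on_has_partial0[of UNIV]) (auto simp: test_fun_def)
      from has_partial_at[OF this]
      show "((\<lambda>s. F (x + s *\<^sub>R axis i 1 + (- \<delta>) *\<^sub>R y)) has_vector_derivative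
        ?F' (x + t *\<^sub>R axis i 1 + (- \<delta>) *\<^sub>R y)) (at t)"
        by (simp add: algebra_simps)
    qed
  qed
  then show ?thesis unfolding has_partial_def mollify_def by simp
qed

lemma continuous_mollify:
  fixes F :: "real^'n::finite \<Rightarrow> complex"
  assumes F: "test_fun F" and \<rho>: "test_fun \<rho>"
  shows "continuous_on UNIV (mollify F \<rho> \<delta>)"
proof (rule continuous_at_imp_continuous_on, rule ballI)
  fix x
  obtain B where B: "B > 0" "\<And>x. norm (F x) \<le> B" using test_fun_bounded[OF F] by blast
  show "isCont (mollify F \<rho> \<delta>) x" unfolding isCont_def mollify_def
  proof (rule tendsto_integral_dominated_at[where b = "\<lambda>y. B * norm (\<rho> y)"])
    show "(\<lambda>y. F (z + (- \<delta>) *\<^sub>R y) * \<rho> y) \<in> borel_measurable lborel"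
        "(\<lambda>y. F (x + (- \<delta>) *\<^sub>R y) * \<rho> y) \<in> borel_measurable lborel" for z
      by (rule borel_measurable_integrable[OF mollify_integrable[OF F \<rho>]])+
    show "integrable lborel (\<lambda>y. B * norm (\<rho> y))"
      by (intro integrable_mult_right integrable_norm test_fun_integrable \<rho>)
    show "((\<lambda>t. F (t + (- \<delta>) *\<^sub>R y) * \<rho> y) \<longlongrightarrow> F (x + (- \<delta>) *\<^sub>R y) * \<rho> y) (at x)" for y
    proof -
      have "continuous_on UNIV (\<lambda>t. F (t + (- \<delta>) *\<^sub>R y) * \<rho> y)"
        by (intro continuous_intros continuous_on_compose2[OF test_fun_continuous[OF F]]) auto
      then have "isCont (\<lambda>t. F (t + (- \<delta>) *\<^sub>R y) * \<rho> y) x" by (simp add: continuous_on_eq_continuous_at)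
      then show ?thesis by (simp add: isCont_def)
    qed
    show "\<forall>\<^sub>F t in at x. \<forall>y. norm (F (t + (- \<delta>) *\<^sub>R y) * \<rho> y) \<le> B * norm (\<rho> y)"
      unfolding norm_mult by (intro always_eventually allI mult_right_mono B) simp
  qed
qed

lemma iter_partial_mollify:
  assumes F: "test_fun F" and \<rho>: "test_fun \<rho>"
  shows "iter_partial js (mollify F \<rho> \<delta>) = mollify (iter_partial js F) \<rho> \<delta>"
proof (induction js)
  case (Cons i js)
  show ?case unfolding iter_partial.simps Cons
    by (rule ext, rule has_partial_unique, rule has_partial_mollify[OF test_fun_iter[OF F] \<rho>])
qed simp

lemma smooth_on_mollify:
  assumes F: "test_fun F" and \<rho>: "test_fun \<rho>"
  shows "smooth_on UNIV (mollify F \<rho> \<delta>)"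
  unfolding smooth_on_def iter_partial_mollify[OF F \<rho>]
proof (intro allI conjI ballI)
  fix js i x
  show "continuous_on UNIV (mollify (iter_partial js F) \<rho> \<delta>)"
    by (rule continuous_mollify[OF test_fun_iter[OF F] \<rho>])
  show "(\<lambda>t. mollify (iter_partial js F) \<rho> \<delta> (x + t *\<^sub>R axis i 1)) differentiable at 0"
    using has_partial_mollify[OF test_fun_iter[OF F, of js] \<rho>, of i]
    unfolding has_partial_def by (rule differentiableI_vector)
qed

text \<open>
  Integration by parts: a derivative is moved from \<open>F\<close> to the kernel at the price of a factor \<open>1 / \<delta>\<close>.
\<close>

lemma mollify_partial:
  fixes F :: "real^'n::finite \<Rightarrow> complex"
  assumes F: "test_fun F" and \<rho>: "test_fun \<rho>" and \<delta>: "\<delta> > 0"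
  shows "mollify (partial_derivative i F) \<rho> \<delta> x = of_real (1 / \<delta>) * mollify F (partial_derivative i \<rho>) \<delta> x"
proof -
  obtain R where R: "\<And>x. norm x > R \<Longrightarrow> \<rho> x = 0" using \<rho> by (auto simp: test_fun_def)
  have R': "partial_derivative i \<rho> x = 0" if "norm x > R" for x
    using iter_partial_zero_outside[where S = "cball 0 R" and js = "[i]" and g = \<rho>] R that by auto
  let ?F' = "partial_derivative i F" and ?r' = "partial_derivative i \<rho>"
  let ?u' = "\<lambda>y. (of_real (- \<delta>) * ?F' (x + (- \<delta>) *\<^sub>R y)) * \<rho> y + F (x + (- \<delta>) *\<^sub>R y) * ?r' y"
  have FP: "has_partial i (\<lambda>y. F (x + (- \<delta>) *\<^sub>R y)) (of_real (- \<delta>) * ?F' (x + (- \<delta>) *\<^sub>R y)) y" for y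
  proof -
    have "has_partial i F (?F' (x + (- \<delta>) *\<^sub>R y)) (x + (- \<delta>) *\<^sub>R y)"
      using F by (intro smooth_on_has_partial0[of UNIV]) (auto simp: test_fun_def)
    then have d: "((\<lambda>s. F (x + (- \<delta>) *\<^sub>R y + s *\<^sub>R axis i 1)) has_vector_derivative ?F' (x + (- \<delta>) *\<^sub>R y)) (at ((- \<delta>) * 0))"
      by (simp add: has_partial_def)
    have "((\<lambda>t. (- \<delta>) * t) has_vector_derivative - \<delta>) (at 0)"
      by (auto intro!: derivative_eq_intros)
    from vector_diff_chain_at[OF this d]
    show ?thesis unfolding has_partial_def o_def
      by (simp add: scaleR_conv_of_real algebra_simps scaleR_add_right)
  qed
  have "(\<integral>y. ?u' y \<partial>lborel) = 0"
  proof (rule integral_partial_zero[where u = "\<lambda>y. F (x + (- \<delta>) *\<^sub>R y) * \<rho> y" and R = R])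
    show "has_partial i (\<lambda>y. F (x + (- \<delta>) *\<^sub>R y) * \<rho> y) (?u' y) y" for y
      using \<rho> by (intro has_partial_mult FP smooth_on_has_partial0[of UNIV]) (auto simp: test_fun_def)
  qed (use R R' in \<open>auto intro!: continuous_intros continuous_on_compose2[OF test_fun_continuous[OF F]]
     continuous_on_compose2[OF test_fun_continuous[OF test_fun_partial[OF F]]]
     test_fun_continuous[OF \<rho>] test_fun_continuous[OF test_fun_partial[OF \<rho>]]\<close>)
  moreover have "(\<integral>y. ?u' y \<partial>lborel) = of_real (- \<delta>) * mollify ?F' \<rho> \<delta> x + mollify F ?r' \<delta> x"
    unfolding mollify_def mult.assoc
    using mollify_integrable[OF test_fun_partial[OF F, of i] \<rho>, of x \<delta>] mollify_integrable[OF F test_fun_partial[OF \<rho>, of i], of x \<delta>]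
    by (subst Bochner_Integration.integral_add) auto
  ultimately have "mollify F ?r' \<delta> x = of_real \<delta> * mollify ?F' \<rho> \<delta> x" by (simp add: eq_neg_iff_add_eq_0 add.commute)
  then show ?thesis using \<delta> by simp
qed

text \<open>
  The outermost derivative is moved first and ends up innermost on the kernel, which explains \<open>rev js\<close>.
\<close>

lemma mollify_iter:
  assumes F: "test_fun F" and \<rho>: "test_fun \<rho>" and \<delta>: "\<delta> > 0"
  shows "mollify (iter_partial js F) \<rho> \<delta> x = of_real (1 / \<delta>) ^ length js * mollify F (iter_partial (rev js) \<rho>) \<delta> x"
  using \<rho>
proof (induction js arbitrary: \<rho>)
  case (Cons i js)
  have "mollify (iter_partial (i # js) F) \<rho> \<delta> x = of_real (1 / \<delta>) * mollify (iter_partial js F) (partial_derivative i \<rho>) \<delta> x"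
    unfolding iter_partial.simps by (rule mollify_partial[OF test_fun_iter[OF F] Cons.prems \<delta>])
  also have "\<dots> = of_real (1 / \<delta>) * (of_real (1 / \<delta>) ^ length js * mollify F (iter_partial (rev js) (partial_derivative i \<rho>)) \<delta> x)"
    by (subst Cons.IH[OF test_fun_partial[OF Cons.prems]]) simp
  finally show ?case by (simp add: iter_partial_append)
qed simp

text \<open>
  The mean value inequality, applied along axis-parallel segments one coordinate at a time.
\<close>

lemma partials_bound_increment:
  fixes F :: "real^'n::finite \<Rightarrow> complex"
  assumes F: "smooth_on UNIV F" and B: "\<And>i x. norm (partial_derivative i F x) \<le> B"
  shows "norm (F (x + v) - F x) \<le> B * (\<Sum>i\<in>UNIV. \<bar>v $ i\<bar>)"
proof -
  have line: "norm (F (y + s *\<^sub>R axis i 1) - F y) \<le> B * \<bar>s\<bar>" for y s i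
  proof -
    have "norm (F (y + s *\<^sub>R axis i 1) - F (y + 0 *\<^sub>R axis i 1)) \<le> B * norm (s - 0)"
    proof (rule differentiable_bound[where S = UNIV and f = "\<lambda>t. F (y + t *\<^sub>R axis i 1)"
          and f' = "\<lambda>t h. h *\<^sub>R partial_derivative i F (y + t *\<^sub>R axis i 1)"])
      show "((\<lambda>t. F (y + t *\<^sub>R axis i 1)) has_derivative (\<lambda>h. h *\<^sub>R partial_derivative i F (y + t *\<^sub>R axis i 1))) (at t within UNIV)" for t
      proof -
        have "has_partial i F (partial_derivative i F (y + t *\<^sub>R axis i 1)) (y + t *\<^sub>R axis i 1)"
          by (rule smooth_on_has_partial0[OF F UNIV_I])
        from has_partial_at[OF this] show ?thesis unfolding has_vector_derivative_def by simp
      qed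
      show "onorm (\<lambda>h. h *\<^sub>R partial_derivative i F (y + t *\<^sub>R axis i 1)) \<le> B" for t
        using B by (intro onorm_le) (auto simp: mult.commute[of B] intro!: mult_left_mono)
    qed auto
    then show ?thesis by simp
  qed
  have "norm (F (x + (\<Sum>i\<in>I. (v $ i) *\<^sub>R axis i 1)) - F x) \<le> B * (\<Sum>i\<in>I. \<bar>v $ i\<bar>)" if "finite I" for I
    using that
  proof induction
    case (insert i I)
    let ?y = "x + (\<Sum>i\<in>I. (v $ i) *\<^sub>R axis i 1)"
    have "norm (F (?y + (v $ i) *\<^sub>R axis i 1) - F x) \<le> norm (F (?y + (v $ i) *\<^sub>R axis i 1) - F ?y) + norm (F ?y - F x)"
      using norm_triangle_ineq[of "F (?y + (v $ i) *\<^sub>R axis i 1) - F ?y" "F ?y - F x"] by simp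
    also have "\<dots> \<le> B * \<bar>v $ i\<bar> + B * (\<Sum>i\<in>I. \<bar>v $ i\<bar>)" by (intro add_mono line insert.IH)
    finally show ?case using insert.hyps by (simp add: algebra_simps)
  qed simp
  from this[of UNIV] show ?thesis
    using basis_expansion[of v] by (simp add: scalar_mult_eq_scaleR)
qed

text \<open>
  A bound on \<open>m0 + 1\<close> derivatives of \<open>F\<close> gives both an approximation of order \<open>\<delta>\<close> in \<open>m0\<close>
  derivatives and bounds on arbitrarily many derivatives of the approximant, polynomial in \<open>1 / \<delta>\<close>. The operators \<open>P(D)\<close>
  commute with mollification, so local solutions remain solutions on a slightly smaller set.
\<close>

lemma mollification:
  fixes M m0 :: nat
  obtains C where "C \<ge> 0"
    "\<forall>(F :: real^'n::finite \<Rightarrow> complex) \<delta> S. test_fun F \<longrightarrow> 0 < \<delta> \<longrightarrow> \<delta> \<le> 1 \<longrightarrow> (\<forall>x. jet (Suc m0) F x \<le> S) \<longrightarrow>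
      (\<exists>F'. smooth_on UNIV F' \<and> (\<forall>x. jet M F' x \<le> C * (1 / \<delta>) ^ M * S) \<and>
        (\<forall>x. jet m0 (\<lambda>x. F x - F' x) x \<le> C * \<delta> * S) \<and>
        (\<forall>P x. (\<forall>y\<in>cball x \<delta>. diff_op P F y = 0) \<longrightarrow> diff_op P F' x = 0))"
proof -
  obtain \<rho> :: "real^'n \<Rightarrow> complex" where \<rho>: "test_fun \<rho>" "\<And>x. norm x > 1 \<Longrightarrow> \<rho> x = 0" "(\<integral>x. \<rho> x \<partial>lborel) = 1"
    using ex_bump by blast
  let ?I = "\<lambda>js. \<integral>y. norm (iter_partial js \<rho> y) \<partial>lborel"
  have I0: "?I js \<ge> 0" for js by (rule Bochner_Integration.integral_nonneg) simp
  define C1 where "C1 = (\<Sum>js | length js \<le> M. ?I js)"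
  define C2 where "C2 = real CARD('n) * ?I []"
  have C1: "?I js \<le> C1" if "length js \<le> M" for js
    unfolding C1_def using that I0 by (intro member_le_sum) (auto simp: finite_lists_le)
  have C1': "C1 \<ge> 0" unfolding C1_def by (intro sum_nonneg I0)
  have C2': "C2 \<ge> 0" unfolding C2_def using I0[of "[]"] by simp
  define C where "C = num_words TYPE('n) M * C1 + num_words TYPE('n) m0 * C2"
  have j1: "num_words TYPE('n) M \<ge> 1" "num_words TYPE('n) m0 \<ge> 1" by (rule num_words_ge1)+
  have Cge: "num_words TYPE('n) M * C1 \<le> C" "num_words TYPE('n) m0 * C2 \<le> C" "C \<ge> 0"
    unfolding C_def using j1 C1' C2' by auto
  show ?thesis
  proof (rule that[OF Cge(3)], intro allI impI)
    fix F :: "real^'n \<Rightarrow> complex" and \<delta> S :: real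
    assume F: "test_fun F" and \<delta>: "0 < \<delta>" "\<delta> \<le> 1" and "\<forall>x. jet (Suc m0) F x \<le> S"
    then have S: "jet (Suc m0) F x \<le> S" for x by blast
    let ?F' = "mollify F \<rho> \<delta>"
    have FS: "smooth_on UNIV F" using F by (simp add: test_fun_def)
    have S0: "S \<ge> 0" using S[of 0] jet_nonneg order_trans by blast
    have F0: "norm (F x) \<le> S" for x using jet_ge[of "[]" "Suc m0" F x] S[of x] by simp
    have d1: "1 / \<delta> \<ge> 1" using \<delta> by simp
    have sm: "smooth_on UNIV ?F'" by (rule smooth_on_mollify[OF F \<rho>(1)])
    have jM: "jet M ?F' x \<le> C * (1 / \<delta>) ^ M * S" for x
    proof -
      have "norm (iter_partial js ?F' x) \<le> (1 / \<delta>) ^ M * (S * C1)" if js: "length js \<le> M" for js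
      proof -
        have "norm (iter_partial js ?F' x) = (1 / \<delta>) ^ length js * norm (mollify F (iter_partial (rev js) \<rho>) \<delta> x)"
          unfolding iter_partial_mollify[OF F \<rho>(1)] mollify_iter[OF F \<rho>(1) \<delta>(1)] norm_mult norm_power norm_of_real
          using \<delta>(1) by simp
        also have "\<dots> \<le> (1 / \<delta>) ^ M * (S * C1)"
        proof (intro mult_mono power_increasing d1 js)
          have "norm (mollify F (iter_partial (rev js) \<rho>) \<delta> x) \<le> S * ?I (rev js)"
            by (rule norm_mollify_le[OF F test_fun_iter[OF \<rho>(1)] F0])
          also have "\<dots> \<le> S * C1" using C1[of "rev js"] js S0 by (intro mult_left_mono) auto
          finally show "norm (mollify F (iter_partial (rev js) \<rho>) \<delta> x) \<le> S * C1" .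
        qed (use \<delta> in auto)
        finally show ?thesis .
      qed
      from jet_le[OF this] have "jet M ?F' x \<le> (num_words TYPE('n) M * C1) * ((1 / \<delta>) ^ M * S)" by (simp add: mult_ac)
      also have "\<dots> \<le> C * ((1 / \<delta>) ^ M * S)" using Cge(1) S0 \<delta> by (intro mult_right_mono) auto
      finally show ?thesis by (simp add: mult.assoc)
    qed
    have jd: "jet m0 (\<lambda>x. F x - ?F' x) x \<le> C * \<delta> * S" for x
    proof -
      have "norm (iter_partial js (\<lambda>x. F x - ?F' x) x) \<le> C2 * (\<delta> * S)" if js: "length js \<le> m0" for js
      proof -
        let ?G = "iter_partial js F"
        have G: "test_fun ?G" by (rule test_fun_iter[OF F])
        have GB: "norm (partial_derivative i ?G y) \<le> S" for i y
          using jet_ge[of "i # js" "Suc m0" F y] S[of y] js by simp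
        have eq: "iter_partial js (\<lambda>x. F x - ?F' x) x = (\<integral>y. (?G x - ?G (x + (- \<delta>) *\<^sub>R y)) * \<rho> y \<partial>lborel)"
        proof -
          have "iter_partial js (\<lambda>x. F x - ?F' x) x = ?G x * (\<integral>y. \<rho> y \<partial>lborel) - mollify ?G \<rho> \<delta> x"
            unfolding iter_partial_diff[OF open_UNIV FS sm UNIV_I] iter_partial_mollify[OF F \<rho>(1)] \<rho>(3) by simp
          also have "\<dots> = (\<integral>y. ?G x * \<rho> y - ?G (x + (- \<delta>) *\<^sub>R y) * \<rho> y \<partial>lborel)"
            unfolding mollify_def
            by (subst Bochner_Integration.integral_diff)
               (auto intro!: integrable_mult_right test_fun_integrable[OF \<rho>(1)] mollify_integrable[OF G \<rho>(1), simplified])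
          finally show ?thesis by (simp add: left_diff_distrib)
        qed
        have "norm (\<integral>y. (?G x - ?G (x + (- \<delta>) *\<^sub>R y)) * \<rho> y \<partial>lborel) \<le>
            (\<integral>y. (real CARD('n) * (\<delta> * S)) * norm (\<rho> y) \<partial>lborel)"
        proof (rule Bochner_Integration.integral_norm_bound_integral)
          show "integrable lborel (\<lambda>y. (?G x - ?G (x + (- \<delta>) *\<^sub>R y)) * \<rho> y)"
            unfolding left_diff_distrib
            by (intro Bochner_Integration.integrable_diff integrable_mult_right test_fun_integrable[OF \<rho>(1)] mollify_integrable[OF G \<rho>(1)])
          show "integrable lborel (\<lambda>y. (real CARD('n) * (\<delta> * S)) * norm (\<rho> y))"
            by (intro integrable_mult_right integrable_norm test_fun_integrable \<rho>)
          fix y :: "real^'n"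
          show "norm ((?G x - ?G (x + (- \<delta>) *\<^sub>R y)) * \<rho> y) \<le> (real CARD('n) * (\<delta> * S)) * norm (\<rho> y)"
          proof (cases "norm y > 1")
            case False
            have "norm (?G (x + (- \<delta>) *\<^sub>R y) - ?G x) \<le> S * (\<Sum>i\<in>UNIV. \<bar>((- \<delta>) *\<^sub>R y) $ i\<bar>)"
              by (rule partials_bound_increment[OF _ GB]) (use G in \<open>simp add: test_fun_def\<close>)
            also have "\<dots> \<le> S * (\<Sum>i\<in>(UNIV :: 'n set). \<delta>)"
            proof (intro mult_left_mono sum_mono S0)
              fix i
              have "\<bar>y $ i\<bar> \<le> 1" using component_le_norm_cart[of y i] False by simp
              then have "\<delta> * \<bar>y $ i\<bar> \<le> \<delta> * 1" using \<delta> by (intro mult_left_mono) auto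
              then show "\<bar>((- \<delta>) *\<^sub>R y) $ i\<bar> \<le> \<delta>" using \<delta> by (simp add: abs_mult)
            qed
            finally have "norm (?G x - ?G (x + (- \<delta>) *\<^sub>R y)) \<le> real CARD('n) * (\<delta> * S)"
              by (simp add: norm_minus_commute mult_ac)
            then show ?thesis unfolding norm_mult by (rule mult_right_mono) simp
          qed (use \<rho>(2) in simp)
        qed
        then show ?thesis unfolding eq C2_def by (simp add: mult_ac)
      qed
      from jet_le[OF this] have "jet m0 (\<lambda>x. F x - ?F' x) x \<le> (num_words TYPE('n) m0 * C2) * (\<delta> * S)" by (simp add: mult_ac)
      also have "\<dots> \<le> C * (\<delta> * S)" using Cge(2) S0 \<delta> by (intro mult_right_mono) auto
      finally show ?thesis by (simp add: mult.assoc)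
    qed
    have dP: "diff_op P ?F' x = 0" if P: "\<forall>y\<in>cball x \<delta>. diff_op P F y = 0" for P x
    proof -
      let ?c = "\<lambda>\<alpha>. Poly_Mapping.lookup P \<alpha> * (- \<i>) ^ length (multi_index_list \<alpha>)"
      let ?K = "Poly_Mapping.keys P"
      have "diff_op P ?F' x = (\<Sum>\<alpha>\<in>?K. ?c \<alpha> * (\<integral>y. iter_partial (multi_index_list \<alpha>) F (x + (- \<delta>) *\<^sub>R y) * \<rho> y \<partial>lborel))"
        unfolding diff_op_smooth[OF open_UNIV sm UNIV_I] iter_partial_mollify[OF F \<rho>(1)] mollify_def ..
      also have "\<dots> = (\<integral>y. (\<Sum>\<alpha>\<in>?K. ?c \<alpha> * (iter_partial (multi_index_list \<alpha>) F (x + (- \<delta>) *\<^sub>R y) * \<rho> y)) \<partial>lborel)"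
        unfolding integral_mult_right_zero[symmetric]
        by (rule Bochner_Integration.integral_sum[symmetric])
           (intro integrable_mult_right mollify_integrable test_fun_iter F \<rho>)
      also have "\<dots> = (\<integral>y. 0 \<partial>(lborel :: (real^'n) measure))"
      proof (rule Bochner_Integration.integral_cong[OF refl])
        fix y :: "real^'n"
        have "(\<Sum>\<alpha>\<in>?K. ?c \<alpha> * (iter_partial (multi_index_list \<alpha>) F (x + (- \<delta>) *\<^sub>R y) * \<rho> y)) =
            diff_op P F (x + (- \<delta>) *\<^sub>R y) * \<rho> y"
          unfolding diff_op_smooth[OF open_UNIV FS UNIV_I] sum_distrib_right mult.assoc ..
        also have "\<dots> = 0"
        proof (cases "norm y > 1")
          case False
          then have "\<delta> * norm y \<le> \<delta> * 1" using \<delta> by (intro mult_left_mono) auto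
          then have "x + (- \<delta>) *\<^sub>R y \<in> cball x \<delta>" using \<delta> by (simp add: dist_norm)
          then show ?thesis using P by simp
        qed (use \<rho>(2) in simp)
        finally show "(\<Sum>\<alpha>\<in>?K. ?c \<alpha> * (iter_partial (multi_index_list \<alpha>) F (x + (- \<delta>) *\<^sub>R y) * \<rho> y)) = 0" .
      qed
      finally show ?thesis by simp
    qed
    show "\<exists>F'. smooth_on UNIV F' \<and> (\<forall>x. jet M F' x \<le> C * (1 / \<delta>) ^ M * S) \<and>
        (\<forall>x. jet m0 (\<lambda>x. F x - F' x) x \<le> C * \<delta> * S) \<and>
        (\<forall>P x. (\<forall>y\<in>cball x \<delta>. diff_op P F y = 0) \<longrightarrow> diff_op P F' x = 0)"
      by (intro exI[of _ ?F'] conjI allI impI sm jM jd dP)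
  qed
qed

section \<open>Decomposition of solutions\<close>

lemma smooth_cutoff_extension:
  assumes "open X" "smooth_on UNIV \<theta>" "closed L" "L \<subseteq> X" "\<And>x. x \<notin> L \<Longrightarrow> \<theta> x = 0" "smooth_on X f"
  shows "smooth_on UNIV (\<lambda>x. \<theta> x * f x)"
proof (rule smooth_on_open_Union)
  fix x
  show "\<exists>Y. open Y \<and> x \<in> Y \<and> smooth_on Y (\<lambda>x. \<theta> x * f x)"
  proof (cases "x \<in> X")
    case True
    then show ?thesis using assms(1,2,6)
      by (intro exI[of _ X] conjI smooth_on_mult) (auto intro: smooth_on_subset)
  next
    case False
    have "smooth_on (- L) (\<lambda>x. \<theta> x * f x)"
      by (rule smooth_on_cong[OF _ smooth_on_const[of _ 0]]) (use assms in auto)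
    then show ?thesis using assms False by (intro exI[of _ "- L"]) auto
  qed
qed

lemma jet_zero_outside:
  assumes "closed S" "\<And>x. x \<notin> S \<Longrightarrow> g x = 0" "x \<notin> S"
  shows "jet m g x = 0"
  unfolding jet_def using iter_partial_zero_outside[OF assms] by simp

lemma diff_op_zero_outside:
  assumes "closed S" "\<And>x. x \<notin> S \<Longrightarrow> g x = 0" "x \<notin> S"
  shows "diff_op P g x = 0"
proof -
  have "diff_op P (\<lambda>_. 0) x = diff_op P g x"
    by (rule diff_op_cong_open[where X = "- S"]) (use assms in \<open>auto intro: smooth_on_const\<close>)
  then show ?thesis by (simp add: diff_op_zero)
qed

lemma telescoping_partition:
  fixes \<phi> :: "nat \<Rightarrow> complex"
  shows "(\<Sum>k<N. (1 - \<phi> k) * (\<Prod>i<k. \<phi> i)) = 1 - (\<Prod>k<N. \<phi> k)"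
  by (induction N) (auto simp: algebra_simps)

lemma open_Collect_all_less:
  fixes \<eta> :: "nat \<Rightarrow> 'a::euclidean_space"
  shows "open {x. \<forall>k<N. \<eta> k \<bullet> x + b k < c}"
proof -
  have "{x. \<forall>k<N. \<eta> k \<bullet> x + b k < c} = (\<Inter>k\<in>{..<N}. {x. \<eta> k \<bullet> x + b k < c})" by auto
  also have "open \<dots>" by (intro open_INT ballI finite_lessThan open_Collect_less continuous_intros)
  finally show ?thesis .
qed

text \<open>
  The heart of the matter: \<open>(\<Omega>)\<close> in terms of jets. The set \<open>L\<close> and the order \<open>Suc m0\<close> to which
  \<open>f\<close> is controlled depend only on \<open>K0\<close> and \<open>m0\<close>, while \<open>B\<close> and \<open>s\<close> may depend on
  \<open>K1\<close> and \<open>m1\<close>.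
\<close>

lemma solution_decomposition:
  fixes P :: "'n::finite cpoly" and X K0 :: "(real^'n) set" and m0 :: nat
  assumes X: "open X" "convex X" and K0: "compact K0" "K0 \<subseteq> X"
  obtains L where "compact L" "L \<subseteq> X"
    "\<And>K1 m1. compact K1 \<Longrightarrow> \<exists>B s. B > 0 \<and> (s::nat) > 0 \<and> (\<forall>f \<epsilon>. smooth_on X f \<longrightarrow> (\<forall>x\<in>X. diff_op P f x = 0) \<longrightarrow>
       (\<forall>x\<in>L. jet (Suc m0) f x \<le> 1) \<longrightarrow> 0 < \<epsilon> \<longrightarrow> \<epsilon> \<le> 1 \<longrightarrow>
       (\<exists>w. smooth_on UNIV w \<and> (\<forall>x. diff_op P w x = 0) \<and>
         (\<forall>x\<in>K0. jet m0 (\<lambda>x. f x - w x) x \<le> \<epsilon>) \<and> (\<forall>x\<in>K1. jet m1 w x \<le> B * (1 / \<epsilon>) ^ s)))"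
proof -
  obtain N :: nat and \<eta> b where poly: "\<And>k x. k < N \<Longrightarrow> x \<in> K0 \<Longrightarrow> \<eta> k \<bullet> x + b k \<le> 0"
    "compact {x. \<forall>k<N. \<eta> k \<bullet> x + b k \<le> 1}" "{x. \<forall>k<N. \<eta> k \<bullet> x + b k \<le> 1} \<subseteq> X"
    by (rule polytope_neighbourhood[OF X K0], rule that, assumption, assumption, assumption)
  define a where "a k x = \<eta> k \<bullet> x + b k" for k x
  define L where "L = {x. \<forall>k<N. a k x \<le> 1}"
  have L: "compact L" "L \<subseteq> X" "closed L" using poly compact_imp_closed by (auto simp: L_def a_def)
  obtain N' :: nat and \<eta>' b' where poly': "\<And>k x. k < N' \<Longrightarrow> x \<in> L \<Longrightarrow> \<eta>' k \<bullet> x + b' k \<le> 0"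
    "compact {x. \<forall>k<N'. \<eta>' k \<bullet> x + b' k \<le> 1}" "{x. \<forall>k<N'. \<eta>' k \<bullet> x + b' k \<le> 1} \<subseteq> X"
    by (rule polytope_neighbourhood[OF X L(1,2)], rule that, assumption, assumption, assumption)
  define a' where "a' k x = \<eta>' k \<bullet> x + b' k" for k x
  define L' where "L' = {x. \<forall>k<N'. a' k x \<le> 1}"
  have L': "compact L'" "L' \<subseteq> X" "closed L'" using poly' compact_imp_closed by (auto simp: L'_def a'_def)
  \<comment> \<open>The thresholds: \<open>\<theta>'\<close> is 1 where all \<open>a' k \<le> 1/2\<close>; \<open>\<theta>\<close> is 1 where all \<open>a k \<le> 2/3\<close>;
      \<open>\<phi> k\<close> is 1 where \<open>a k \<le> 1/3\<close> and 0 where \<open>a k \<ge> 2/3\<close>. Hence \<open>\<theta>\<close> is constant wherever the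
      product of all \<open>\<phi> k\<close> is non-zero, and \<open>\<psi> k\<close> lives where \<open>a k \<ge> 1/3\<close>.\<close>
  define \<theta>' where "\<theta>' x = (\<Prod>k<N'. step (2 *\<^sub>R \<eta>' k) (2 * b' k - 1) x)" for x
  define \<theta> where "\<theta> x = (\<Prod>k<N. step (3 *\<^sub>R \<eta> k) (3 * b k - 2) x)" for x
  define \<phi> where "\<phi> k = step (3 *\<^sub>R \<eta> k) (3 * b k - 1)" for k
  define \<psi> where "\<psi> k x = (1 - \<phi> k x) * (\<Prod>i<k. \<phi> i x)" for k x
  have sm\<theta>': "smooth_on UNIV \<theta>'" unfolding \<theta>'_def[abs_def] by (intro smooth_on_prod smooth_on_step open_UNIV)
  have sm\<theta>: "smooth_on UNIV \<theta>" unfolding \<theta>_def[abs_def] by (intro smooth_on_prod smooth_on_step open_UNIV)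
  have sm\<psi>: "smooth_on UNIV (\<psi> k)" for k unfolding \<psi>_def[abs_def] \<phi>_def
    by (intro smooth_on_mult smooth_on_diff smooth_on_const smooth_on_prod smooth_on_step open_UNIV)
  have \<theta>'0: "\<theta>' x = 0" if x: "x \<notin> L'" for x
  proof -
    obtain k where k: "k < N'" "a' k x > 1" using x by (auto simp: L'_def not_le)
    have "step (2 *\<^sub>R \<eta>' k) (2 * b' k - 1) x = 0" by (rule step_eq_0) (use k in \<open>simp add: a'_def\<close>)
    then show ?thesis unfolding \<theta>'_def using k(1) by (intro prod_zero) auto
  qed
  have \<theta>0: "\<theta> x = 0" if x: "x \<notin> L" for x
  proof -
    obtain k where k: "k < N" "a k x > 1" using x by (auto simp: L_def not_le)
    have "step (3 *\<^sub>R \<eta> k) (3 * b k - 2) x = 0" by (rule step_eq_0) (use k in \<open>simp add: a_def\<close>)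
    then show ?thesis unfolding \<theta>_def using k(1) by (intro prod_zero) auto
  qed
  define O' where "O' = {x. \<forall>k<N'. a' k x < 1 / 2}"
  define Q where "Q = {x. \<forall>k<N. a k x < 2 / 3}"
  have "open O'" unfolding O'_def a'_def by (rule open_Collect_all_less)
  moreover have "L \<subseteq> O'" unfolding O'_def
  proof (intro subsetI CollectI allI impI)
    fix x k assume "x \<in> L" "k < N'"
    then show "a' k x < 1 / 2" using poly'(1)[of k x] by (simp add: a'_def)
  qed
  moreover have "O' \<subseteq> L'"
  proof
    fix x assume x: "x \<in> O'"
    have "a' k x \<le> 1" if "k < N'" for k
    proof -
      have "a' k x < 1 / 2" using x that unfolding O'_def by blast
      then show ?thesis by simp
    qed
    then show "x \<in> L'" unfolding L'_def by blast
  qed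
  ultimately have O': "open O'" "L \<subseteq> O'" "O' \<subseteq> L'" by blast+
  have "open Q" unfolding Q_def a_def by (rule open_Collect_all_less)
  moreover have "K0 \<subseteq> Q" unfolding Q_def
  proof (intro subsetI CollectI allI impI)
    fix x k assume "x \<in> K0" "k < N"
    then show "a k x < 2 / 3" using poly(1)[of k x] by (simp add: a_def)
  qed
  moreover have "Q \<subseteq> L"
  proof
    fix x assume x: "x \<in> Q"
    have "a k x \<le> 1" if "k < N" for k
    proof -
      have "a k x < 2 / 3" using x that unfolding Q_def by blast
      then show ?thesis by simp
    qed
    then show "x \<in> L" unfolding L_def by blast
  qed
  ultimately have Q: "open Q" "Q \<subseteq> L" "K0 \<subseteq> Q" by blast+
  have \<theta>'1: "\<theta>' x = 1" if "x \<in> O'" for x unfolding \<theta>'_def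
    by (intro prod.neutral ballI step_eq_1) (use that in \<open>auto simp: O'_def a'_def\<close>)
  have \<theta>1: "\<theta> x = 1" if "x \<in> Q" for x unfolding \<theta>_def
    by (intro prod.neutral ballI step_eq_1) (use that in \<open>auto simp: Q_def a_def\<close>)
  obtain r where r: "r > 0" "(\<Union>x\<in>L. cball x r) \<subseteq> O'"
    using compact_subset_open_imp_cball_epsilon_subset[OF L(1) O'(1,2)] by blast
  obtain R0 where R0: "\<And>x. x \<in> L \<Longrightarrow> norm x \<le> R0" using compact_imp_bounded[OF L(1)] bounded_iff by metis
  define R where "R = max R0 0"
  have R: "R \<ge> 0" "\<And>x. x \<in> L \<Longrightarrow> norm x \<le> R" using R0 by (force simp: R_def)+
  obtain B\<theta>' where B\<theta>': "B\<theta>' > 0" "\<And>x. x \<in> L' \<Longrightarrow> jet (Suc m0) \<theta>' x \<le> B\<theta>'"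
    using jet_bounded_compact[OF sm\<theta>' L'(1) subset_UNIV] by metis
  define S where "S = num_words TYPE('n) (Suc m0) * 2 ^ Suc m0 * (B\<theta>' * 1)"
  have jc0: "num_words TYPE('n) m > 0" for m using num_words_ge1[where 'n='n and m=m] by linarith
  have S0: "S \<ge> 0" unfolding S_def using jc0[of "Suc m0"] B\<theta>' by simp
  show ?thesis
  proof (rule that[OF L'(1,2)])
    fix K1 :: "(real^'n) set" and m1 :: nat
    assume K1: "compact K1"
    have "bounded (K0 \<union> K1)" using compact_imp_bounded[OF K0(1)] compact_imp_bounded[OF K1] by simp
    then obtain r1 where r1: "\<And>x. x \<in> K0 \<union> K1 \<Longrightarrow> norm x \<le> r1" using bounded_iff by metis
    define M where "M = max m0 m1"
    obtain Cs where Cs: "Cs \<ge> 0"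
      "\<And>g (\<eta> :: real^'n) b t G. t \<ge> 0 \<Longrightarrow> test_fun g \<Longrightarrow> (\<And>x. norm x > R \<Longrightarrow> g x = 0) \<Longrightarrow>
       (\<And>x. g x \<noteq> 0 \<Longrightarrow> \<eta> \<bullet> x \<ge> b) \<Longrightarrow> (P = 0 \<Longrightarrow> g = (\<lambda>x. 0)) \<Longrightarrow>
       (\<And>x. jet (M + 2 * CARD('n)) g x \<le> G) \<Longrightarrow>
       \<exists>h. smooth_on UNIV h \<and> (\<forall>x. diff_op P h x = g x) \<and>
         (\<forall>x. norm x \<le> r1 \<longrightarrow> jet M h x \<le> Cs * exp (t * (\<eta> \<bullet> x - b)) * G)"
      by (rule exponentially_weighted_solution[OF R(1), of P M r1], rule that, assumption, blast)
    obtain Cq q where Cq: "Cq \<ge> 0" "\<And>(X::(real^'n) set) f x m. open X \<Longrightarrow> smooth_on X f \<Longrightarrow> x \<in> X \<Longrightarrow>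
       jet m (diff_op P f) x \<le> Cq * jet (m + q) f x"
      by (rule jet_diff_op[of P], rule that, assumption, assumption)
    define M' where "M' = M + 2 * CARD('n)"
    define Md where "Md = M' + q"
    obtain Cm where Cm: "Cm \<ge> 0" "\<forall>(F :: real^'n \<Rightarrow> complex) \<delta> S. test_fun F \<longrightarrow> 0 < \<delta> \<longrightarrow> \<delta> \<le> 1 \<longrightarrow> (\<forall>x. jet (Suc m0) F x \<le> S) \<longrightarrow>
      (\<exists>F'. smooth_on UNIV F' \<and> (\<forall>x. jet Md F' x \<le> Cm * (1 / \<delta>) ^ Md * S) \<and>
        (\<forall>x. jet m0 (\<lambda>x. F x - F' x) x \<le> Cm * \<delta> * S) \<and>
        (\<forall>P x. (\<forall>y\<in>cball x \<delta>. diff_op P F y = 0) \<longrightarrow> diff_op P F' x = 0))"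
      by (rule mollification[where M = Md and ?m0.0 = m0], rule that, assumption, assumption)
    obtain B\<theta> where B\<theta>: "B\<theta> > 0" "\<And>x. x \<in> L \<Longrightarrow> jet Md \<theta> x \<le> B\<theta>"
      using jet_bounded_compact[OF sm\<theta> L(1) subset_UNIV] by metis
    have "\<exists>B. B > 0 \<and> (\<forall>x\<in>L. jet M' (\<psi> k) x \<le> B)" for k
      using jet_bounded_compact[OF sm\<psi> L(1) subset_UNIV] by metis
    then obtain Bf where Bf: "\<And>k. Bf k > 0" "\<And>k x. x \<in> L \<Longrightarrow> jet M' (\<psi> k) x \<le> Bf k" by metis
    define B\<psi> where "B\<psi> = (\<Sum>k<N. Bf k)"
    have B\<psi>0: "B\<psi> \<ge> 0" unfolding B\<psi>_def using Bf(1) by (intro sum_nonneg) (auto simp: less_imp_le)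
    have B\<psi>: "jet M' (\<psi> k) x \<le> B\<psi>" if "k < N" "x \<in> L" for k x
    proof -
      have "Bf k \<le> B\<psi>" unfolding B\<psi>_def using that Bf(1) by (intro member_le_sum) (auto simp: less_imp_le)
      then show ?thesis using Bf(2)[OF that(2), of k] by linarith
    qed
    define c2 where "c2 = num_words TYPE('n) Md * 2 ^ Md * (B\<theta> * (Cm * S))"
    define c1 where "c1 = num_words TYPE('n) M' * 2 ^ M' * (B\<psi> * (Cq * c2))"
    have c2: "c2 \<ge> 0" unfolding c2_def using jc0[of Md] B\<theta>(1) Cm(1) S0 by simp
    have c1: "c1 \<ge> 0" unfolding c1_def using jc0[of M'] B\<psi>0 Cq(1) c2 by simp
    define H where "H = Suc (nat \<lceil>\<Sum>k<N. norm (\<eta> k) * \<bar>r1\<bar> + \<bar>b k\<bar>\<rceil>)"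
    have H: "a k x \<le> real H" if "k < N" "x \<in> K1" for k x
    proof -
      have "\<eta> k \<bullet> x \<le> norm (\<eta> k) * norm x" by (rule norm_cauchy_schwarz)
      also have "\<dots> \<le> norm (\<eta> k) * \<bar>r1\<bar>" using r1[of x] that by (intro mult_left_mono) auto
      finally have "a k x \<le> norm (\<eta> k) * \<bar>r1\<bar> + \<bar>b k\<bar>" by (simp add: a_def)
      also have "\<dots> \<le> (\<Sum>k<N. norm (\<eta> k) * \<bar>r1\<bar> + \<bar>b k\<bar>)" using that by (intro member_le_sum) auto
      also have "\<dots> \<le> real H" unfolding H_def using real_nat_ceiling_ge[of "\<Sum>k<N. norm (\<eta> k) * \<bar>r1\<bar> + \<bar>b k\<bar>"] by simp
      finally show ?thesis .
    qed
    \<comment> \<open>The mollification scale will be \<open>\<kappa> * \<epsilon>\<close>: below \<open>r\<close>, so that \<open>P(D)\<close> still annihilates the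
        mollified function on \<open>L\<close>, and small enough for an error of at most \<open>\<epsilon> / 2\<close>.\<close>
    define \<kappa> where "\<kappa> = min (min r 1) (1 / (2 * (Cm * S + 1)))"
    have CmS: "Cm * S + 1 > 0" using Cm(1) S0 by (simp add: add_nonneg_pos)
    have \<kappa>: "\<kappa> > 0" "\<kappa> \<le> r" "\<kappa> \<le> 1" unfolding \<kappa>_def using r(1) CmS by auto
    have \<kappa>C: "Cm * \<kappa> * S \<le> 1 / 2"
    proof -
      have "\<kappa> * (Cm * S + 1) \<le> 1 / (2 * (Cm * S + 1)) * (Cm * S + 1)"
        unfolding \<kappa>_def using CmS by (intro mult_right_mono) auto
      also have "\<dots> = 1 / 2" using CmS by (simp add: divide_simps)
      finally show ?thesis using \<kappa>(1) by (simp add: algebra_simps)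
    qed
    define D where "D = 2 * real N * Cs * c1 * (1 / \<kappa>) ^ Md"
    have D: "D \<ge> 0" unfolding D_def using Cs(1) c1 \<kappa>(1) by simp
    define B where "B = c2 * (1 / \<kappa>) ^ Md + D / 2 * (1 + D) ^ (3 * H) + 1"
    define s where "s = Md + (Md + 1) * (3 * H)"
    have B: "B > 0" unfolding B_def using c2 \<kappa>(1) D by (intro add_nonneg_pos add_nonneg_nonneg) auto
    have s: "s > 0" unfolding s_def H_def by simp
    have main: "\<exists>w. smooth_on UNIV w \<and> (\<forall>x. diff_op P w x = 0) \<and>
         (\<forall>x\<in>K0. jet m0 (\<lambda>x. f x - w x) x \<le> \<epsilon>) \<and> (\<forall>x\<in>K1. jet m1 w x \<le> B * (1 / \<epsilon>) ^ s)"
      if f: "smooth_on X f" "\<forall>x\<in>X. diff_op P f x = 0" "\<forall>x\<in>L'. jet (Suc m0) f x \<le> 1" and \<epsilon>: "0 < \<epsilon>" "\<epsilon> \<le> 1" for f \<epsilon>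
    proof -
      let ?F = "\<lambda>x. \<theta>' x * f x"
      have smF: "smooth_on UNIV ?F" by (rule smooth_cutoff_extension[OF X(1) sm\<theta>' L'(3,2) \<theta>'0 f(1)])
      have F0: "?F x = 0" if "x \<notin> L'" for x using \<theta>'0[OF that] by simp
      have tF: "test_fun ?F"
      proof -
        obtain R' where "\<And>x. x \<in> L' \<Longrightarrow> norm x \<le> R'" using compact_imp_bounded[OF L'(1)] bounded_iff by metis
        then have "?F x = 0" if "norm x > R'" for x using F0[of x] that by force
        then show ?thesis unfolding test_fun_def using smF by blast
      qed
      have jF: "jet (Suc m0) ?F x \<le> S" for x
      proof (cases "x \<in> L'")
        case True
        then have "x \<in> X" using L'(2) by blast
        have "jet (Suc m0) ?F x \<le> num_words TYPE('n) (Suc m0) * 2 ^ Suc m0 * (jet (Suc m0) \<theta>' x * jet (Suc m0) f x)"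
          by (rule jet_mult[OF X(1) smooth_on_subset[OF sm\<theta>' subset_UNIV] f(1) \<open>x \<in> X\<close>])
        also have "\<dots> \<le> S" unfolding S_def
          using f(3) True B\<theta>' jc0[of "Suc m0"] by (intro mult_left_mono mult_mono jet_nonneg) auto
        finally show ?thesis .
      next
        case False
        have "jet (Suc m0) ?F x = 0" by (rule jet_zero_outside[OF L'(3) F0 False])
        then show ?thesis using S0 by simp
      qed
      define \<delta> where "\<delta> = \<kappa> * \<epsilon>"
      have \<delta>: "0 < \<delta>" "\<delta> \<le> 1" "\<delta> \<le> r"
        unfolding \<delta>_def using \<kappa> \<epsilon> mult_le_one[of \<kappa> \<epsilon>] mult_mono[of \<kappa> r \<epsilon> 1] r(1) by auto
      obtain F' where F': "smooth_on UNIV F'" "\<And>x. jet Md F' x \<le> Cm * (1 / \<delta>) ^ Md * S"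
        "\<And>x. jet m0 (\<lambda>x. ?F x - F' x) x \<le> Cm * \<delta> * S"
        "\<And>P x. (\<forall>y\<in>cball x \<delta>. diff_op P ?F y = 0) \<Longrightarrow> diff_op P F' x = 0"
        using Cm(2)[rule_format, OF tF \<delta>(1,2) jF] by (elim exE conjE) blast
      have PF: "diff_op P ?F y = 0" if "y \<in> O'" for y
      proof -
        have "diff_op P f y = diff_op P ?F y"
          by (rule diff_op_cong_open[OF O'(1) smooth_on_subset[OF f(1)] that]) (use O' L'(2) \<theta>'1 in auto)
        then show ?thesis using f(2) that O'(3) L'(2) by auto
      qed
      have PF': "diff_op P F' x = 0" if "x \<in> L" for x
      proof (rule F'(4), rule ballI)
        fix y assume "y \<in> cball x \<delta>"
        then have "y \<in> cball x r" using \<delta>(3) by simp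
        then show "diff_op P ?F y = 0" using r(2) that PF by blast
      qed
      let ?\<Phi> = "\<lambda>x. \<theta> x * F' x"
      let ?e = "(1 / \<epsilon>) ^ Md"
      have e\<delta>: "(1 / \<delta>) ^ Md = (1 / \<kappa>) ^ Md * ?e" unfolding \<delta>_def by (simp add: power_divide power_mult_distrib)
      have sm\<Phi>: "smooth_on UNIV ?\<Phi>" by (rule smooth_on_mult[OF open_UNIV sm\<theta> F'(1)])
      have \<Phi>0: "?\<Phi> x = 0" if "x \<notin> L" for x using \<theta>0[OF that] by simp
      have j\<Phi>: "jet Md ?\<Phi> x \<le> c2 * (1 / \<delta>) ^ Md" for x
      proof (cases "x \<in> L")
        case True
        have "jet Md ?\<Phi> x \<le> num_words TYPE('n) Md * 2 ^ Md * (jet Md \<theta> x * jet Md F' x)"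
          by (rule jet_mult[OF open_UNIV sm\<theta> F'(1) UNIV_I])
        also have "\<dots> \<le> num_words TYPE('n) Md * 2 ^ Md * (B\<theta> * (Cm * (1 / \<delta>) ^ Md * S))"
          using True B\<theta> F'(2) jc0[of Md] by (intro mult_left_mono mult_mono jet_nonneg) auto
        finally show ?thesis unfolding c2_def by (simp add: mult_ac)
      next
        case False
        have "jet Md ?\<Phi> x = 0" by (rule jet_zero_outside[OF L(3) \<Phi>0 False])
        then show ?thesis using c2 \<delta> by simp
      qed
      let ?src = "diff_op P ?\<Phi>"
      have smg0: "smooth_on UNIV ?src" by (rule smooth_on_diff_op[OF open_UNIV sm\<Phi>])
      have g00: "?src x = 0" if "x \<notin> L" for x by (rule diff_op_zero_outside[OF L(3) \<Phi>0 that])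
      have g0Q: "?src x = 0" if "x \<in> Q" for x
      proof -
        have "diff_op P F' x = ?src x"
          by (rule diff_op_cong_open[OF Q(1) smooth_on_subset[OF F'(1) subset_UNIV] that]) (use \<theta>1 in auto)
        then show ?thesis using PF'[of x] that Q(2) by auto
      qed
      let ?g = "\<lambda>k x. \<psi> k x * ?src x"
      let ?G = "c1 * (1 / \<delta>) ^ Md"
      have smg: "smooth_on UNIV (?g k)" for k by (rule smooth_on_mult[OF open_UNIV sm\<psi> smg0])
      have gL: "?g k x = 0" if "x \<notin> L" for k x using g00[OF that] by simp
      have gR: "?g k x = 0" if "norm x > R" for k x using gL[of x k] R(2)[of x] that by force
      have tg: "test_fun (?g k)" for k unfolding test_fun_def using smg gR by blast
      have ga: "a k x \<ge> 1 / 3" if "?g k x \<noteq> 0" for k x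
      proof (rule ccontr)
        assume "\<not> a k x \<ge> 1 / 3"
        then have "\<phi> k x = 1" unfolding \<phi>_def by (intro step_eq_1) (simp add: a_def)
        then show False using that by (simp add: \<psi>_def)
      qed
      have jg: "jet M' (?g k) x \<le> ?G" if "k < N" for k x
      proof (cases "x \<in> L")
        case True
        have "jet M' (?g k) x \<le> num_words TYPE('n) M' * 2 ^ M' * (jet M' (\<psi> k) x * jet M' ?src x)"
          by (rule jet_mult[OF open_UNIV sm\<psi> smg0 UNIV_I])
        also have "\<dots> \<le> num_words TYPE('n) M' * 2 ^ M' * (B\<psi> * (Cq * (c2 * (1 / \<delta>) ^ Md)))"
        proof (intro mult_left_mono mult_mono jet_nonneg)
          have "jet M' ?src x \<le> Cq * jet Md ?\<Phi> x" unfolding Md_def by (rule Cq(2)[OF open_UNIV sm\<Phi> UNIV_I])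
          also have "\<dots> \<le> Cq * (c2 * (1 / \<delta>) ^ Md)" by (rule mult_left_mono[OF j\<Phi> Cq(1)])
          finally show "jet M' ?src x \<le> \<dots>" .
        qed (use B\<psi>[OF that True] B\<psi>0 jc0[of M'] in auto)
        finally show ?thesis unfolding c1_def by (simp add: mult_ac)
      next
        case False
        have "jet M' (?g k) x = 0" by (rule jet_zero_outside[OF L(3) gL False])
        then show ?thesis using c1 \<delta> by simp
      qed
      \<comment> \<open>The parameter \<open>t\<close> is chosen so that \<open>exp (- t / 3) = 1 / T\<close>. The factor \<open>1 / T\<close> outweighs the
          powers of \<open>1 / \<epsilon>\<close> produced by the mollification and leaves \<open>\<epsilon> / 2\<close>.\<close>
      define T where "T = 1 + D * (1 / \<epsilon>) ^ (Md + 1)"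
      have T1: "T \<ge> 1" unfolding T_def using D \<epsilon> by simp
      define t where "t = 3 * ln T"
      have t: "t \<ge> 0" unfolding t_def using T1 by simp
      have "\<forall>k\<in>{..<N}. \<exists>h. smooth_on UNIV h \<and> (\<forall>x. diff_op P h x = ?g k x) \<and>
         (\<forall>x. norm x \<le> r1 \<longrightarrow> jet M h x \<le> Cs * exp (t * (\<eta> k \<bullet> x - (1 / 3 - b k))) * ?G)"
      proof
        fix k assume "k \<in> {..<N}"
        then have k: "k < N" by simp
        show "\<exists>h. smooth_on UNIV h \<and> (\<forall>x. diff_op P h x = ?g k x) \<and>
         (\<forall>x. norm x \<le> r1 \<longrightarrow> jet M h x \<le> Cs * exp (t * (\<eta> k \<bullet> x - (1 / 3 - b k))) * ?G)"
        proof (rule Cs(2)[OF t tg gR])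
          show "\<eta> k \<bullet> x \<ge> 1 / 3 - b k" if "?g k x \<noteq> 0" for x using ga[OF that] by (simp add: a_def)
          show "?g k = (\<lambda>x. 0)" if "P = 0" using that by (simp add: diff_op_def fun_eq_iff)
          show "jet (M + 2 * CARD('n)) (?g k) x \<le> ?G" for x using jg[OF k, of x] by (simp add: M'_def)
        qed
      qed
      from bchoice[OF this] obtain h where hh: "\<forall>k\<in>{..<N}. smooth_on UNIV (h k) \<and> (\<forall>x. diff_op P (h k) x = ?g k x) \<and>
         (\<forall>x. norm x \<le> r1 \<longrightarrow> jet M (h k) x \<le> Cs * exp (t * (\<eta> k \<bullet> x - (1 / 3 - b k))) * ?G)"
        by (elim exE)
      have h: "smooth_on UNIV (h k)" "diff_op P (h k) x = ?g k x"
        "norm x \<le> r1 \<Longrightarrow> jet M (h k) x \<le> Cs * exp (t * (\<eta> k \<bullet> x - (1 / 3 - b k))) * ?G"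
        if "k < N" for k x
        using bspec[OF hh, of k] that by simp_all
      let ?h = "\<lambda>x. \<Sum>k<N. h k x"
      let ?w = "\<lambda>x. ?\<Phi> x - ?h x"
      have smh: "smooth_on UNIV ?h" by (rule smooth_on_sum[OF open_UNIV]) (use h(1) in auto)
      have smw: "smooth_on UNIV ?w" by (rule smooth_on_diff[OF open_UNIV sm\<Phi> smh])
      have Pw: "diff_op P ?w x = 0" for x
      proof -
        have "diff_op P ?w x = ?src x - (\<Sum>k<N. ?g k x)"
        proof -
          have "diff_op P ?h x = (\<Sum>k<N. diff_op P (h k) x)"
            by (rule diff_op_sum[OF open_UNIV]) (use h(1) in auto)
          also have "\<dots> = (\<Sum>k<N. ?g k x)" by (rule sum.cong[OF refl]) (use h(2) in simp)
          finally show ?thesis unfolding diff_op_diff[OF open_UNIV sm\<Phi> smh UNIV_I] by simp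
        qed
        \<comment> \<open>The sources \<open>?g k\<close> add up to \<open>?src\<close>, except for a term that vanishes on \<open>Q\<close> through
            \<open>?src\<close> and off \<open>Q\<close> through some \<open>\<phi> k\<close>.\<close>
        also have "(\<Sum>k<N. ?g k x) = (1 - (\<Prod>k<N. \<phi> k x)) * ?src x"
          unfolding sum_distrib_right[symmetric] \<psi>_def telescoping_partition ..
        also have "?src x - (1 - (\<Prod>k<N. \<phi> k x)) * ?src x = (\<Prod>k<N. \<phi> k x) * ?src x" by (simp add: algebra_simps)
        also have "\<dots> = 0"
        proof (cases "x \<in> Q")
          case False
          then obtain k where k: "k < N" "a k x \<ge> 2 / 3" by (auto simp: Q_def not_less)
          have "\<phi> k x = 0" unfolding \<phi>_def by (rule step_eq_0) (use k in \<open>simp add: a_def\<close>)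
          then have "(\<Prod>k<N. \<phi> k x) = 0" using k(1) by (intro prod_zero) auto
          then show ?thesis by simp
        qed (use g0Q in simp)
        finally show ?thesis .
      qed
      have NG: "real N * (Cs * ?G) = D / 2 * ?e" unfolding D_def e\<delta> by (simp add: mult_ac)
      have G0: "?G \<ge> 0" using c1 \<delta> by simp
      have jh: "jet M ?h x \<le> E * (D / 2 * ?e)" if x: "norm x \<le> r1" and E: "\<And>k. k < N \<Longrightarrow> exp (t * (a k x - 1 / 3)) \<le> E" for x E
      proof -
        have "jet M ?h x \<le> (\<Sum>k<N. jet M (h k) x)" by (rule jet_sum[OF open_UNIV]) (use h(1) in auto)
        also have "\<dots> \<le> (\<Sum>k<N. E * (Cs * ?G))"
        proof (rule sum_mono)
          fix k assume "k \<in> {..<N}"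
          then have k: "k < N" by simp
          have "jet M (h k) x \<le> Cs * exp (t * (\<eta> k \<bullet> x - (1 / 3 - b k))) * ?G" by (rule h(3)[OF k x])
          also have "\<dots> = exp (t * (a k x - 1 / 3)) * (Cs * ?G)" by (simp add: a_def algebra_simps)
          also have "\<dots> \<le> E * (Cs * ?G)" by (rule mult_right_mono[OF E[OF k]]) (use Cs(1) G0 in simp)
          finally show "jet M (h k) x \<le> E * (Cs * ?G)" .
        qed
        also have "\<dots> = E * (real N * (Cs * ?G))" by simp
        finally show ?thesis unfolding NG .
      qed
      have near: "jet m0 (\<lambda>x. f x - ?w x) x \<le> \<epsilon>" if x: "x \<in> K0" for x
      proof -
        have xQ: "x \<in> Q \<inter> O'" using x Q O' by auto
        have "jet m0 (\<lambda>x. f x - ?w x) x = jet m0 (\<lambda>x. (?F x - F' x) + ?h x) x"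
        proof (rule jet_cong_open[OF _ xQ])
          show "open (Q \<inter> O')" using Q(1) O'(1) by (rule open_Int)
          show "f y - ?w y = (?F y - F' y) + ?h y" if "y \<in> Q \<inter> O'" for y
            using \<theta>'1[of y] \<theta>1[of y] that by simp
        qed
        also have "\<dots> \<le> jet m0 (\<lambda>x. ?F x - F' x) x + jet m0 ?h x"
          by (rule jet_add[OF open_UNIV smooth_on_diff[OF open_UNIV smF F'(1)] smh UNIV_I])
        also have "jet m0 (\<lambda>x. ?F x - F' x) x \<le> \<epsilon> / 2"
        proof -
          have "Cm * \<delta> * S = (Cm * \<kappa> * S) * \<epsilon>" unfolding \<delta>_def by simp
          also have "\<dots> \<le> 1 / 2 * \<epsilon>" using \<kappa>C \<epsilon> by (intro mult_right_mono) auto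
          finally show ?thesis using F'(3)[of x] by simp
        qed
        also have "jet m0 ?h x \<le> \<epsilon> / 2"
        proof -
          have E: "exp (t * (a k x - 1 / 3)) \<le> 1 / T" if "k < N" for k
          proof -
            have "a k x \<le> 0" using poly(1)[OF that x] by (simp add: a_def)
            then have "t * (a k x - 1 / 3) \<le> t * (- 1 / 3)" using t by (intro mult_left_mono) auto
            also have "\<dots> = - ln T" by (simp add: t_def)
            finally have "exp (t * (a k x - 1 / 3)) \<le> exp (- ln T)" by simp
            also have "\<dots> = 1 / T" using T1 by (simp add: exp_minus inverse_eq_divide)
            finally show ?thesis .
          qed
          have "jet m0 ?h x \<le> jet M ?h x" by (rule jet_mono) (simp add: M_def)
          also have "\<dots> \<le> 1 / T * (D / 2 * ?e)" by (rule jh[OF _ E]) (use r1 x in auto)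
          also have "D / 2 * ?e = (\<epsilon> / 2) * (D * (1 / \<epsilon>) ^ (Md + 1))" using \<epsilon> by (simp add: field_simps)
          also have "1 / T * ((\<epsilon> / 2) * (D * (1 / \<epsilon>) ^ (Md + 1))) \<le> 1 / T * ((\<epsilon> / 2) * T)"
            using T1 \<epsilon> by (intro mult_left_mono) (auto simp: T_def)
          also have "\<dots> = \<epsilon> / 2" using T1 by simp
          finally show ?thesis .
        qed
        finally show ?thesis by simp
      qed
      have far: "jet m1 ?w x \<le> B * (1 / \<epsilon>) ^ s" if x: "x \<in> K1" for x
      proof -
        have e1: "1 / \<epsilon> \<ge> 1" using \<epsilon> by simp
        have E: "exp (t * (a k x - 1 / 3)) \<le> T ^ (3 * H)" if "k < N" for k
        proof -
          have "t * (a k x - 1 / 3) \<le> t * real H" using H[OF that x] t by (intro mult_left_mono) auto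
          also have "\<dots> = real (3 * H) * ln T" by (simp add: t_def)
          finally have "exp (t * (a k x - 1 / 3)) \<le> exp (real (3 * H) * ln T)" by simp
          also have "\<dots> = T ^ (3 * H)" using T1 by (subst exp_of_nat_mult) simp
          finally show ?thesis .
        qed
        have TT: "T ^ (3 * H) \<le> (1 + D) ^ (3 * H) * (1 / \<epsilon>) ^ ((Md + 1) * (3 * H))"
        proof -
          have "1 \<le> (1 / \<epsilon>) ^ (Md + 1)" by (rule one_le_power[OF e1])
          then have "T \<le> (1 + D) * (1 / \<epsilon>) ^ (Md + 1)" unfolding T_def distrib_right by simp
          then have "T ^ (3 * H) \<le> ((1 + D) * (1 / \<epsilon>) ^ (Md + 1)) ^ (3 * H)" using T1 by (intro power_mono) auto
          then show ?thesis by (simp only: power_mult_distrib power_mult)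
        qed
        have es: "?e \<le> (1 / \<epsilon>) ^ s" unfolding s_def by (rule power_increasing[OF _ e1]) simp
        have "jet m1 ?w x \<le> jet m1 ?\<Phi> x + jet m1 ?h x" by (rule jet_diff[OF open_UNIV sm\<Phi> smh UNIV_I])
        also have "jet m1 ?\<Phi> x \<le> jet Md ?\<Phi> x" by (rule jet_mono) (simp add: Md_def M'_def M_def)
        also have "jet Md ?\<Phi> x \<le> c2 * (1 / \<kappa>) ^ Md * ?e" using j\<Phi>[of x] unfolding e\<delta> by (simp add: mult_ac)
        also have "\<dots> \<le> c2 * (1 / \<kappa>) ^ Md * (1 / \<epsilon>) ^ s" using es c2 \<kappa>(1) by (intro mult_left_mono) auto
        also have "jet m1 ?h x \<le> jet M ?h x" by (rule jet_mono) (simp add: M_def)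
        also have "jet M ?h x \<le> T ^ (3 * H) * (D / 2 * ?e)" by (rule jh[OF _ E]) (use r1 x in auto)
        also have "\<dots> \<le> ((1 + D) ^ (3 * H) * (1 / \<epsilon>) ^ ((Md + 1) * (3 * H))) * (D / 2 * ?e)"
          by (rule mult_right_mono[OF TT]) (use D \<epsilon> in simp)
        also have "\<dots> = D / 2 * (1 + D) ^ (3 * H) * (1 / \<epsilon>) ^ s"
          unfolding s_def power_add[of "1 / \<epsilon>" Md] by (simp only: mult_ac)
        finally have "jet m1 ?w x \<le> (c2 * (1 / \<kappa>) ^ Md + D / 2 * (1 + D) ^ (3 * H)) * (1 / \<epsilon>) ^ s"
          by (simp add: distrib_right)
        also have "\<dots> \<le> B * (1 / \<epsilon>) ^ s" unfolding B_def using \<epsilon> by (intro mult_right_mono) auto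
        finally show ?thesis .
      qed
      show ?thesis by (intro exI[of _ ?w] conjI allI ballI smw Pw near far)
    qed
    show "\<exists>B s. B > 0 \<and> (s::nat) > 0 \<and> (\<forall>f \<epsilon>. smooth_on X f \<longrightarrow> (\<forall>x\<in>X. diff_op P f x = 0) \<longrightarrow>
       (\<forall>x\<in>L'. jet (Suc m0) f x \<le> 1) \<longrightarrow> 0 < \<epsilon> \<longrightarrow> \<epsilon> \<le> 1 \<longrightarrow>
       (\<exists>w. smooth_on UNIV w \<and> (\<forall>x. diff_op P w x = 0) \<and>
         (\<forall>x\<in>K0. jet m0 (\<lambda>x. f x - w x) x \<le> \<epsilon>) \<and> (\<forall>x\<in>K1. jet m1 w x \<le> B * (1 / \<epsilon>) ^ s)))"
      using main by (intro exI[of _ B] exI[of _ s] conjI allI impI B s)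
  qed
qed

section \<open>Neighbourhoods of zero\<close>

lemma zero_in_smooth_functions: "open X \<Longrightarrow> 0 \<in> smooth_functions X"
  unfolding smooth_functions_def zero_fun_def by (simp add: smooth_on_const)

text \<open>
  A basic open set may be centred at some \<open>f \<noteq> 0\<close>. By compactness the finitely many derivatives
  of \<open>f\<close> stay below \<open>e\<close> by a fixed margin, which is the radius of a ball around 0.
\<close>

lemma basic_nhd_contains_jet_ball:
  fixes X :: "(real^'n::finite) set"
  assumes f: "f \<in> smooth_functions X" and K: "compact K" "K \<subseteq> X" and e: "e > 0"
    and 0: "\<forall>js. length js \<le> m \<longrightarrow> (\<forall>x\<in>K. norm (iter_partial js 0 x - iter_partial js f x) < e)"
  obtains d where "d > 0" "{g \<in> smooth_functions X. \<forall>x\<in>K. jet m g x < d} \<subseteq>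
    {g \<in> smooth_functions X. \<forall>js. length js \<le> m \<longrightarrow> (\<forall>x\<in>K. norm (iter_partial js g x - iter_partial js f x) < e)}"
proof -
  let ?J = "{js :: 'n list. length js \<le> m}"
  have "\<exists>E. E < e \<and> (\<forall>x\<in>K. norm (iter_partial js f x) \<le> E)" if js: "js \<in> ?J" for js
  proof (cases "K = {}")
    case True
    then show ?thesis using e by (intro exI[of _ "e / 2"]) auto
  next
    case False
    have "continuous_on K (\<lambda>x. norm (iter_partial js f x))"
      using f K(2) by (intro continuous_on_norm continuous_on_subset[OF smooth_on_continuous])
        (auto simp: smooth_functions_def)
    from continuous_attains_sup[OF K(1) False this] obtain x where
      x: "x \<in> K" "\<forall>y\<in>K. norm (iter_partial js f y) \<le> norm (iter_partial js f x)" by blast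
    have "norm (iter_partial js f x) < e"
      using 0 js x(1) unfolding zero_fun_def by (auto simp: iter_partial_zero)
    then show ?thesis using x(2) by blast
  qed
  then obtain E where E: "\<And>js. js \<in> ?J \<Longrightarrow> E js < e" "\<And>js x. js \<in> ?J \<Longrightarrow> x \<in> K \<Longrightarrow> norm (iter_partial js f x) \<le> E js"
    by metis
  define d where "d = Min ((\<lambda>js. e - E js) ` ?J)"
  have ne: "?J \<noteq> {}" by (auto intro: exI[of _ "[]"])
  have d: "d > 0" unfolding d_def using E(1) ne finite_lists_le[where 'n='n and m=m] by (subst Min_gr_iff) auto
  have dle: "d \<le> e - E js" if "js \<in> ?J" for js
    unfolding d_def using that finite_lists_le[where 'n='n and m=m] by (intro Min_le) auto
  show ?thesis
  proof (rule that[OF d], intro subsetI CollectI conjI allI impI ballI)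
    fix g x and js :: "'n list"
    assume g: "g \<in> {g \<in> smooth_functions X. \<forall>x\<in>K. jet m g x < d}"
    then show "g \<in> smooth_functions X" by blast
    assume js: "length js \<le> m" and x: "x \<in> K"
    have "norm (iter_partial js g x) < d" using jet_ge[OF js, of g x] g x by fastforce
    moreover have "norm (iter_partial js f x) \<le> E js" using E(2)[of js x] js x by simp
    moreover have "d \<le> e - E js" using dle js by simp
    ultimately show "norm (iter_partial js g x - iter_partial js f x) < e"
      using norm_triangle_ineq4[of "iter_partial js g x" "iter_partial js f x"] by linarith
  qed
qed

lemma nhd_contains_jet_ball:
  fixes X :: "(real^'n::finite) set"
  assumes G: "openin (smooth_topology X) G" and 0: "0 \<in> G"
  shows "\<exists>K m d. compact K \<and> K \<subseteq> X \<and> d > 0 \<and> {g \<in> smooth_functions X. \<forall>x\<in>K. jet m g x < d} \<subseteq> G"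
proof -
  have "generate_topology_on {{g \<in> smooth_functions X.
         \<forall>js. length js \<le> m \<longrightarrow> (\<forall>x\<in>K. norm (iter_partial js g x - iter_partial js f x) < e)}
      | f K m e. f \<in> smooth_functions X \<and> compact K \<and> K \<subseteq> X \<and> e > (0::real)} G"
    using G unfolding smooth_topology_def openin_topology_generated_by_iff .
  then show ?thesis using 0
  proof induction
    case Empty
    then show ?case by simp
  next
    case (Int a b)
    then obtain K1 m1 d1 K2 m2 d2 where
      1: "compact K1" "K1 \<subseteq> X" "d1 > 0" "{g \<in> smooth_functions X. \<forall>x\<in>K1. jet m1 g x < d1} \<subseteq> a" and
      2: "compact K2" "K2 \<subseteq> X" "d2 > 0" "{g \<in> smooth_functions X. \<forall>x\<in>K2. jet m2 g x < d2} \<subseteq> b"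
      by blast
    have "{g \<in> smooth_functions X. \<forall>x\<in>K1 \<union> K2. jet (max m1 m2) g x < min d1 d2} \<subseteq> a \<inter> b"
    proof
      fix g assume g: "g \<in> {g \<in> smooth_functions X. \<forall>x\<in>K1 \<union> K2. jet (max m1 m2) g x < min d1 d2}"
      have "jet m1 g x < d1" if "x \<in> K1" for x
      proof -
        have "jet (max m1 m2) g x < min d1 d2" using g that by blast
        then show ?thesis using jet_mono[of m1 "max m1 m2" g x] by simp
      qed
      moreover have "jet m2 g x < d2" if "x \<in> K2" for x
      proof -
        have "jet (max m1 m2) g x < min d1 d2" using g that by blast
        then show ?thesis using jet_mono[of m2 "max m1 m2" g x] by simp
      qed
      ultimately show "g \<in> a \<inter> b" using g 1(4) 2(4) by blast
    qed
    then show ?case using 1 2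
      by (intro exI[of _ "K1 \<union> K2"] exI[of _ "max m1 m2"] exI[of _ "min d1 d2"]) (auto intro: compact_Un)
  next
    case (UN \<U>)
    then obtain k where k: "k \<in> \<U>" "0 \<in> k" by blast
    from UN.IH[OF k] show ?case using k(1) by (meson Union_upper order_trans)
  next
    case (Basis s)
    then obtain f K m e where s: "s = {g \<in> smooth_functions X.
         \<forall>js. length js \<le> m \<longrightarrow> (\<forall>x\<in>K. norm (iter_partial js g x - iter_partial js f x) < e)}"
      and f: "f \<in> smooth_functions X" "compact K" "K \<subseteq> X" "e > 0" by blast
    have "\<forall>js. length js \<le> m \<longrightarrow> (\<forall>x\<in>K. norm (iter_partial js 0 x - iter_partial js f x) < e)"
      using Basis.prems unfolding s by blast
    from basic_nhd_contains_jet_ball[OF f this] obtain d where "d > 0"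
      "{g \<in> smooth_functions X. \<forall>x\<in>K. jet m g x < d} \<subseteq> s" unfolding s by blast
    then show ?case using f by blast
  qed
qed

lemma kernel_nhd_contains_jet_ball:
  fixes P :: "'n::finite cpoly"
  assumes U: "U \<in> abs_convex_nhds0 fun_scale (kernel_topology P X)"
  shows "\<exists>K m d. compact K \<and> K \<subseteq> X \<and> d > 0 \<and> (\<forall>g\<in>kernel_space P X. (\<forall>x\<in>K. jet m g x < d) \<longrightarrow> g \<in> U)"
proof -
  obtain G where G: "openin (kernel_topology P X) G" "0 \<in> G" "G \<subseteq> U"
    using U unfolding abs_convex_nhds0_def by blast
  then obtain T where T: "openin (smooth_topology X) T" "G = T \<inter> kernel_space P X"
    unfolding kernel_topology_def openin_subtopology by blast
  then have "0 \<in> T" using G(2) by blast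
  from nhd_contains_jet_ball[OF T(1) this] obtain K m d where
    K: "compact K" "K \<subseteq> X" "d > 0" "{g \<in> smooth_functions X. \<forall>x\<in>K. jet m g x < d} \<subseteq> T" by blast
  have "g \<in> U" if "g \<in> kernel_space P X" "\<forall>x\<in>K. jet m g x < d" for g
  proof -
    have "g \<in> smooth_functions X" using that(1) by (simp add: kernel_space_def)
    then show ?thesis using K(4) T(2) G(3) that by blast
  qed
  then show ?thesis using K by blast
qed

lemma kernel_space_combination:
  assumes X: "open X" and f: "f \<in> kernel_space P X" and g: "g \<in> kernel_space P X"
  shows "(\<lambda>x. a * f x + b * g x) \<in> kernel_space P X"
proof -
  have fg: "smooth_on X f" "smooth_on X g" using f g by (auto simp: kernel_space_def smooth_functions_def)
  have "smooth_on X (\<lambda>x. a * f x + b * g x)" by (intro smooth_on_add smooth_on_cmult X fg)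
  moreover have "diff_op P (\<lambda>x. a * f x + b * g x) x = 0" if "x \<in> X" for x
    using diff_op_linear[OF X fg that, of P a b] f g that by (simp add: kernel_space_def)
  ultimately show ?thesis using f g by (auto simp: kernel_space_def smooth_functions_def)
qed

lemma jet_ball_is_nhd:
  fixes P :: "'n::finite cpoly"
  assumes X: "open X" and L: "compact L" "L \<subseteq> X"
  shows "{f \<in> kernel_space P X. \<forall>x\<in>L. jet m f x \<le> 1} \<in> abs_convex_nhds0 fun_scale (kernel_topology P X)"
proof -
  let ?V = "{f \<in> kernel_space P X. \<forall>x\<in>L. jet m f x \<le> 1}"
  let ?c = "num_words TYPE('n) m"
  have c: "?c > 0" using num_words_ge1[where 'n='n and m=m] by linarith
  have top: "topspace (kernel_topology P X) = kernel_space P X"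
    unfolding kernel_topology_def topspace_subtopology topspace_smooth_topology
    by (auto simp: kernel_space_def)
  have "absolutely_convex fun_scale ?V"
    unfolding absolutely_convex_def
  proof (intro ballI allI impI CollectI conjI)
    fix f g and a b :: complex
    assume f: "f \<in> ?V" and g: "g \<in> ?V" and ab: "norm a + norm b \<le> 1"
    have eq: "fun_scale a f + fun_scale b g = (\<lambda>x. a * f x + b * g x)"
      by (simp add: fun_scale_def plus_fun_def)
    show "fun_scale a f + fun_scale b g \<in> kernel_space P X"
      unfolding eq using kernel_space_combination[OF X] f g by blast
    fix x assume x: "x \<in> L"
    then have xX: "x \<in> X" using L by blast
    have fg: "smooth_on X f" "smooth_on X g" using f g by (auto simp: kernel_space_def smooth_functions_def)
    have "jet m (\<lambda>x. a * f x + b * g x) x \<le> norm a * jet m f x + norm b * jet m g x"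
      using jet_add[OF X smooth_on_cmult[OF X fg(1)] smooth_on_cmult[OF X fg(2)] xX, of m a b]
      unfolding jet_cmult[OF X fg(1) xX] jet_cmult[OF X fg(2) xX] .
    also have "\<dots> \<le> norm a * 1 + norm b * 1"
      using f g x by (intro add_mono mult_left_mono) auto
    finally show "jet m (fun_scale a f + fun_scale b g) x \<le> 1" unfolding eq using ab by simp
  qed
  moreover have "\<exists>G. openin (kernel_topology P X) G \<and> 0 \<in> G \<and> G \<subseteq> ?V"
  proof -
    let ?B = "{g \<in> smooth_functions X. \<forall>js. length js \<le> m \<longrightarrow>
      (\<forall>x\<in>L. norm (iter_partial js g x - iter_partial js 0 x) < 1 / ?c)}"
    have "openin (smooth_topology X) ?B"
      unfolding smooth_topology_def
      by (rule topology_generated_by_Basis)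
         (use L c zero_in_smooth_functions[OF X] in \<open>auto intro!: exI[of _ "0 :: real^'n \<Rightarrow> complex"] exI[of _ L] exI[of _ m] exI[of _ "1 / ?c"]\<close>)
    then have "openin (kernel_topology P X) (?B \<inter> kernel_space P X)"
      unfolding kernel_topology_def openin_subtopology by blast
    moreover have "0 \<in> ?B \<inter> kernel_space P X"
      using c zero_in_smooth_functions[OF X] by (auto simp: kernel_space_def zero_fun_def diff_op_zero)
    moreover have "?B \<inter> kernel_space P X \<subseteq> ?V"
    proof
      fix g assume g: "g \<in> ?B \<inter> kernel_space P X"
      have "jet m g x \<le> 1" if x: "x \<in> L" for x
      proof -
        have "norm (iter_partial js g x) \<le> 1 / ?c" if "length js \<le> m" for js
          using g x that by (force simp: zero_fun_def iter_partial_zero)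
        from jet_le[of m g x "1 / ?c", OF this] show ?thesis using c by simp
      qed
      then show "g \<in> ?V" using g by blast
    qed
    ultimately show ?thesis by blast
  qed
  ultimately show ?thesis unfolding abs_convex_nhds0_def top by blast
qed

theorem theorem4p2:
  fixes P :: "'n::finite cpoly" and X :: "(real^'n) set"
  assumes "open X" and "convex X"
  shows "satisfies_Omega fun_scale (kernel_topology P X)"
  unfolding satisfies_Omega_def
proof
  note X = assms
  fix U assume "U \<in> abs_convex_nhds0 fun_scale (kernel_topology P X)"
  from kernel_nhd_contains_jet_ball[OF this] obtain K0 m0 d0 where
    K0: "compact K0" "K0 \<subseteq> X" and d0: "d0 > 0"
    and U: "\<And>g. g \<in> kernel_space P X \<Longrightarrow> \<forall>x\<in>K0. jet m0 g x < d0 \<Longrightarrow> g \<in> U" by blast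
  obtain L where L: "compact L" "L \<subseteq> X"
    and dec: "\<And>K1 m1. compact K1 \<Longrightarrow> \<exists>B s. B > 0 \<and> (s::nat) > 0 \<and> (\<forall>f \<epsilon>. smooth_on X f \<longrightarrow> (\<forall>x\<in>X. diff_op P f x = 0) \<longrightarrow>
       (\<forall>x\<in>L. jet (Suc m0) f x \<le> 1) \<longrightarrow> 0 < \<epsilon> \<longrightarrow> \<epsilon> \<le> 1 \<longrightarrow>
       (\<exists>w. smooth_on UNIV w \<and> (\<forall>x. diff_op P w x = 0) \<and>
         (\<forall>x\<in>K0. jet m0 (\<lambda>x. f x - w x) x \<le> \<epsilon>) \<and> (\<forall>x\<in>K1. jet m1 w x \<le> B * (1 / \<epsilon>) ^ s)))"
    by (rule solution_decomposition[OF X K0, of P m0], rule that, assumption, assumption, assumption)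
  let ?V = "{f \<in> kernel_space P X. \<forall>x\<in>L. jet (Suc m0) f x \<le> 1}"
  show "\<exists>V\<in>abs_convex_nhds0 fun_scale (kernel_topology P X). \<forall>W\<in>abs_convex_nhds0 fun_scale (kernel_topology P X).
        \<exists>C s :: real. C > 0 \<and> s > 0 \<and> (\<forall>\<epsilon>\<in>{0<..<1}.
             V \<subseteq> {fun_scale (of_real \<epsilon>) u + fun_scale (of_real (C / \<epsilon> powr s)) w | u w. u \<in> U \<and> w \<in> W})"
  proof (rule bexI[where x = ?V], rule ballI)
    show "?V \<in> abs_convex_nhds0 fun_scale (kernel_topology P X)" by (rule jet_ball_is_nhd[OF X(1) L])
    fix W assume "W \<in> abs_convex_nhds0 fun_scale (kernel_topology P X)"
    from kernel_nhd_contains_jet_ball[OF this] obtain K1 m1 d1 where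
      K1: "compact K1" "K1 \<subseteq> X" and d1: "d1 > 0"
      and W: "\<And>g. g \<in> kernel_space P X \<Longrightarrow> \<forall>x\<in>K1. jet m1 g x < d1 \<Longrightarrow> g \<in> W" by blast
    from dec[OF K1(1), of m1] obtain B and s :: nat where B: "B > 0" and s: "s > 0"
      and split: "\<And>f \<epsilon>. smooth_on X f \<Longrightarrow> \<forall>x\<in>X. diff_op P f x = 0 \<Longrightarrow>
       \<forall>x\<in>L. jet (Suc m0) f x \<le> 1 \<Longrightarrow> 0 < \<epsilon> \<Longrightarrow> \<epsilon> \<le> 1 \<Longrightarrow>
       \<exists>w. smooth_on UNIV w \<and> (\<forall>x. diff_op P w x = 0) \<and>
         (\<forall>x\<in>K0. jet m0 (\<lambda>x. f x - w x) x \<le> \<epsilon>) \<and> (\<forall>x\<in>K1. jet m1 w x \<le> B * (1 / \<epsilon>) ^ s)" by blast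
    \<comment> \<open>Decomposing with \<open>\<epsilon> * \<kappa>\<close> instead of \<open>\<epsilon>\<close> puts the small part, divided by \<open>\<epsilon>\<close>, into the open
        jet ball inside \<open>U\<close>; the resulting factor \<open>(1 / \<kappa>) ^ s\<close> is absorbed by \<open>C\<close>.\<close>
    define \<kappa> where "\<kappa> = min (d0 / 2) 1"
    have \<kappa>: "\<kappa> > 0" "\<kappa> \<le> 1" "\<kappa> < d0" using d0 by (auto simp: \<kappa>_def)
    define C where "C = (B * (1 / \<kappa>) ^ s + 1) / d1"
    have C: "C > 0" unfolding C_def using B d1 \<kappa>(1) by (intro divide_pos_pos add_nonneg_pos) auto
    have Cd: "B * (1 / \<kappa>) ^ s < C * d1" unfolding C_def using d1 by simp
    have "?V \<subseteq> {fun_scale (of_real \<epsilon>) u + fun_scale (of_real (C / \<epsilon> powr real s)) w | u w. u \<in> U \<and> w \<in> W}"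
      if "\<epsilon> \<in> {0<..<1}" for \<epsilon>
    proof
      have \<epsilon>: "0 < \<epsilon>" "\<epsilon> < 1" using that by auto
      have pw: "\<epsilon> powr real s = \<epsilon> ^ s" using \<epsilon> by (rule_tac powr_realpow)
      fix f assume f: "f \<in> ?V"
      have fX: "smooth_on X f" "\<And>x. x \<notin> X \<Longrightarrow> f x = 0" "\<forall>x\<in>X. diff_op P f x = 0"
        and fk: "f \<in> kernel_space P X"
        using f by (auto simp: kernel_space_def smooth_functions_def)
      have \<epsilon>\<kappa>: "0 < \<epsilon> * \<kappa>" "\<epsilon> * \<kappa> \<le> 1" using \<epsilon> \<kappa> mult_le_one[of \<epsilon> \<kappa>] by auto
      obtain w where w: "smooth_on UNIV w" "\<And>x. diff_op P w x = 0"
        "\<And>x. x \<in> K0 \<Longrightarrow> jet m0 (\<lambda>x. f x - w x) x \<le> \<epsilon> * \<kappa>"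
        "\<And>x. x \<in> K1 \<Longrightarrow> jet m1 w x \<le> B * (1 / (\<epsilon> * \<kappa>)) ^ s"
        using split[OF fX(1,3) _ \<epsilon>\<kappa>] f by blast
      \<comment> \<open>Elements of \<open>kernel_space P X\<close> vanish outside \<open>X\<close> by definition.\<close>
      define w' where "w' x = (if x \<in> X then w x else 0)" for x
      have ww: "w' x = w x" if "x \<in> X" for x using that by (simp add: w'_def)
      have wX: "smooth_on X w" by (rule smooth_on_subset[OF w(1) subset_UNIV])
      have smw': "smooth_on X w'" by (rule smooth_on_cong[OF X(1) wX]) (simp add: ww)
      have wk: "w' \<in> kernel_space P X"
      proof -
        have "diff_op P w' x = 0" if "x \<in> X" for x
        proof -
          have "diff_op P w x = diff_op P w' x"
            by (rule diff_op_cong_open[OF X(1) wX that]) (simp add: ww)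
          then show ?thesis using w(2) by simp
        qed
        moreover have "w' x = 0" if "x \<notin> X" for x using that by (simp add: w'_def)
        ultimately show ?thesis using smw' by (simp add: kernel_space_def smooth_functions_def)
      qed
      let ?u = "\<lambda>x. of_real (1 / \<epsilon>) * f x + of_real (- (1 / \<epsilon>)) * w' x"
      let ?v = "\<lambda>x. of_real (\<epsilon> ^ s / C) * w' x + 0 * w' x"
      have uk: "?u \<in> kernel_space P X" "?v \<in> kernel_space P X"
        by (rule kernel_space_combination[OF X(1) fk wk], rule kernel_space_combination[OF X(1) wk wk])
      have "?u \<in> U"
      proof (rule U[OF uk(1)], rule ballI)
        fix x assume x: "x \<in> K0"
        then have xX: "x \<in> X" using K0 by blast
        have "jet m0 ?u x = jet m0 (\<lambda>x. of_real (1 / \<epsilon>) * (f x - w x)) x"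
          by (rule jet_cong_open[OF X(1) xX]) (simp add: ww algebra_simps)
        also have "\<dots> = norm (complex_of_real (1 / \<epsilon>)) * jet m0 (\<lambda>x. f x - w x) x"
          by (rule jet_cmult[OF X(1) smooth_on_diff[OF X(1) fX(1) wX] xX])
        also have "\<dots> \<le> norm (complex_of_real (1 / \<epsilon>)) * (\<epsilon> * \<kappa>)"
          by (rule mult_left_mono[OF w(3)[OF x]]) simp
        also have "\<dots> = \<kappa>" unfolding norm_of_real using \<epsilon> by simp
        finally show "jet m0 ?u x < d0" using \<kappa>(3) by simp
      qed
      moreover have "?v \<in> W"
      proof (rule W[OF uk(2)], rule ballI)
        fix x assume x: "x \<in> K1"
        then have xX: "x \<in> X" using K1 by blast
        have "jet m1 ?v x = jet m1 (\<lambda>x. of_real (\<epsilon> ^ s / C) * w x) x"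
          by (rule jet_cong_open[OF X(1) xX]) (simp add: ww)
        also have "\<dots> = norm (complex_of_real (\<epsilon> ^ s / C)) * jet m1 w x"
          by (rule jet_cmult[OF X(1) wX xX])
        also have "\<dots> \<le> norm (complex_of_real (\<epsilon> ^ s / C)) * (B * (1 / (\<epsilon> * \<kappa>)) ^ s)"
          by (rule mult_left_mono[OF w(4)[OF x]]) simp
        also have "\<dots> = (B * (1 / \<kappa>) ^ s) / C"
          unfolding norm_of_real using \<epsilon> C by (simp add: power_divide power_mult_distrib)
        also have "\<dots> < d1" using Cd C by (simp add: divide_less_eq mult.commute)
        finally show "jet m1 ?v x < d1" .
      qed
      moreover have "f = fun_scale (of_real \<epsilon>) ?u + fun_scale (of_real (C / \<epsilon> powr real s)) ?v"
      proof
        fix x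
        have "(fun_scale (of_real \<epsilon>) ?u + fun_scale (of_real (C / \<epsilon> powr real s)) ?v) x =
          of_real (\<epsilon> * (1 / \<epsilon>)) * (f x - w' x) + of_real ((C / \<epsilon> ^ s) * (\<epsilon> ^ s / C)) * w' x"
          unfolding fun_scale_def plus_fun_def pw by (simp add: algebra_simps)
        also have "\<epsilon> * (1 / \<epsilon>) = 1" using \<epsilon> by simp
        also have "(C / \<epsilon> ^ s) * (\<epsilon> ^ s / C) = 1" using \<epsilon> C by simp
        finally show "f x = (fun_scale (of_real \<epsilon>) ?u + fun_scale (of_real (C / \<epsilon> powr real s)) ?v) x" by simp
      qed
      ultimately show "f \<in> {fun_scale (of_real \<epsilon>) u + fun_scale (of_real (C / \<epsilon> powr real s)) w | u w. u \<in> U \<and> w \<in> W}"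
        by blast
    qed
    then show "\<exists>C s :: real. C > 0 \<and> s > 0 \<and> (\<forall>\<epsilon>\<in>{0<..<1}.
             ?V \<subseteq> {fun_scale (of_real \<epsilon>) u + fun_scale (of_real (C / \<epsilon> powr s)) w | u w. u \<in> U \<and> w \<in> W})"
      using C s by (intro exI[of _ C] exI[of _ "real s"]) simp
  qed
qed

end
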